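(* Let $1<p\le q<\infty$, $0<\alpha<n$, let $m\ge1$ be an integer and $\mathbf b=(b_1,\ldots,b_m)\in BMO(\mathbb R^n)^m$. Suppose $s\in[p,q]$ and $\delta>0$, and $(u,v)$ is a pair of weights such that $$\hat{\mathsf K}_\alpha=\sup_Q|Q|^{\frac\alpha n+\frac1q-\frac1p}\|u^{\frac1q}\|_{L^q(\log L)^{(m+\frac1{s'})q+\delta},Q}\,\|v^{-\frac1p}\|_{L^{p'}(\log L)^{(m+\frac1s)p'+\delta},Q}<\infty,$$ the supremum being over all cubes $Q$. Then $$\|I_{\alpha,\mathbf b}f\|_{L^q(u)}\lesssim\hat{\mathsf K}_\alpha\prod_{j=1}^m\|b_j\|_{BMO}\,\|f\|_{L^p(v)}.$$
   Context: A weight is a nonnegative locally integrable function; for a pair $(u,v)$, $u$ is positive on a set of positive measure and $v$ is positive a.e. For a Young function $A$ and cube $Q$, $\|f\|_{A,Q}=\inf\{\lambda>0:\frac1{|Q|}\int_QA(|f|/\lambda)\le1\}$; $\|f\|_{L^r(\log L)^a,Q}$ denotes this with $A(t)=t^r\log(e+t)^a$; $r'=r/(r-1)$. $\|b\|_{BMO}=\sup_Q\frac1{|Q|}\int_Q|b-b_Q|$, $b_Q=\frac1{|Q|}\int_Qb$. $I_\alpha f(x)=\int\frac{f(y)}{|x-y|^{n-\alpha}}dy$ and $I_{\alpha,\mathbf b}f(x)=\int\prod_{j=1}^m(b_j(x)-b_j(y))\frac{f(y)}{|x-y|^{n-\alpha}}dy$ (the iterated commutator $[b_m,[\ldots[b_1,I_\alpha]\ldots]]$).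 *)

theory Defs
  imports "HOL-Analysis.Analysis"
begin

(* Axis-parallel cubes in R^n (closed; open/closed makes no difference) *)
definition cube :: "(real ^ 'n :: finite) set \<Rightarrow> bool" where
  "cube Q \<longleftrightarrow> (\<exists>a r. r > 0 \<and> Q = cbox a (a + (\<chi> i. r)))"

definition locally_integrable :: "(real ^ 'n :: finite \<Rightarrow> real) \<Rightarrow> bool" where
  "locally_integrable g \<longleftrightarrow> (\<forall>K. compact K \<longrightarrow> set_integrable lebesgue K g)"

definition weight :: "(real ^ 'n :: finite \<Rightarrow> real) \<Rightarrow> bool" where
  "weight w \<longleftrightarrow> (\<forall>x. w x \<ge> 0) \<and> locally_integrable w"

(* Luxemburg norm ||f||_{A,Q}; the infimum of the empty set is \<infinity> *)
definition lux_norm :: "(real \<Rightarrow> real) \<Rightarrow> (real ^ 'n :: finite \<Rightarrow> real) \<Rightarrow> (real ^ 'n) set \<Rightarrow> ennreal" where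
  "lux_norm A f Q = Inf (ennreal ` {t::real. t > 0 \<and>
      ennreal (1 / measure lebesgue Q) * (\<integral>\<^sup>+ x \<in> Q. ennreal (A (\<bar>f x\<bar> / t)) \<partial>lebesgue) \<le> 1})"

definition LlogL :: "real \<Rightarrow> real \<Rightarrow> real \<Rightarrow> real" where
  "LlogL r a t = t powr r * (ln (exp 1 + t)) powr a"

definition bmo_norm :: "(real ^ 'n :: finite \<Rightarrow> real) \<Rightarrow> ennreal" where
  "bmo_norm b = (SUP Q \<in> Collect cube.
     ennreal (1 / measure lebesgue Q) *
     (\<integral>\<^sup>+ x \<in> Q. ennreal \<bar>b x - (1 / measure lebesgue Q) * (LINT y:Q|lebesgue. b y)\<bar> \<partial>lebesgue))"

definition in_BMO :: "(real ^ 'n :: finite \<Rightarrow> real) \<Rightarrow> bool" where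
  "in_BMO b \<longleftrightarrow> locally_integrable b \<and> bmo_norm b < \<infinity>"

definition Lp_w_norm :: "real \<Rightarrow> (real ^ 'n :: finite \<Rightarrow> real) \<Rightarrow> (real ^ 'n \<Rightarrow> real) \<Rightarrow> ennreal" where
  "Lp_w_norm p w g = (let I = (\<integral>\<^sup>+ x. ennreal (\<bar>g x\<bar> powr p * w x) \<partial>lebesgue)
     in if I = \<infinity> then \<infinity> else ennreal ((enn2real I) powr (1 / p)))"

definition frac_comm :: "real \<Rightarrow> nat \<Rightarrow> (nat \<Rightarrow> real ^ 'n :: finite \<Rightarrow> real) \<Rightarrow> (real ^ 'n \<Rightarrow> real) \<Rightarrow> real ^ 'n \<Rightarrow> real" where
  "frac_comm \<alpha> m b f x = (\<integral> y. (\<Prod>j\<in>{1..m}. b j x - b j y) * f y / dist x y powr (real CARD('n) - \<alpha>) \<partial>lebesgue)"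

definition conj_exp :: "real \<Rightarrow> real" where
  "conj_exp r = r / (r - 1)"

definition K_hat :: "real \<Rightarrow> real \<Rightarrow> real \<Rightarrow> nat \<Rightarrow> real \<Rightarrow> real \<Rightarrow> (real ^ 'n :: finite \<Rightarrow> real) \<Rightarrow> (real ^ 'n \<Rightarrow> real) \<Rightarrow> ennreal" where
  "K_hat \<alpha> p q m s \<delta> u v = (SUP Q \<in> Collect (cube :: (real ^ 'n) set \<Rightarrow> bool).
     ennreal (measure lebesgue Q powr (\<alpha> / real CARD('n) + 1 / q - 1 / p)) *
     lux_norm (LlogL q ((real m + 1 / conj_exp s) * q + \<delta>)) (\<lambda>x. u x powr (1 / q)) Q *
     lux_norm (LlogL (conj_exp p) ((real m + 1 / s) * conj_exp p + \<delta>)) (\<lambda>x. v x powr (- 1 / p)) Q)"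

end

theory Submission
  imports Defs
begin

text \<open>
  Expand the kernel over finitely many shifted dyadic grids (one-third trick). On a cube \<open>Q\<close> all
  factors \<open>b\<^sub>j(x) - b\<^sub>j(y)\<close> are controlled by \<open>D\<^sub>Q(x) D\<^sub>Q(y)\<close>, where
  \<open>D\<^sub>Q = 1 + \<Sum>\<^sub>j |b\<^sub>j - (b\<^sub>j)\<^sub>Q| / \<parallel>b\<^sub>j\<parallel>\<close>; this turns the bilinear form into
  \<open>\<Sum>\<^sub>Q |Q|\<^bsup>\<alpha>/n-1\<^esup> (\<integral>\<^sub>Q D\<^sub>Q\<^bsup>m\<^esup> f) (\<integral>\<^sub>Q D\<^sub>Q\<^bsup>m\<^esup> g)\<close>. Passing from a cube to a subcube \<open>l\<close> generations
  below costs only a factor \<open>(1 + K l)\<^bsup>m\<^esup>\<close>, which \<open>\<alpha> > 0\<close> absorbs, so the sum reduces to a family of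
  cubes satisfying a Carleson packing condition. On these, Young's inequality together with the
  exponential integrability of \<open>D\<^sub>Q\<close> (John--Nirenberg) splits off the two bumped Luxemburg norms, hence
  \<open>K\<close>, and leaves Orlicz averages of \<open>F = f v\<^bsup>1/p\<^esup>\<close> and of the dual function. Their Carleson sums are
  bounded \<open>L\<^bsup>p\<^esup> \<rightarrow> \<ell>\<^bsup>s\<^esup>\<close> and \<open>L\<^bsup>q'\<^esup> \<rightarrow> \<ell>\<^bsup>s'\<^esup>\<close> respectively, which is exactly what the logarithmic
  exponents in the hypothesis provide, and Hoelder's inequality with \<open>s\<close> and \<open>s'\<close> concludes.
\<close>

section \<open>Dyadic grids\<close>

text \<open>The bound |b(x) - b(y)| \<le> |b(x) - b_Q| + |b(y) - b_Q| would produce 2^m mixed terms.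
  Since D_Q \<ge> 1, a sum of two of its values is at most twice their product, so all terms are
  treated at once; the price, a full power m on both sides, is the m in both logarithmic exponents.
  The other logarithms come from duality: t^p log^(-\<kappa>) is paired with t^(p')
  log^(\<kappa>/(p-1)), the level sums converge for \<kappa> > p/s, and \<kappa> = p/s +
  \<delta>(p-1) gives p'/s + \<delta>. Three obstacles shape the argument. The grids depend on the
  truncation of the kernel, so constants are fixed before the grid, the bilinear form runs over
  finite families, and the limit is left to Fatou's lemma. Luxemburg infima need not be attained and
  0 * \<infinity> = 0 may hide an infinite norm in the bump product, so the hypothesis is converted
  into admissible heights on each cube, with a factor 2 to spare. Symbols of zero seminorm cannot be
  normalised and are treated apart.\<close>

type_synonym 'n dindex = "int \<times> ('n \<Rightarrow> int)"

definition dside :: "'n dindex \<Rightarrow> real" where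
  "dside Q = 2 powr real_of_int (fst Q)"

definition dvol :: "'n::finite dindex \<Rightarrow> real" where
  "dvol Q = dside Q ^ CARD('n)"

text \<open>One translate \<tau> serves all levels, which keeps the grid exactly nested. Floors make
  the cubes half open, hence disjoint within a level, and turn the passage to a coarser level into
  integer division.\<close>

definition dcube :: "real ^ 'n :: finite \<Rightarrow> 'n dindex \<Rightarrow> (real ^ 'n) set" where
  "dcube \<tau> Q = {x. \<forall>i. \<lfloor>(x $ i - \<tau> $ i) / dside Q\<rfloor> = snd Q i}"

definition dat :: "real ^ 'n :: finite \<Rightarrow> int \<Rightarrow> real ^ 'n \<Rightarrow> 'n dindex" where
  "dat \<tau> k x = (k, \<lambda>i. \<lfloor>(x $ i - \<tau> $ i) / 2 powr real_of_int k\<rfloor>)"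

definition dsub :: "real ^ 'n :: finite \<Rightarrow> 'n dindex \<Rightarrow> 'n dindex \<Rightarrow> bool" where
  "dsub \<tau> Q P \<longleftrightarrow> fst Q \<le> fst P \<and> dcube \<tau> Q \<subseteq> dcube \<tau> P"

lemma dside_pos [simp]: "dside Q > 0" "dside Q \<ge> 0" "dside Q \<noteq> 0"
  by (auto simp: dside_def)

lemma dvol_pos [simp]: "dvol Q > 0" "dvol Q \<ge> 0" "dvol Q \<noteq> 0"
  by (auto simp: dvol_def)

lemma dvol_powr: "dvol (Q :: 'n::finite dindex) = dside Q powr real CARD('n)"
  by (simp add: dvol_def powr_realpow)

lemma mem_dcube_iff:
  "x \<in> dcube \<tau> Q \<longleftrightarrow> (\<forall>i. \<tau> $ i + dside Q * snd Q i \<le> x $ i \<and> x $ i < \<tau> $ i + dside Q * (snd Q i + 1))"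
proof -
  have "\<lfloor>(x $ i - \<tau> $ i) / dside Q\<rfloor> = snd Q i \<longleftrightarrow>
     \<tau> $ i + dside Q * snd Q i \<le> x $ i \<and> x $ i < \<tau> $ i + dside Q * (snd Q i + 1)" for i
    unfolding floor_eq_iff using dside_pos(1)[of Q]
    by (simp add: pos_le_divide_eq pos_divide_less_eq algebra_simps)
  then show ?thesis by (auto simp: dcube_def)
qed

lemma dside_dat [simp]: "dside (dat \<tau> k x) = 2 powr real_of_int k" "fst (dat \<tau> k x) = k"
  by (auto simp: dside_def dat_def)

lemma mem_dcube_dat [simp]: "x \<in> dcube \<tau> (dat \<tau> k x)"
  by (simp add: dcube_def) (simp add: dat_def)

lemma mem_dcube_iff_dat: "x \<in> dcube \<tau> Q \<longleftrightarrow> Q = dat \<tau> (fst Q) x"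
  by (auto simp: dcube_def dat_def dside_def prod_eq_iff)

text \<open>With \<open>dside P = 2 ^ l * dside Q\<close> the coordinates of P are the integer
  quotients by \<open>2 ^ l\<close> of those of Q, so one common point already determines the
  ancestor of the whole cube.\<close>

lemma dcube_nested:
  assumes "fst Q \<le> fst P" "x \<in> dcube \<tau> Q" "x \<in> dcube \<tau> P"
  shows "dcube \<tau> Q \<subseteq> dcube \<tau> P"
proof -
  define l where "l = nat (fst P - fst Q)"
  have "dside P = 2 powr real_of_int (fst Q) * 2 powr (real l)"
    using assms(1) by (simp add: dside_def l_def flip: powr_add)
  then have s: "dside P = dside Q * real_of_int (2 ^ l)"
    by (simp add: dside_def powr_realpow)
  have *: "\<lfloor>y / dside P\<rfloor> = \<lfloor>y / dside Q\<rfloor> div 2 ^ l" for y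
  proof -
    have "y / dside P = (y / dside Q) / real_of_int (2 ^ l)" unfolding s by simp
    then show ?thesis using floor_divide_real_eq_div[of "2^l" "y / dside Q"] by (simp only:) simp
  qed
  show ?thesis using assms(2,3) unfolding dcube_def by (auto simp: *)
qed

lemma dsub_refl [simp]: "dsub \<tau> Q Q"
  by (simp add: dsub_def)

lemma dsub_trans: "dsub \<tau> Q P \<Longrightarrow> dsub \<tau> P R \<Longrightarrow> dsub \<tau> Q R"
  by (auto simp: dsub_def)

lemma dcube_nonempty: "\<exists>x. x \<in> dcube \<tau> Q"
proof -
  have "(\<chi> i. \<tau> $ i + dside Q * snd Q i) \<in> dcube \<tau> Q"
    by (simp add: mem_dcube_iff)
  then show ?thesis by blast
qed

lemma dsub_level_eq: "dsub \<tau> Q P \<Longrightarrow> fst Q = fst P \<Longrightarrow> Q = P"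
  using dcube_nonempty[of \<tau> Q] by (metis dsub_def mem_dcube_iff_dat subsetD)

lemma dcube_meet_dsub:
  "x \<in> dcube \<tau> Q \<Longrightarrow> x \<in> dcube \<tau> P \<Longrightarrow> fst Q \<le> fst P \<Longrightarrow> dsub \<tau> Q P"
  unfolding dsub_def by (intro conjI dcube_nested[of Q P x \<tau>])

lemma dcube_meet_cases:
  assumes "x \<in> dcube \<tau> Q" "x \<in> dcube \<tau> P"
  shows "dsub \<tau> Q P \<or> dsub \<tau> P Q"
  using assms dcube_meet_dsub linorder_linear by metis

text \<open>BMO norms and the bump condition are suprema over closed cubes, whereas disjointness
  needs half-open ones. The closure, written in the form required by \<open>cube\<close>, mediates;
  it differs from \<open>dcube\<close> by a null set.\<close>

definition dclosed :: "real ^ 'n :: finite \<Rightarrow> 'n dindex \<Rightarrow> (real ^ 'n) set" where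
  "dclosed \<tau> Q = cbox (\<chi> i. \<tau> $ i + dside Q * snd Q i) ((\<chi> i. \<tau> $ i + dside Q * snd Q i) + (\<chi> i. dside Q))"

lemma cube_dclosed: "cube (dclosed \<tau> Q)"
  unfolding cube_def dclosed_def by (intro exI conjI) auto

lemma dcube_subset_dclosed: "dcube \<tau> Q \<subseteq> dclosed \<tau> Q"
  by (auto simp: dclosed_def mem_box_cart mem_dcube_iff algebra_simps less_imp_le)

lemma measure_dclosed: "measure lebesgue (dclosed \<tau> (Q :: 'n::finite dindex)) = dvol Q"
proof -
  have "dclosed \<tau> Q \<noteq> {}"
    using dcube_nonempty[of \<tau> Q] dcube_subset_dclosed[of \<tau> Q] by blast
  then show ?thesis unfolding dclosed_def
    by (simp add: content_cbox_cart dvol_def)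
qed

lemma emeasure_dclosed: "emeasure lebesgue (dclosed \<tau> (Q :: 'n::finite dindex)) = ennreal (dvol Q)"
proof -
  have "emeasure lebesgue (dclosed \<tau> Q) \<noteq> top"
    using emeasure_lborel_cbox_finite by (simp add: dclosed_def less_top)
  then have "emeasure lebesgue (dclosed \<tau> Q) = ennreal (measure lebesgue (dclosed \<tau> Q))"
    by (rule emeasure_eq_ennreal_measure)
  then show ?thesis unfolding measure_dclosed .
qed

lemma box_subset_dcube:
  "box (\<chi> i. \<tau> $ i + dside Q * snd Q i) ((\<chi> i. \<tau> $ i + dside Q * snd Q i) + (\<chi> i. dside Q)) \<subseteq> dcube \<tau> Q"
  by (auto simp: mem_box_cart mem_dcube_iff algebra_simps less_imp_le)

lemma null_dclosed_diff: "dclosed \<tau> (Q :: 'n::finite dindex) - dcube \<tau> Q \<in> null_sets lebesgue"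
proof -
  let ?a = "(\<chi> i. \<tau> $ i + dside Q * snd Q i) :: real ^ 'n" and ?r = "(\<chi> i. dside Q) :: real ^ 'n"
  have "negligible (cbox ?a (?a + ?r) - box ?a (?a + ?r))"
    by (rule negligible_frontier_interval)
  then show ?thesis
    using box_subset_dcube[of \<tau> Q] unfolding dclosed_def negligible_iff_null_sets
    by (meson Diff_mono negligible_iff_null_sets negligible_subset order_refl)
qed

lemma sets_dcube [measurable, simp]: "dcube \<tau> Q \<in> sets lebesgue"
proof -
  have "dcube \<tau> Q = dclosed \<tau> Q - (dclosed \<tau> Q - dcube \<tau> Q)"
    using dcube_subset_dclosed[of \<tau> Q] by blast
  moreover have "dclosed \<tau> Q - dcube \<tau> Q \<in> sets lebesgue"
    using null_dclosed_diff by blast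
  moreover have "dclosed \<tau> Q \<in> sets lebesgue" by (simp add: dclosed_def)
  ultimately show ?thesis by (metis sets.Diff)
qed

lemma sets_dclosed [measurable, simp]: "dclosed \<tau> Q \<in> sets lebesgue"
  by (simp add: dclosed_def)

lemma emeasure_dcube [simp]: "emeasure lebesgue (dcube \<tau> (Q :: 'n::finite dindex)) = ennreal (dvol Q)"
proof -
  have "dcube \<tau> Q = dclosed \<tau> Q - (dclosed \<tau> Q - dcube \<tau> Q)"
    using dcube_subset_dclosed[of \<tau> Q] by blast
  then have "emeasure lebesgue (dcube \<tau> Q) = emeasure lebesgue (dclosed \<tau> Q)"
    using emeasure_Diff_null_set[OF null_dclosed_diff[of \<tau> Q] sets_dclosed[of \<tau> Q]] by (simp only:)
  then show ?thesis by (simp add: emeasure_dclosed)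
qed

lemma AE_dclosed_dcube: "AE x in lebesgue. x \<in> dclosed \<tau> Q \<longleftrightarrow> x \<in> dcube \<tau> Q"
proof -
  have "AE x in lebesgue. x \<notin> dclosed \<tau> Q - dcube \<tau> Q"
    by (rule AE_not_in[OF null_dclosed_diff])
  then show ?thesis
    by (rule AE_mp) (use dcube_subset_dclosed[of \<tau> Q] in auto)
qed

lemma dvol_dsub: "dsub \<tau> Q P \<Longrightarrow> dvol Q \<le> dvol P"
  unfolding dvol_def dsub_def dside_def by (intro power_mono) auto

lemma dat_small:
  fixes x :: "real ^ 'n :: finite"
  assumes "open U" "x \<in> U"
  shows "\<exists>k0. \<forall>k\<le>k0. dcube \<tau> (dat \<tau> k x) \<subseteq> U"
proof -
  obtain e where e: "e > 0" "ball x e \<subseteq> U" using assms openE by blast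
  \<comment> \<open>Each of the n coordinates differs by at most d; n + 1 in the denominator makes
    the l1 bound n * d strictly smaller than e.\<close>
  define d where "d = e / (real CARD('n) + 1)"
  have d: "d > 0" using e by (simp add: d_def)
  obtain k0 :: int where k0: "2 powr real_of_int k0 < d"
  proof -
    have "2 powr real_of_int (\<lfloor>log 2 d\<rfloor> - 1) < 2 powr (log 2 d)"
      by (intro powr_less_mono) linarith+
    then have "2 powr real_of_int (\<lfloor>log 2 d\<rfloor> - 1) < d"
      using d by simp
    then show ?thesis by (rule that)
  qed
  show ?thesis
  proof (intro exI[of _ k0] allI impI subsetI)
    fix k y assume k: "k \<le> k0" and y: "y \<in> dcube \<tau> (dat \<tau> k x)"
    have "2 powr real_of_int k < d" using k k0
      by (smt (verit, best) of_int_le_iff powr_mono)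
    moreover have "\<bar>(x - y) $ i\<bar> \<le> 2 powr real_of_int k" for i
      using y mem_dcube_dat[of x \<tau> k] unfolding mem_dcube_iff
      by (auto simp: abs_le_iff algebra_simps dest!: spec[of _ i])
    ultimately have "\<bar>(x - y) $ i\<bar> \<le> d" for i by (meson less_imp_le order_trans)
    then have "norm (x - y) \<le> (\<Sum>i\<in>(UNIV::'n set). d)"
      by (intro order_trans[OF norm_le_l1_cart] sum_mono)
    also have "\<dots> < e" using e by (simp add: d_def field_simps)
    finally show "y \<in> U" using e by (auto simp: dist_norm)
  qed
qed

section \<open>Maximal cubes and summation over disjoint families\<close>

definition dmax :: "real ^ 'n :: finite \<Rightarrow> 'n dindex set \<Rightarrow> 'n dindex set" where
  "dmax \<tau> A = {Q \<in> A. \<forall>P\<in>A. dsub \<tau> Q P \<longrightarrow> P = Q}"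

lemma dmax_subset: "dmax \<tau> A \<subseteq> A"
  by (auto simp: dmax_def)

lemma dmax_disjoint: "disjoint_family_on (dcube \<tau>) (dmax \<tau> A)"
  unfolding disjoint_family_on_def
proof (intro ballI impI)
  fix Q P assume "Q \<in> dmax \<tau> A" "P \<in> dmax \<tau> A" "Q \<noteq> P"
  then show "dcube \<tau> Q \<inter> dcube \<tau> P = {}"
    using dcube_meet_cases[of _ \<tau> Q P] by (auto simp: dmax_def)
qed

text \<open>The cubes above Q form a chain with one cube per level, so a bound on the levels yields
  a maximal element. The stopping families of the John--Nirenberg argument are infinite, but
  confined to one top cube.\<close>

lemma dmax_above:
  assumes "Q \<in> A" and bound: "\<And>P. P \<in> A \<Longrightarrow> fst P \<le> K"
  shows "\<exists>P\<in>dmax \<tau> A. dsub \<tau> Q P"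
proof -
  let ?S = "{P\<in>A. dsub \<tau> Q P}"
  have "\<exists>P. P \<in> ?S \<and> (\<forall>P'. P' \<in> ?S \<longrightarrow> nat (fst P' - fst Q) \<le> nat (fst P - fst Q))"
  proof (rule Lattices_Big.ex_has_greatest_nat)
    show "Q \<in> ?S" using assms(1) by simp
    show "\<forall>P. P \<in> ?S \<longrightarrow> nat (fst P - fst Q) < Suc (nat (K - fst Q))"
      using bound by (auto simp: less_Suc_eq_le intro!: nat_mono)
  qed
  then obtain P where P: "P \<in> ?S" "\<And>P'. P' \<in> ?S \<Longrightarrow> nat (fst P' - fst Q) \<le> nat (fst P - fst Q)"
    by blast
  have "P' = P" if "P' \<in> A" "dsub \<tau> P P'" for P'
  proof -
    have "P' \<in> ?S" using that P dsub_trans by blast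
    then have "nat (fst P' - fst Q) \<le> nat (fst P - fst Q)" by (rule P(2))
    moreover have "fst Q \<le> fst P" "fst P \<le> fst P'" using P(1) that by (simp_all add: dsub_def)
    ultimately have "fst P = fst P'" by linarith
    then show ?thesis using that dsub_level_eq[of \<tau> P P'] by simp
  qed
  then have "P \<in> dmax \<tau> A" using P(1) unfolding dmax_def by blast
  then show ?thesis using P(1) by blast
qed

lemma dmax_cover:
  assumes "\<And>P. P \<in> A \<Longrightarrow> fst P \<le> K"
  shows "(\<Union>Q\<in>A. dcube \<tau> Q) = (\<Union>Q\<in>dmax \<tau> A. dcube \<tau> Q)"
proof
  show "(\<Union>Q\<in>A. dcube \<tau> Q) \<subseteq> (\<Union>Q\<in>dmax \<tau> A. dcube \<tau> Q)"
  proof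
    fix x assume "x \<in> (\<Union>Q\<in>A. dcube \<tau> Q)"
    then obtain Q where Q: "Q \<in> A" "x \<in> dcube \<tau> Q" by blast
    obtain P where "P \<in> dmax \<tau> A" "dsub \<tau> Q P" using dmax_above[OF Q(1) assms] by blast
    then show "x \<in> (\<Union>Q\<in>dmax \<tau> A. dcube \<tau> Q)" using Q(2) unfolding dsub_def by blast
  qed
qed (use dmax_subset[of \<tau> A] in blast)

text \<open>Stopping-time estimates are checked cube by cube. Written as a comparison of two
  measures M and N, in practice densities, they sum over a countably infinite disjoint family by
  countable additivity.\<close>

lemma emeasure_UN_dcube_mono:
  fixes M N :: "(real ^ 'n::finite) measure"
  assumes "disjoint_family_on (dcube \<tau>) A" "sets M = sets lebesgue" "sets N = sets lebesgue"
    and "\<And>Q. Q \<in> A \<Longrightarrow> emeasure M (dcube \<tau> Q) \<le> emeasure N (dcube \<tau> Q)"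
  shows "emeasure M (\<Union>Q\<in>A. dcube \<tau> Q) \<le> emeasure N (\<Union>Q\<in>A. dcube \<tau> Q)"
  using assms by (subst (1 2) emeasure_UN_countable) (auto intro!: nn_integral_mono)

section \<open>The John--Nirenberg inequality\<close>

abbreviation dint :: "real ^ 'n :: finite \<Rightarrow> 'n dindex \<Rightarrow> (real ^ 'n \<Rightarrow> real) \<Rightarrow> ennreal" where
  "dint \<tau> Q f \<equiv> \<integral>\<^sup>+x\<in>dcube \<tau> Q. ennreal (f x) \<partial>lebesgue"

definition davg :: "real ^ 'n :: finite \<Rightarrow> (real ^ 'n \<Rightarrow> real) \<Rightarrow> 'n dindex \<Rightarrow> real" where
  "davg \<tau> b Q = 1 / dvol Q * (LINT y:dclosed \<tau> Q|lebesgue. b y)"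

lemma nn_integral_dclosed_dcube:
  "(\<integral>\<^sup>+x\<in>dclosed \<tau> Q. g x \<partial>lebesgue) = (\<integral>\<^sup>+x\<in>dcube \<tau> Q. g x \<partial>lebesgue)"
proof (rule nn_integral_cong_AE)
  show "AE x in lebesgue. g x * indicator (dclosed \<tau> Q) x = g x * indicator (dcube \<tau> Q) x"
    using AE_dclosed_dcube[of \<tau> Q] by (rule AE_mp) (auto simp: indicator_def)
qed

lemma locally_integrable_measurable:
  assumes "locally_integrable b"
  shows "b \<in> borel_measurable lebesgue"
proof -
  have *: "(\<lambda>x. indicator (cball 0 (real j)) x *\<^sub>R b x) \<in> borel_measurable lebesgue" for j
    using assms compact_cball[of "0::real^'a" "real j"]
    unfolding locally_integrable_def set_integrable_def by blast
  have "(\<lambda>j. indicator (cball 0 (real j)) x *\<^sub>R b x) \<longlonglongrightarrow> b x" for x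
  proof (rule tendsto_eventually)
    obtain j0 :: nat where "norm x \<le> real j0" using real_arch_simple by blast
    then show "\<forall>\<^sub>F j in sequentially. indicator (cball 0 (real j)) x *\<^sub>R b x = b x"
      unfolding eventually_sequentially by (intro exI[of _ j0]) (auto simp: indicator_def)
  qed
  then show ?thesis by (rule borel_measurable_LIMSEQ_real) (rule *)
qed

lemma bmo_dcube:
  assumes "bmo_norm b \<le> ennreal B" "B \<ge> 0"
  shows "(dint \<tau> Q (\<lambda>x. \<bar>b x - davg \<tau> b Q\<bar>)) \<le> ennreal (B * dvol Q)"
proof -
  have "ennreal (1 / dvol Q) * (\<integral>\<^sup>+x\<in>dclosed \<tau> Q. ennreal \<bar>b x - davg \<tau> b Q\<bar> \<partial>lebesgue) \<le> bmo_norm b"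
    unfolding bmo_norm_def
    by (rule SUP_upper2[of "dclosed \<tau> Q"]) (auto simp: cube_dclosed davg_def measure_dclosed)
  then have "ennreal (1 / dvol Q) * (dint \<tau> Q (\<lambda>x. \<bar>b x - davg \<tau> b Q\<bar>)) \<le> ennreal B"
    using assms(1) by (auto simp: nn_integral_dclosed_dcube)
  then have "ennreal (dvol Q) * (ennreal (1 / dvol Q) * (dint \<tau> Q (\<lambda>x. \<bar>b x - davg \<tau> b Q\<bar>)))
     \<le> ennreal (dvol Q) * ennreal B" by (rule mult_left_mono) simp
  then show ?thesis
    using assms(2) by (simp add: mult.assoc[symmetric] ennreal_mult[symmetric] mult.commute)
qed

lemma davg_diff_le:
  assumes "locally_integrable b"
  shows "ennreal (\<bar>davg \<tau> b R - c\<bar> * dvol R) \<le> (dint \<tau> R (\<lambda>x. \<bar>b x - c\<bar>))"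
proof -
  let ?S = "dclosed \<tau> R"
  have i1: "set_integrable lebesgue ?S b"
    using assms unfolding locally_integrable_def dclosed_def by auto
  have i2: "set_integrable lebesgue ?S (\<lambda>x. c)"
    unfolding set_integrable_def by (auto simp: emeasure_dclosed)
  have c: "(LINT y:?S|lebesgue. c) = c * dvol R"
    unfolding set_lebesgue_integral_def by (simp add: measure_dclosed)
  have "davg \<tau> b R * dvol R - c * dvol R = (LINT y:?S|lebesgue. b y) - (LINT y:?S|lebesgue. c)"
    by (simp add: davg_def c)
  also have "\<dots> = (LINT y:?S|lebesgue. b y - c)"
    by (rule set_integral_diff(2)[OF i1 i2, symmetric])
  finally have diff: "(davg \<tau> b R - c) * dvol R = (LINT y:?S|lebesgue. b y - c)"
    by (simp add: left_diff_distrib)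
  have "\<bar>davg \<tau> b R - c\<bar> * dvol R = norm ((davg \<tau> b R - c) * dvol R)"
    by (simp add: abs_mult)
  then have eq: "\<bar>davg \<tau> b R - c\<bar> * dvol R = norm (LINT y:?S|lebesgue. b y - c)"
    unfolding diff .
  have "ennreal (norm (LINT y:?S|lebesgue. b y - c)) \<le> (\<integral>\<^sup>+x. norm (indicator ?S x *\<^sub>R (b x - c)) \<partial>lebesgue)"
    unfolding set_lebesgue_integral_def
    by (rule integral_norm_bound_ennreal) (use set_integral_diff(1)[OF i1 i2] in \<open>simp add: set_integrable_def\<close>)
  also have "\<dots> = (\<integral>\<^sup>+x\<in>?S. ennreal \<bar>b x - c\<bar> \<partial>lebesgue)"
    by (intro nn_integral_cong) (auto simp: indicator_def)
  finally show ?thesis unfolding eq nn_integral_dclosed_dcube .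
qed

lemma dvol_parent: "dvol (dat \<tau> (fst R + 1) x :: 'n::finite dindex) = 2 ^ CARD('n) * dvol (R :: 'n dindex)"
  by (simp add: dvol_def dside_def[of R] powr_add power_mult_distrib mult.commute)

lemma dsub_parent: "x \<in> dcube \<tau> R \<Longrightarrow> dsub \<tau> R (dat \<tau> (fst R + 1) x)"
  by (rule dcube_meet_dsub[of x]) auto

lemma nn_integral_dsub_mono:
  assumes "dsub \<tau> R P"
  shows "(\<integral>\<^sup>+x\<in>dcube \<tau> R. g x \<partial>lebesgue) \<le> (\<integral>\<^sup>+x\<in>dcube \<tau> P. g x \<partial>lebesgue)"
  using assms unfolding dsub_def by (intro nn_integral_mono) (auto simp: indicator_def)

text \<open>This stands in for the Lebesgue differentiation theorem: the exceptional set is covered by the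
  maximal dyadic cubes inside an open superset of almost the same measure.\<close>

lemma dyadic_density_null:
  fixes g :: "real ^ 'n::finite \<Rightarrow> real"
  assumes [measurable]: "g \<in> borel_measurable lebesgue" and c: "c \<ge> 0"
  shows "{x \<in> dcube \<tau> Q. g x > c \<and> (\<forall>R. dsub \<tau> R Q \<and> x \<in> dcube \<tau> R \<longrightarrow>
      (dint \<tau> R (\<lambda>x. g x)) \<le> ennreal (c * dvol R))} \<in> null_sets lebesgue"
    (is "?N \<in> _")
proof -
  define V where "V = (\<Union>R\<in>{R. dsub \<tau> R Q \<and> \<not> (dint \<tau> R (\<lambda>x. g x)) \<le> ennreal (c * dvol R)}. dcube \<tau> R)"
  have [measurable]: "V \<in> sets lebesgue" unfolding V_def
    by (intro sets.countable_UN'') auto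
  define N where "N j = {x \<in> space lebesgue. x \<in> dcube \<tau> Q - V \<and> g x \<ge> c + 1 / real (Suc j)}" for j
  have Nmeas [measurable]: "N j \<in> sets lebesgue" for j
    unfolding N_def by measurable
  have null: "emeasure lebesgue (N j) = 0" for j
  proof -
    define \<eta> where "\<eta> = 1 / real (Suc j)"
    have \<eta>: "\<eta> > 0" by (simp add: \<eta>_def)
    have "emeasure lebesgue (N j) \<le> ennreal (dvol Q)"
      unfolding emeasure_dcube[of \<tau> Q, symmetric] by (intro emeasure_mono) (auto simp: N_def)
    then have "emeasure lebesgue (N j) \<noteq> top" by (auto simp: top_unique)
    then obtain a where a: "emeasure lebesgue (N j) = ennreal a" "a \<ge> 0"
      by (metis ennreal_cases)
    \<comment> \<open>An open superset U whose excess has measure below e turns the averages over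
      cubes inside U into a bound with error c * e; letting e tend to 0 forces a = 0 because of the
      margin \<open>\<eta>\<close>.\<close>
    have key: "(c + \<eta>) * a \<le> c * (a + e)" if "e > 0" for e
    proof -
      obtain U where U: "open U" "N j \<subseteq> U" "emeasure lebesgue (U - N j) < ennreal e"
        using sets_lebesgue_outer_open[OF Nmeas \<open>e > 0\<close>] by metis
      have [measurable]: "U \<in> sets lebesgue" using U(1) by simp
      have Um: "emeasure lebesgue U \<le> ennreal (a + e)"
      proof -
        have "emeasure lebesgue U = emeasure lebesgue (N j \<union> (U - N j))"
          using U(2) by (simp add: Un_absorb1)
        also have "\<dots> \<le> emeasure lebesgue (N j) + emeasure lebesgue (U - N j)"
          by (rule emeasure_subadditive) auto
        also have "\<dots> \<le> ennreal a + ennreal e"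
          unfolding a(1)[symmetric] using U(3) by (intro add_left_mono less_imp_le)
        finally show ?thesis using a that by simp
      qed
      \<comment> \<open>Only cubes meeting N j are kept: a point of N j lies outside V, so the
        average of g over every such cube is at most c.\<close>
      define A where "A = {R. dsub \<tau> R Q \<and> dcube \<tau> R \<subseteq> U \<and> dcube \<tau> R \<inter> N j \<noteq> {}}"
      have lev: "\<And>R. R \<in> A \<Longrightarrow> fst R \<le> fst Q" by (auto simp: A_def dsub_def)
      have cov: "N j \<subseteq> (\<Union>R\<in>dmax \<tau> A. dcube \<tau> R)"
      proof
        fix x assume x: "x \<in> N j"
        obtain k0 where k0: "\<And>k. k \<le> k0 \<Longrightarrow> dcube \<tau> (dat \<tau> k x) \<subseteq> U"
          using dat_small[OF U(1), of x \<tau>] x U(2) by blast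
        let ?R = "dat \<tau> (min k0 (fst Q)) x"
        have "dsub \<tau> ?R Q" using x by (intro dcube_meet_dsub[of x]) (auto simp: N_def)
        moreover have "dcube \<tau> ?R \<subseteq> U" by (rule k0) simp
        moreover have "dcube \<tau> ?R \<inter> N j \<noteq> {}"
          using IntI[OF mem_dcube_dat x] by (metis empty_iff)
        ultimately have "?R \<in> A" unfolding A_def mem_Collect_eq by (intro conjI)
        then have "x \<in> (\<Union>R\<in>A. dcube \<tau> R)" by (rule UN_I) simp
        then show "x \<in> (\<Union>R\<in>dmax \<tau> A. dcube \<tau> R)"
          using equalityD1[OF dmax_cover[OF lev]] by (rule rev_subsetD)
      qed
      let ?M = "density lebesgue (\<lambda>x. ennreal (c + \<eta>) * indicator (N j) x)"
      let ?L = "density lebesgue (\<lambda>x. ennreal c)"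
      let ?W = "\<Union>R\<in>dmax \<tau> A. dcube \<tau> R"
      have [measurable]: "?W \<in> sets lebesgue" by (intro sets.countable_UN'') auto
      have "emeasure ?M ?W \<le> emeasure ?L ?W"
      proof (rule emeasure_UN_dcube_mono[OF dmax_disjoint])
        fix R assume "R \<in> dmax \<tau> A"
        then have R: "dsub \<tau> R Q" "dcube \<tau> R \<inter> N j \<noteq> {}" using dmax_subset[of \<tau> A] by (auto simp: A_def)
        have "emeasure ?M (dcube \<tau> R) = (\<integral>\<^sup>+x. ennreal (c + \<eta>) * indicator (N j) x * indicator (dcube \<tau> R) x \<partial>lebesgue)"
          by (subst emeasure_density) auto
        also have "\<dots> \<le> (dint \<tau> R (\<lambda>x. g x))"
          by (intro nn_integral_mono) (auto simp: N_def \<eta>_def indicator_def ennreal_leI)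
        also have "\<dots> \<le> ennreal (c * dvol R)"
        proof -
          obtain x where x: "x \<in> dcube \<tau> R" "x \<in> N j" using R by blast
          then have "x \<notin> V" by (simp add: N_def)
          then show ?thesis using R(1) x(1) unfolding V_def by blast
        qed
        also have "\<dots> = emeasure ?L (dcube \<tau> R)"
          using c by (simp add: emeasure_density_const ennreal_mult)
        finally show "emeasure ?M (dcube \<tau> R) \<le> emeasure ?L (dcube \<tau> R)" .
      qed auto
      also have "\<dots> = ennreal c * emeasure lebesgue ?W"
        by (simp only: emeasure_density_const[OF \<open>?W \<in> sets lebesgue\<close>])
      also have "\<dots> \<le> ennreal c * ennreal (a + e)"
      proof (intro mult_left_mono order_trans[OF _ Um] emeasure_mono)
        show "?W \<subseteq> U" using dmax_subset[of \<tau> A] unfolding A_def by blast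
      qed auto
      finally have 1: "emeasure ?M ?W \<le> ennreal (c * (a + e))"
        using c a that by (simp add: ennreal_mult)
      have "emeasure ?M ?W = (\<integral>\<^sup>+x. ennreal (c + \<eta>) * indicator (N j) x * indicator ?W x \<partial>lebesgue)"
        by (rule emeasure_density) auto
      also have "\<dots> = (\<integral>\<^sup>+x. ennreal (c + \<eta>) * indicator (N j) x \<partial>lebesgue)"
        using cov by (intro nn_integral_cong) (auto simp: indicator_def)
      also have "\<dots> = ennreal (c + \<eta>) * ennreal a"
        by (simp only: nn_integral_cmult_indicator[OF Nmeas] a)
      finally have "ennreal ((c + \<eta>) * a) \<le> ennreal (c * (a + e))"
        using 1 c a \<eta> by (simp add: ennreal_mult)
      then show ?thesis using c a that by (simp add: ennreal_le_iff)
    qed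
    have "\<eta> * a \<le> 0"
    proof (rule field_le_epsilon)
      fix e :: real assume "e > 0"
      \<comment> \<open>Dividing by c + 1 instead of c covers c = 0.\<close>
      then have "e / (c + 1) > 0" using c by simp
      from key[OF this] have "\<eta> * a \<le> c * (e / (c + 1))" by (simp add: algebra_simps)
      also have "\<dots> \<le> e" using c \<open>e > 0\<close> by (simp add: field_simps)
      finally show "\<eta> * a \<le> 0 + e" by simp
    qed
    then have "a \<le> 0" using \<eta> by (simp add: mult_le_0_iff)
    then show ?thesis using a by simp
  qed
  have "(\<Union>j. N j) \<in> null_sets lebesgue"
    by (rule null_sets_UN') (auto simp: null_sets_def null)
  moreover have "?N \<subseteq> (\<Union>j. N j)"
  proof
    fix x assume x: "x \<in> ?N"
    then have "g x - c > 0" by simp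
    then obtain j where "1 / real (Suc j) < g x - c" using nat_approx_posE by metis
    then show "x \<in> (\<Union>j. N j)" using x by (auto simp: N_def V_def intro!: exI[of _ j])
  qed
  ultimately show ?thesis using null_sets_completion_subset by blast
qed

text \<open>Calderon--Zygmund stopping at height 2 * B, iterated by induction over all cubes at
  once. The stopping cubes cover at most half of Q, outside them |b - b_Q| \<le> 2 * B almost
  everywhere, and passing from Q to a stopping cube moves the average by at most 2^n * 2 * B, which
  is the step \<open>2 ^ (CARD('n) + 1) * B\<close>.\<close>

lemma john_nirenberg:
  fixes b :: "real ^ 'n::finite \<Rightarrow> real"
  assumes b: "locally_integrable b" and B: "bmo_norm b \<le> ennreal B" "B > 0"
  shows "emeasure lebesgue {x \<in> dcube \<tau> Q. \<bar>b x - davg \<tau> b Q\<bar> > real i * (2 ^ (CARD('n) + 1) * B)} \<le> ennreal (dvol Q / 2 ^ i)"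
proof (induction i arbitrary: Q)
  case 0
  have "emeasure lebesgue {x \<in> dcube \<tau> Q. \<bar>b x - davg \<tau> b Q\<bar> > 0} \<le> emeasure lebesgue (dcube \<tau> Q)"
    by (intro emeasure_mono) auto
  then show ?case by simp
next
  case (Suc i)
  note [measurable] = locally_integrable_measurable[OF b]
  define T where "T = 2 ^ (CARD('n) + 1) * B"
  have T: "T > 0" "2 * B \<le> T" using B
    by (auto simp: T_def)
  define g where "g x = \<bar>b x - davg \<tau> b Q\<bar>" for x
  have [measurable]: "g \<in> borel_measurable lebesgue" unfolding g_def by measurable
  have gQ: "(dint \<tau> Q (\<lambda>x. g x)) \<le> ennreal (B * dvol Q)"
    unfolding g_def using bmo_dcube[of b B \<tau> Q] B by simp
  define A where "A = {R. dsub \<tau> R Q \<and> \<not> (dint \<tau> R (\<lambda>x. g x)) \<le> ennreal (2 * B * dvol R)}"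
  have lev: "\<And>R. R \<in> A \<Longrightarrow> fst R \<le> fst Q" by (auto simp: A_def dsub_def)
  let ?W = "\<Union>R\<in>dmax \<tau> A. dcube \<tau> R"
  have W[measurable]: "?W \<in> sets lebesgue" by (intro sets.countable_UN'') auto
  define E where "E = {x \<in> space lebesgue. x \<in> dcube \<tau> Q \<and> g x > real (Suc i) * T}"
  have E[measurable]: "E \<in> sets lebesgue" unfolding E_def by measurable
  have jump: "\<bar>davg \<tau> b R - davg \<tau> b Q\<bar> \<le> T" if "R \<in> dmax \<tau> A" for R
  proof -
    have RA: "R \<in> A" using that dmax_subset by blast
    obtain x where x: "x \<in> dcube \<tau> R" using dcube_nonempty by blast
    have xQ: "x \<in> dcube \<tau> Q" using x RA by (auto simp: A_def dsub_def)
    \<comment> \<open>Q itself is not a stopping cube, its average being at most B; hence R is a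
      proper subcube and its parent still lies in Q.\<close>
    have "ennreal (B * dvol Q) \<le> ennreal (2 * B * dvol Q)" using B by (intro ennreal_leI) auto
    then have "Q \<notin> A" using gQ unfolding A_def by (auto simp: not_le dest: order.trans)
    then have "R \<noteq> Q" using RA by auto
    moreover have "dsub \<tau> R Q" using RA by (simp add: A_def)
    ultimately have "fst R \<noteq> fst Q" using dsub_level_eq by metis
    then have "fst R + 1 \<le> fst Q" using RA by (auto simp: A_def dsub_def)
    let ?P = "dat \<tau> (fst R + 1) x"
    have P: "dsub \<tau> ?P Q" using xQ \<open>fst R + 1 \<le> fst Q\<close> by (intro dcube_meet_dsub[of x]) auto
    have "dsub \<tau> R ?P" using x by (rule dsub_parent)
    moreover have "?P \<noteq> R" using dside_dat(2)[of \<tau> "fst R + 1" x] by (metis add_cancel_right_right zero_neq_one)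
    \<comment> \<open>Maximality: the parent was not stopped, so its average is at most 2 * B; going
      down to R costs the volume ratio 2^n.\<close>
    ultimately have "?P \<notin> A" using that unfolding dmax_def by blast
    then have PA: "(dint \<tau> ?P (\<lambda>x. g x)) \<le> ennreal (2 * B * dvol ?P)"
      using P by (simp add: A_def)
    have "ennreal (\<bar>davg \<tau> b R - davg \<tau> b Q\<bar> * dvol R) \<le> (dint \<tau> R (\<lambda>x. g x))"
      unfolding g_def by (rule davg_diff_le[OF b])
    also have "\<dots> \<le> (dint \<tau> ?P (\<lambda>x. g x))"
      by (rule nn_integral_dsub_mono[OF \<open>dsub \<tau> R ?P\<close>])
    also note PA
    finally have "\<bar>davg \<tau> b R - davg \<tau> b Q\<bar> * dvol R \<le> T * dvol R"
      using B unfolding dvol_parent by (simp add: ennreal_le_iff T_def mult_ac)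
    then show ?thesis by simp
  qed
  have 1: "emeasure lebesgue (E \<inter> ?W) \<le> ennreal (1 / 2 ^ i) * emeasure lebesgue ?W"
  proof -
    let ?M = "density lebesgue (indicator E)"
    let ?L = "density lebesgue (\<lambda>x. ennreal (1 / 2 ^ i))"
    have M: "emeasure ?M S = emeasure lebesgue (E \<inter> S)" if S: "S \<in> sets lebesgue" for S
    proof -
      have "emeasure ?M S = (\<integral>\<^sup>+x. indicator E x * indicator S x \<partial>lebesgue)"
        using S E by (intro emeasure_density) auto
      also have "\<dots> = (\<integral>\<^sup>+x. indicator (E \<inter> S) x \<partial>lebesgue)"
        by (intro nn_integral_cong) (auto simp: indicator_def)
      also have "\<dots> = emeasure lebesgue (E \<inter> S)"
        using S E by (intro nn_integral_indicator) auto
      finally show ?thesis .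
    qed
    have "emeasure ?M ?W \<le> emeasure ?L ?W"
    proof (rule emeasure_UN_dcube_mono[OF dmax_disjoint])
      fix R assume R: "R \<in> dmax \<tau> A"
      have "emeasure ?M (dcube \<tau> R) = emeasure lebesgue (E \<inter> dcube \<tau> R)"
        by (rule M) simp
      also have "\<dots> \<le> emeasure lebesgue {x \<in> dcube \<tau> R. \<bar>b x - davg \<tau> b R\<bar> > real i * T}"
      proof (rule emeasure_mono)
        show "E \<inter> dcube \<tau> R \<subseteq> {x \<in> dcube \<tau> R. \<bar>b x - davg \<tau> b R\<bar> > real i * T}"
          using jump[OF R] by (auto simp: E_def g_def algebra_simps)
        have "{x \<in> dcube \<tau> R. \<bar>b x - davg \<tau> b R\<bar> > real i * T} = {x \<in> space lebesgue. x \<in> dcube \<tau> R \<and> \<bar>b x - davg \<tau> b R\<bar> > real i * T}"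
          by simp
        also have "\<dots> \<in> sets lebesgue" by measurable
        finally show "{x \<in> dcube \<tau> R. \<bar>b x - davg \<tau> b R\<bar> > real i * T} \<in> sets lebesgue" .
      qed
      also have "\<dots> \<le> ennreal (dvol R / 2 ^ i)" using Suc[of R] by (simp add: T_def)
      also have "\<dots> = emeasure ?L (dcube \<tau> R)"
        by (subst emeasure_density_const) (auto simp: ennreal_mult[symmetric])
      finally show "emeasure ?M (dcube \<tau> R) \<le> emeasure ?L (dcube \<tau> R)" .
    qed auto
    then show ?thesis unfolding M[OF W] emeasure_density_const[OF W] .
  qed
  \<comment> \<open>Chebyshev: g has average above 2 * B on every stopping cube and at most B on Q,
    so these cubes fill at most half of Q.\<close>
  have 2: "ennreal (2 * B) * emeasure lebesgue ?W \<le> ennreal (B * dvol Q)"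
  proof -
    have "ennreal (2 * B) * emeasure lebesgue ?W = emeasure (density lebesgue (\<lambda>x. ennreal (2 * B))) ?W"
      by (simp only: emeasure_density_const[OF W])
    also have "\<dots> \<le> emeasure (density lebesgue (\<lambda>x. ennreal (g x))) ?W"
    proof (rule emeasure_UN_dcube_mono[OF dmax_disjoint])
      fix R assume "R \<in> dmax \<tau> A"
      then have "R \<in> A" using dmax_subset by blast
      then have "ennreal (2 * B * dvol R) \<le> (dint \<tau> R (\<lambda>x. g x))"
        by (auto simp: A_def)
      then show "emeasure (density lebesgue (\<lambda>x. ennreal (2 * B))) (dcube \<tau> R) \<le> emeasure (density lebesgue (\<lambda>x. ennreal (g x))) (dcube \<tau> R)"
        using B by (subst emeasure_density_const, simp, subst emeasure_density) (auto simp: ennreal_mult)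
    qed auto
    also have "\<dots> = (\<integral>\<^sup>+x\<in>?W. ennreal (g x) \<partial>lebesgue)"
      by (rule emeasure_density) auto
    also have "\<dots> \<le> (dint \<tau> Q (\<lambda>x. g x))"
    proof (rule nn_integral_mono)
      have "?W \<subseteq> dcube \<tau> Q" using dmax_subset[of \<tau> A] by (auto simp: A_def dsub_def)
      then show "ennreal (g x) * indicator ?W x \<le> ennreal (g x) * indicator (dcube \<tau> Q) x" for x
        by (auto simp: indicator_def)
    qed
    finally show ?thesis using gQ by (rule order_trans)
  qed
  \<comment> \<open>Points of E outside \<open>?W\<close>: all averages of g around them stay below
    2 * B, although g > T \<ge> 2 * B there, so they form a null set.\<close>
  let ?N = "{x \<in> dcube \<tau> Q. g x > 2 * B \<and> (\<forall>R. dsub \<tau> R Q \<and> x \<in> dcube \<tau> R \<longrightarrow>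
      (dint \<tau> R (\<lambda>x. g x)) \<le> ennreal (2 * B * dvol R))}"
  have N: "?N \<in> null_sets lebesgue"
    by (rule dyadic_density_null) (use B in auto)
  have sub: "E \<subseteq> ?N \<union> (E \<inter> ?W)"
  proof
    fix x assume x: "x \<in> E"
    have "g x > 1 * T" using x T by (auto simp: E_def algebra_simps intro: le_less_trans[of T "T + real i * T"])
    then have "g x > 2 * B" using T by simp
    moreover have "?W = (\<Union>R\<in>A. dcube \<tau> R)" by (rule dmax_cover[OF lev, symmetric])
    ultimately show "x \<in> ?N \<union> (E \<inter> ?W)" using x by (auto simp: A_def E_def)
  qed
  have "emeasure lebesgue E \<le> emeasure lebesgue (?N \<union> (E \<inter> ?W))"
    by (rule emeasure_mono[OF sub]) (use N in auto)
  also have "\<dots> \<le> emeasure lebesgue ?N + emeasure lebesgue (E \<inter> ?W)"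
    by (rule emeasure_subadditive) (use N in auto)
  also have "\<dots> = emeasure lebesgue (E \<inter> ?W)" using N by (simp only: null_setsD1 add_0)
  finally have 3: "emeasure lebesgue E \<le> ennreal (1 / 2 ^ i) * emeasure lebesgue ?W"
    using 1 by (rule order_trans)
  have "emeasure lebesgue ?W = ennreal (1 / (2 * B)) * (ennreal (2 * B) * emeasure lebesgue ?W)"
    using B by (simp add: mult.assoc[symmetric] ennreal_mult[symmetric])
  also have "\<dots> \<le> ennreal (1 / (2 * B)) * ennreal (B * dvol Q)"
    by (intro mult_left_mono 2) auto
  also have "\<dots> = ennreal (dvol Q / 2)" using B by (simp add: ennreal_mult[symmetric])
  finally have "ennreal (1 / 2 ^ i) * emeasure lebesgue ?W \<le> ennreal (1 / 2 ^ i) * ennreal (dvol Q / 2)"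
    by (intro mult_left_mono) auto
  with 3 have "emeasure lebesgue E \<le> ennreal (1 / 2 ^ i) * ennreal (dvol Q / 2)" by (rule order_trans)
  also have "\<dots> = ennreal (dvol Q / 2 ^ Suc i)" by (simp add: ennreal_mult[symmetric])
  finally show ?case by (simp add: E_def g_def T_def)
qed

text \<open>The tail halves at each step, so any base below 2 is integrable. Base 3/2 gives a
  geometric series of ratio 3/4 and the total 3/2 + 6 = 15/2, rounded up to 8.\<close>

lemma john_nirenberg_exp:
  fixes b :: "real ^ 'n::finite \<Rightarrow> real"
  assumes b: "locally_integrable b" and B: "bmo_norm b \<le> ennreal B" "B > 0"
  shows "(dint \<tau> Q (\<lambda>x. (3/2) powr (\<bar>b x - davg \<tau> b Q\<bar> / (2 ^ (CARD('n) + 1) * B))))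
     \<le> ennreal (8 * dvol Q)"
proof -
  note [measurable] = locally_integrable_measurable[OF b]
  define T where "T = 2 ^ (CARD('n) + 1) * B"
  have T: "T > 0" using B by (simp add: T_def)
  define t where "t x = \<bar>b x - davg \<tau> b Q\<bar> / T" for x
  have t0: "t x \<ge> 0" for x using T by (simp add: t_def)
  define E where "E i = {x \<in> space lebesgue. x \<in> dcube \<tau> Q \<and> \<bar>b x - davg \<tau> b Q\<bar> > real i * T}" for i
  have E[measurable]: "E i \<in> sets lebesgue" for i unfolding E_def by measurable
  have Em: "emeasure lebesgue (E i) \<le> ennreal (dvol Q / 2 ^ i)" for i
    using john_nirenberg[OF b B, of \<tau> Q i] by (simp add: E_def T_def)
  have pw: "ennreal ((3/2) powr t x) * indicator (dcube \<tau> Q) x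
      \<le> ennreal (3/2) * indicator (dcube \<tau> Q) x + (\<Sum>i. ennreal ((3/2) ^ Suc i) * indicator (E i) x)" for x
  proof (cases "x \<in> dcube \<tau> Q \<and> t x > 0")
    case True
    \<comment> \<open>Chosen so that i < t x \<le> i + 1; the strict inequality on the left is what
      membership in E i demands.\<close>
    define i where "i = nat (\<lceil>t x\<rceil> - 1)"
    have i: "real i < t x" "t x \<le> real (Suc i)" using True unfolding i_def by linarith+
    then have "x \<in> E i" using True T by (auto simp: E_def t_def field_simps)
    have "(3/2 :: real) powr t x \<le> (3/2) powr real (Suc i)" using i by (intro powr_mono) auto
    also have "\<dots> = (3/2) ^ Suc i" by (rule powr_realpow) simp
    finally have "ennreal ((3/2) powr t x) \<le> ennreal ((3/2) ^ Suc i)"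
      by (rule ennreal_leI)
    also have "\<dots> = (\<Sum>j\<in>{i}. ennreal ((3/2) ^ Suc j) * indicator (E j) x)" using \<open>x \<in> E i\<close> by simp
    also have "\<dots> \<le> (\<Sum>i. ennreal ((3/2) ^ Suc i) * indicator (E i) x)"
      by (rule sum_le_suminf) auto
    finally show ?thesis using True by (simp add: add_increasing)
  next
    case False
    then show ?thesis using t0[of x] by (auto simp: indicator_def add_increasing2)
  qed
  have "(dint \<tau> Q (\<lambda>x. (3/2) powr t x))
    \<le> (\<integral>\<^sup>+x. ennreal (3/2) * indicator (dcube \<tau> Q) x + (\<Sum>i. ennreal ((3/2) ^ Suc i) * indicator (E i) x) \<partial>lebesgue)"
    by (rule nn_integral_mono) (rule pw)
  also have "\<dots> = ennreal (3/2) * ennreal (dvol Q) + (\<Sum>i. ennreal ((3/2) ^ Suc i) * emeasure lebesgue (E i))"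
    by (subst nn_integral_add) (auto simp: nn_integral_suminf nn_integral_cmult_indicator simp del: power_Suc)
  also have "\<dots> \<le> ennreal (3/2) * ennreal (dvol Q) + (\<Sum>i. ennreal (3/2 * dvol Q * (3/4) ^ i))"
  proof (intro add_left_mono suminf_le)
    fix i
    have "ennreal ((3/2) ^ Suc i) * emeasure lebesgue (E i) \<le> ennreal ((3/2) ^ Suc i) * ennreal (dvol Q / 2 ^ i)"
      by (intro mult_left_mono Em) auto
    also have "\<dots> = ennreal (3/2 * dvol Q * (3/4) ^ i)"
    proof -
      have "(3/2) ^ Suc i * (dvol Q / 2 ^ i) = 3/2 * dvol Q * ((3/2) ^ i / 2 ^ i)" by simp
      also have "(3/2) ^ i / 2 ^ i = (3/4 :: real) ^ i" by (simp flip: power_divide)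
      finally show ?thesis by (subst ennreal_mult[symmetric]) auto
    qed
    finally show "ennreal ((3/2) ^ Suc i) * emeasure lebesgue (E i) \<le> ennreal (3/2 * dvol Q * (3/4) ^ i)" .
  qed auto
  also have "(\<Sum>i. ennreal (3/2 * dvol Q * (3/4) ^ i)) = ennreal (3/2 * dvol Q * 4)"
  proof (rule suminf_ennreal_eq)
    have "(\<lambda>i. (3/4 :: real) ^ i) sums 4" using geometric_sums[of "3/4 :: real"] by simp
    then show "(\<lambda>i. 3/2 * dvol Q * (3/4) ^ i) sums (3/2 * dvol Q * 4)" by (rule sums_mult)
  qed auto
  also have "ennreal (3/2) * ennreal (dvol Q) + ennreal (3/2 * dvol Q * 4) = ennreal (15/2 * dvol Q)"
    by (simp add: ennreal_mult[symmetric] ennreal_plus[symmetric] del: ennreal_plus)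
  also have "\<dots> \<le> ennreal (8 * dvol Q)" by (intro ennreal_leI) simp
  finally show ?thesis unfolding t_def T_def .
qed

text \<open>The averages over a cube and its parent differ by at most 2^n * B; telescoping along the
  chain of ancestors makes the drift linear in the number of generations. This linear growth is the
  origin of K in \<open>osc_family\<close>.\<close>

lemma davg_growth:
  fixes b :: "real ^ 'n::finite \<Rightarrow> real"
  assumes b: "locally_integrable b" and B: "bmo_norm b \<le> ennreal B" "B \<ge> 0"
    and "dsub \<tau> R P"
  shows "\<bar>davg \<tau> b R - davg \<tau> b P\<bar> \<le> 2 ^ CARD('n) * B * real_of_int (fst P - fst R)"
  using \<open>dsub \<tau> R P\<close>
proof (induction "nat (fst P - fst R)" arbitrary: R)
  case 0
  have "fst R \<le> fst P" using 0(2) by (simp add: dsub_def)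
  then have "fst R = fst P" using 0(1) by linarith
  then have "R = P" using dsub_level_eq[of \<tau> R P] 0(2) by blast
  then show ?case by simp
next
  case (Suc l)
  obtain x where x: "x \<in> dcube \<tau> R" using dcube_nonempty by blast
  let ?S = "dat \<tau> (fst R + 1) x"
  have RS: "dsub \<tau> R ?S" using x by (rule dsub_parent)
  have "x \<in> dcube \<tau> P" using Suc.prems x by (auto simp: dsub_def)
  moreover have "fst R + 1 \<le> fst P" using Suc(2) by linarith
  ultimately have "dsub \<tau> ?S P" by (intro dcube_meet_dsub[of x]) simp_all
  moreover have "l = nat (fst P - fst ?S)" using Suc(2) unfolding dside_dat by linarith
  ultimately have IH: "\<bar>davg \<tau> b ?S - davg \<tau> b P\<bar> \<le> 2 ^ CARD('n) * B * real_of_int (fst P - fst ?S)"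
    using Suc(1)[of ?S] by blast
  have "ennreal (\<bar>davg \<tau> b R - davg \<tau> b ?S\<bar> * dvol R) \<le> (dint \<tau> R (\<lambda>x. \<bar>b x - davg \<tau> b ?S\<bar>))"
    by (rule davg_diff_le[OF b])
  also have "\<dots> \<le> (dint \<tau> ?S (\<lambda>x. \<bar>b x - davg \<tau> b ?S\<bar>))"
    by (rule nn_integral_dsub_mono[OF RS])
  also have "\<dots> \<le> ennreal (B * dvol ?S)" by (rule bmo_dcube[OF B])
  finally have "\<bar>davg \<tau> b R - davg \<tau> b ?S\<bar> * dvol R \<le> 2 ^ CARD('n) * B * dvol R"
    unfolding dvol_parent using B by (simp add: ennreal_le_iff mult_ac)
  then have "\<bar>davg \<tau> b R - davg \<tau> b ?S\<bar> \<le> 2 ^ CARD('n) * B" by simp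
  then show ?case using IH by (simp add: algebra_simps)
qed

section \<open>Selection of a Carleson family\<close>

declare split_paired_All [simp del] split_paired_Ex [simp del]

text \<open>The model is the integral of D_Q^m * f over Q: it is additive over disjoint subcubes
  except for the change of reference cube, which costs the power m of a linear function of the
  generation gap. The gap may vary within one family, so the loss stands inside the sum.\<close>

definition dsuper :: "real ^ 'n :: finite \<Rightarrow> real \<Rightarrow> nat \<Rightarrow> ('n dindex \<Rightarrow> real) \<Rightarrow> bool" where
  "dsuper \<tau> K m A \<longleftrightarrow> (\<forall>Q. A Q \<ge> 0) \<and>
     (\<forall>P \<R>. finite \<R> \<and> disjoint_family_on (dcube \<tau>) \<R> \<and> (\<forall>R\<in>\<R>. dsub \<tau> R P) \<longrightarrow>
       (\<Sum>R\<in>\<R>. A R / (1 + K * real_of_int (fst P - fst R)) ^ m) \<le> A P)"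

text \<open>A packing condition tested only on members of the family. It is applied to finite
  families, for which the sum has its literal meaning.\<close>

definition carleson :: "real ^ 'n :: finite \<Rightarrow> real \<Rightarrow> 'n dindex set \<Rightarrow> bool" where
  "carleson \<tau> C \<S> \<longleftrightarrow> (\<forall>P\<in>\<S>. (\<Sum>R | R \<in> \<S> \<and> dsub \<tau> R P. dvol R) \<le> C * dvol P)"

section \<open>Geometric sums over levels and absorption of polynomial losses\<close>

lemma finite_geometric_le:
  fixes x :: real and h :: "'a \<Rightarrow> nat"
  assumes "finite J" "inj_on h J" "0 \<le> x" "x < 1"
  shows "(\<Sum>j\<in>J. x ^ h j) \<le> 1 / (1 - x)"
proof -
  have "(\<Sum>j\<in>J. x ^ h j) = (\<Sum>l\<in>h ` J. x ^ l)"
    using sum.reindex[OF assms(2), of "\<lambda>l. x ^ l"] by (simp add: o_def)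
  also have "\<dots> \<le> (\<Sum>l. x ^ l)"
    using assms by (intro sum_le_suminf summable_geometric) auto
  also have "\<dots> = 1 / (1 - x)" using assms by (intro suminf_geometric) auto
  finally show ?thesis .
qed

lemma inj_on_nat_diff_left:
  fixes a :: int
  assumes "\<And>j. j \<in> J \<Longrightarrow> a \<le> j"
  shows "inj_on (\<lambda>j. nat (j - a)) J"
proof (rule inj_onI)
  fix x y assume "x \<in> J" "y \<in> J" and eq: "nat (x - a) = nat (y - a)"
  then have "a \<le> x" "a \<le> y" using assms by auto
  then show "x = y" using eq by linarith
qed

lemma inj_on_nat_diff_right:
  fixes a :: int
  assumes "\<And>j. j \<in> J \<Longrightarrow> j \<le> a"
  shows "inj_on (\<lambda>j. nat (a - j)) J"
proof (rule inj_onI)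
  fix x y assume "x \<in> J" "y \<in> J" and eq: "nat (a - x) = nat (a - y)"
  then have "x \<le> a" "y \<le> a" using assms by auto
  then show "x = y" using eq by linarith
qed

text \<open>Bernoulli's inequality bounds 1 + K * l by a constant times r^l. The root has order m +
  1 rather than m, so m = 0 is no exception and r^m \<le> 2 powr \<epsilon> still holds.\<close>

lemma polynomial_le_exponential:
  fixes K \<epsilon> :: real
  assumes "\<epsilon> > 0" "K \<ge> 0"
  shows "\<exists>C\<ge>1. \<forall>l::nat. (1 + K * real l) ^ m \<le> C * 2 powr (\<epsilon> * real l)"
proof -
  define r where "r = 2 powr (\<epsilon> / real (Suc m))"
  have r: "r > 1" unfolding r_def using assms by (intro gr_one_powr) auto
  define c where "c = 1 + K / (r - 1)"
  have c: "c \<ge> 1" using assms r by (simp add: c_def)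
  have 1: "1 + K * real l \<le> c * r ^ l" for l
  proof -
    have "1 + real l * (r - 1) \<le> (1 + (r - 1)) ^ l" using r by (intro Bernoulli_inequality) simp
    then have b: "1 + real l * (r - 1) \<le> r ^ l" by simp
    have "1 + K * real l = 1 + K / (r - 1) * (real l * (r - 1))" using r by simp
    also have "\<dots> \<le> r ^ l + K / (r - 1) * r ^ l"
    proof (intro add_mono mult_left_mono)
      show "1 \<le> r ^ l" using r by (simp add: one_le_power)
      show "real l * (r - 1) \<le> r ^ l" using b by simp
    qed (use assms r in auto)
    also have "\<dots> = c * r ^ l" by (simp add: c_def algebra_simps)
    finally show ?thesis .
  qed
  have "(1 + K * real l) ^ m \<le> c ^ m * 2 powr (\<epsilon> * real l)" for l
  proof -
    have "(1 + K * real l) ^ m \<le> (c * r ^ l) ^ m" using 1 assms by (intro power_mono) auto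
    also have "\<dots> = c ^ m * (r ^ m) ^ l" by (simp add: power_mult_distrib mult.commute flip: power_mult)
    also have "\<dots> \<le> c ^ m * (2 powr \<epsilon>) ^ l"
    proof (intro mult_left_mono power_mono)
      have "r ^ m = 2 powr (\<epsilon> * real m / real (Suc m))"
        unfolding r_def by (simp add: powr_powr flip: powr_realpow)
      also have "\<dots> \<le> 2 powr \<epsilon>"
        using assms by (intro powr_mono) (auto simp: field_simps)
      finally show "r ^ m \<le> 2 powr \<epsilon>" .
    qed (use c r in auto)
    also have "\<dots> = c ^ m * 2 powr (\<epsilon> * real l)" by (simp add: powr_powr flip: powr_realpow)
    finally show ?thesis .
  qed
  then show ?thesis using c by (intro exI[of _ "c ^ m"]) (auto simp: one_le_power)
qed

lemma dside_dsub:
  assumes "dsub \<tau> R P"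
  shows "dside R powr \<epsilon> = dside P powr \<epsilon> * 2 powr (- \<epsilon> * real (nat (fst P - fst R)))"
  using assms unfolding dside_def dsub_def
  by (simp add: powr_powr algebra_simps flip: powr_add)

text \<open>The selected cubes are those whose level \<open>\<lfloor>log\<^sub>2 (\<ell>(Q)\<^sup>\<epsilon> A\<^sub>Q / |Q|)\<rfloor>\<close> exceeds the
  level of every larger cube of the family. The positive power of the side length absorbs the
  logarithmic losses in \<^const>\<open>dsuper\<close>.\<close>

lemma sparse_selection:
  fixes \<alpha> K :: real and m :: nat
  assumes "\<alpha> > 0" "K \<ge> 0"
  shows "\<exists>C>0. \<forall>(\<tau> :: real ^ 'n::finite) \<F> A B. finite \<F> \<and> dsuper \<tau> K m A \<and> dsuper \<tau> K m B \<longrightarrow>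
    (\<exists>\<S>\<subseteq>\<F>. carleson \<tau> C \<S> \<and> (\<forall>P\<in>\<S>. A P > 0) \<and>
      (\<Sum>Q\<in>\<F>. dside Q powr (\<alpha> - real CARD('n)) * A Q * B Q) \<le>
      C * (\<Sum>P\<in>\<S>. dside P powr (\<alpha> - real CARD('n)) * A P * B P))"
proof -
  \<comment> \<open>Half of \<alpha> enters the quantity a Q that defines the levels, the other half
    remains for summing B; each half beats one polynomial loss.\<close>
  define \<epsilon> where "\<epsilon> = \<alpha> / 2"
  have \<epsilon>: "\<epsilon> > 0" "\<alpha> = \<epsilon> + \<epsilon>" using assms by (auto simp: \<epsilon>_def)
  \<comment> \<open>Only \<epsilon>/2 is spent on the polynomial, so that x^l with x = 2 powr (-
    \<epsilon> / 2) is left over for the sum over generations.\<close>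
  obtain C1 where C1: "C1 \<ge> 1" "\<And>l::nat. (1 + K * real l) ^ m \<le> C1 * 2 powr (\<epsilon> / 2 * real l)"
    using polynomial_le_exponential[of "\<epsilon> / 2" K m] \<epsilon> assms by auto
  define x where "x = 2 powr (- \<epsilon> / 2)"
  have x: "0 < x" "x < 1" using \<epsilon> unfolding x_def by (auto intro: powr_less_one)
  define C where "C = 4 * C1 / (1 - x)"
  have C: "C > 0" "4 * C1 \<le> C" using C1 x by (auto simp: C_def field_simps)
  have main: "\<exists>\<S>\<subseteq>\<F>. carleson \<tau> C \<S> \<and> (\<forall>P\<in>\<S>. A P > 0) \<and>
      (\<Sum>Q\<in>\<F>. dside Q powr (\<alpha> - real CARD('n)) * A Q * B Q) \<le>
      C * (\<Sum>P\<in>\<S>. dside P powr (\<alpha> - real CARD('n)) * A P * B P)"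
    if F: "finite \<F>" and A: "dsuper \<tau> K m A" and B: "dsuper \<tau> K m B"
    for \<tau> :: "real ^ 'n" and \<F> A B
  proof -
    define a where "a Q = dside Q powr (\<epsilon> - real CARD('n)) * A Q" for Q
    define k where "k Q = \<lfloor>log 2 (a Q)\<rfloor>" for Q
    \<comment> \<open>Cubes with A Q = 0 contribute nothing to the sum and have no meaningful
      logarithmic level.\<close>
    define G where "G = {Q\<in>\<F>. A Q > 0}"
    have G: "finite G" "G \<subseteq> \<F>" using F by (auto simp: G_def)
    have A0: "A Q \<ge> 0" and B0: "B Q \<ge> 0" for Q using A B unfolding dsuper_def by blast+
    have ak: "2 powr real_of_int (k Q) \<le> a Q" "a Q < 2 * 2 powr real_of_int (k Q)" if "Q \<in> G" for Q
    proof -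
      have pos: "a Q > 0" using that by (simp add: a_def G_def)
      have "2 powr real_of_int (k Q) \<le> 2 powr (log 2 (a Q))"
        by (intro powr_mono) (auto simp: k_def)
      then show "2 powr real_of_int (k Q) \<le> a Q" using pos by simp
      have "2 powr (log 2 (a Q)) < 2 powr (real_of_int (k Q) + 1)"
        by (intro powr_less_mono) (auto simp: k_def)
      then show "a Q < 2 * 2 powr real_of_int (k Q)" using pos by (simp add: powr_add)
    qed
    define \<S> where "\<S> = {Q\<in>G. \<forall>P\<in>G. dsub \<tau> Q P \<and> P \<noteq> Q \<longrightarrow> k P < k Q}"
    have S: "finite \<S>" "\<S> \<subseteq> G" using G by (auto simp: \<S>_def)
    have avol: "a Q * dvol Q = dside Q powr \<epsilon> * A Q" for Q
      by (simp add: a_def dvol_powr powr_diff)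
    have super: "(\<Sum>R\<in>\<R>. dside R powr \<epsilon> * X R) \<le> C1 * dside P powr \<epsilon> * X P"
      if X: "dsuper \<tau> K m X" and R: "finite \<R>" "disjoint_family_on (dcube \<tau>) \<R>" "\<And>R. R \<in> \<R> \<Longrightarrow> dsub \<tau> R P"
      for X \<R> P
    proof -
      have X0: "X Q \<ge> 0" for Q using X unfolding dsuper_def by blast
      have "(\<Sum>R\<in>\<R>. dside R powr \<epsilon> * X R) \<le> (\<Sum>R\<in>\<R>. C1 * dside P powr \<epsilon> * (X R / (1 + K * real_of_int (fst P - fst R)) ^ m))"
      proof (rule sum_mono)
        fix R assume "R \<in> \<R>"
        then have RP: "dsub \<tau> R P" by (rule R)
        define l where "l = nat (fst P - fst R)"
        have l: "real_of_int (fst P - fst R) = real l" using RP by (simp add: l_def dsub_def)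
        have p: "(1 + K * real l) ^ m > 0" using assms by (intro zero_less_power) (simp add: add_pos_nonneg)
        have "2 powr (- \<epsilon> * real l) * (1 + K * real l) ^ m \<le> 2 powr (- \<epsilon> * real l) * (C1 * 2 powr (\<epsilon> * real l))"
        proof (rule mult_left_mono)
          have "2 powr (\<epsilon> / 2 * real l) \<le> 2 powr (\<epsilon> * real l)" using \<epsilon> by (intro powr_mono) auto
          then show "(1 + K * real l) ^ m \<le> C1 * 2 powr (\<epsilon> * real l)"
            using C1 by (meson mult_left_mono order_trans zero_le_one)
        qed simp
        also have "\<dots> = C1" by (simp add: powr_minus)
        finally have q: "2 powr (- \<epsilon> * real l) \<le> C1 / (1 + K * real l) ^ m"
          using p by (simp add: pos_le_divide_eq)
        have "dside R powr \<epsilon> * X R = dside P powr \<epsilon> * 2 powr (- \<epsilon> * real l) * X R"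
          using dside_dsub[OF RP, of \<epsilon>] by (simp add: l_def)
        also have "\<dots> \<le> dside P powr \<epsilon> * (C1 / (1 + K * real l) ^ m) * X R"
          using q X0 by (intro mult_right_mono mult_left_mono) auto
        finally show "dside R powr \<epsilon> * X R \<le> C1 * dside P powr \<epsilon> * (X R / (1 + K * real_of_int (fst P - fst R)) ^ m)"
          unfolding l by (simp add: mult_ac)
      qed
      also have "\<dots> = C1 * dside P powr \<epsilon> * (\<Sum>R\<in>\<R>. X R / (1 + K * real_of_int (fst P - fst R)) ^ m)"
        by (simp add: sum_distrib_left)
      also have "\<dots> \<le> C1 * dside P powr \<epsilon> * X P"
      proof (rule mult_left_mono)
        show "(\<Sum>R\<in>\<R>. X R / (1 + K * real_of_int (fst P - fst R)) ^ m) \<le> X P"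
          using X R unfolding dsuper_def by blast
      qed (use C1 in simp)
      finally show ?thesis .
    qed
    \<comment> \<open>Nested selected cubes have strictly different levels, so those of equal level
      are disjoint and \<open>super\<close> applies to them.\<close>
    have disj: "disjoint_family_on (dcube \<tau>) {R\<in>\<S>. dsub \<tau> R P \<and> k R = j}" for P j
      unfolding disjoint_family_on_def
    proof (intro ballI impI)
      fix R R' assume R: "R \<in> {R\<in>\<S>. dsub \<tau> R P \<and> k R = j}" "R' \<in> {R\<in>\<S>. dsub \<tau> R P \<and> k R = j}" "R \<noteq> R'"
      have "\<not> dsub \<tau> R R'" "\<not> dsub \<tau> R' R" using R by (auto simp: \<S>_def)
      then show "dcube \<tau> R \<inter> dcube \<tau> R' = {}"
        using dcube_meet_cases[of _ \<tau> R R'] by blast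
    qed
    have carl: "carleson \<tau> C \<S>" unfolding carleson_def
    proof
      fix P assume P: "P \<in> \<S>"
      let ?T = "{R. R \<in> \<S> \<and> dsub \<tau> R P}"
      have T: "finite ?T" using S by simp
      have kP: "k P \<le> k R" if "R \<in> ?T" for R
        using that P by (cases "R = P") (auto simp: \<S>_def intro: less_imp_le)
      \<comment> \<open>On level j the volume of R is at most 2^(-j) * dside R powr \<epsilon> * A
        R. Summing and comparing with the level of P gains 2^(k P - j), so the levels form a
        geometric series.\<close>
      have lev: "(\<Sum>R | R \<in> ?T \<and> k R = j. dvol R) \<le> 2 * C1 * dvol P * (1/2) ^ nat (j - k P)" if j: "j \<in> k ` ?T" for j
      proof -
        have jk: "k P \<le> j" using j kP by auto
        have "(\<Sum>R | R \<in> ?T \<and> k R = j. dvol R) \<le> (\<Sum>R | R \<in> ?T \<and> k R = j. 2 powr (- real_of_int j) * (dside R powr \<epsilon> * A R))"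
        proof (rule sum_mono)
          fix R assume R: "R \<in> {R. R \<in> ?T \<and> k R = j}"
          then have "2 powr real_of_int j \<le> a R" using ak(1)[of R] S by auto
          then have "2 powr real_of_int j * dvol R \<le> dside R powr \<epsilon> * A R"
            unfolding avol[symmetric] by (intro mult_right_mono) auto
          then show "dvol R \<le> 2 powr (- real_of_int j) * (dside R powr \<epsilon> * A R)"
            by (simp add: powr_minus field_simps)
        qed
        also have "\<dots> = 2 powr (- real_of_int j) * (\<Sum>R | R \<in> ?T \<and> k R = j. dside R powr \<epsilon> * A R)"
          by (simp add: sum_distrib_left)
        also have "\<dots> \<le> 2 powr (- real_of_int j) * (C1 * dside P powr \<epsilon> * A P)"
          using disj[of P j] S by (intro mult_left_mono super[OF A]) (auto simp: conj_assoc)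
        also have "\<dots> = 2 powr (- real_of_int j) * (C1 * (a P * dvol P))"
          by (simp add: avol)
        also have "\<dots> \<le> 2 powr (- real_of_int j) * (C1 * (2 * 2 powr real_of_int (k P) * dvol P))"
          using ak(2)[of P] P S C1 by (intro mult_left_mono mult_right_mono less_imp_le) auto
        also have "\<dots> = 2 * C1 * dvol P * 2 powr (- real (nat (j - k P)))"
          using jk by (simp add: powr_diff powr_minus field_simps)
        also have "\<dots> = 2 * C1 * dvol P * (1/2) ^ nat (j - k P)"
          by (simp add: powr_minus powr_realpow power_one_over field_simps)
        finally show ?thesis .
      qed
      have "(\<Sum>R\<in>?T. dvol R) = (\<Sum>j\<in>k ` ?T. \<Sum>R | R \<in> ?T \<and> k R = j. dvol R)"
        using T by (rule sum.image_gen)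
      also have "\<dots> \<le> (\<Sum>j\<in>k ` ?T. 2 * C1 * dvol P * (1/2) ^ nat (j - k P))"
        by (rule sum_mono) (rule lev)
      also have "\<dots> = 2 * C1 * dvol P * (\<Sum>j\<in>k ` ?T. (1/2) ^ nat (j - k P))"
        by (simp add: sum_distrib_left)
      also have "\<dots> \<le> 2 * C1 * dvol P * (1 / (1 - 1/2))"
      proof (intro mult_left_mono finite_geometric_le)
        have "k P \<le> j" if "j \<in> k ` ?T" for j using that kP by auto
        then show "inj_on (\<lambda>j. nat (j - k P)) (k ` ?T)"
          by (rule inj_on_nat_diff_left)
      qed (use C1 T in auto)
      finally have "(\<Sum>R\<in>?T. dvol R) \<le> 4 * C1 * dvol P"
        by simp
      also have "\<dots> \<le> C * dvol P" using C by (intro mult_right_mono) auto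
      finally show "(\<Sum>R | R \<in> \<S> \<and> dsub \<tau> R P. dvol R) \<le> C * dvol P" .
    qed
    define w where "w Q = dside Q powr (\<alpha> - real CARD('n)) * A Q * B Q" for Q
    have w0: "w Q \<ge> 0" for Q using A0 B0 by (simp add: w_def)
    have weq: "w Q = dside Q powr \<epsilon> * a Q * B Q" for Q
    proof -
      have "dside Q powr (\<alpha> - real CARD('n)) = dside Q powr \<epsilon> * dside Q powr (\<epsilon> - real CARD('n))"
        by (simp add: \<epsilon>(2) flip: powr_add)
      then show ?thesis by (simp add: w_def a_def)
    qed
    \<comment> \<open>Among the cubes above Q of level at least k Q, a maximal one is selected:
      every larger cube of G has level below k Q.\<close>
    have cover: "\<exists>P\<in>\<S>. dsub \<tau> Q P \<and> k Q \<le> k P" if "Q \<in> G" for Q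
    proof -
      let ?H = "{P\<in>G. k Q \<le> k P}"
      have "\<And>P. P \<in> ?H \<Longrightarrow> fst P \<le> Max (fst ` G)" using G by auto
      then obtain P where P: "P \<in> dmax \<tau> ?H" "dsub \<tau> Q P"
        using dmax_above[of Q ?H "Max (fst ` G)" \<tau>] \<open>Q \<in> G\<close> by blast
      then have "P \<in> ?H" using dmax_subset by blast
      moreover have "k P' < k P" if "P' \<in> G" "dsub \<tau> P P'" "P' \<noteq> P" for P'
      proof -
        have "P' \<notin> ?H" using P(1) that unfolding dmax_def by blast
        then show ?thesis using that \<open>P \<in> ?H\<close> by auto
      qed
      ultimately show ?thesis using P(2) unfolding \<S>_def by blast
    qed
    \<comment> \<open>Since k Q \<le> k P gives a Q \<le> 2 * a P, the factor A leaves the sum; the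
      rest is summed generation by generation, cubes of equal side being disjoint.\<close>
    have inner: "(\<Sum>Q | Q \<in> G \<and> dsub \<tau> Q P \<and> k Q \<le> k P. w Q) \<le> C * w P" if P: "P \<in> \<S>" for P
    proof -
      let ?T = "{Q. Q \<in> G \<and> dsub \<tau> Q P \<and> k Q \<le> k P}"
      have T: "finite ?T" using G by simp
      have aP: "a P > 0" using P S by (auto simp: a_def G_def)
      have "(\<Sum>Q\<in>?T. w Q) \<le> (\<Sum>Q\<in>?T. 2 * a P * (dside Q powr \<epsilon> * B Q))"
      proof (rule sum_mono)
        fix Q assume Q: "Q \<in> ?T"
        have "a Q \<le> 2 * 2 powr real_of_int (k Q)" using ak(2)[of Q] Q by simp
        also have "\<dots> \<le> 2 * 2 powr real_of_int (k P)" using Q by (intro mult_left_mono powr_mono) auto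
        also have "\<dots> \<le> 2 * a P" using ak(1)[of P] P S by auto
        finally have "dside Q powr \<epsilon> * a Q * B Q \<le> dside Q powr \<epsilon> * (2 * a P) * B Q"
          using B0 by (intro mult_right_mono mult_left_mono) auto
        then show "w Q \<le> 2 * a P * (dside Q powr \<epsilon> * B Q)" unfolding weq by (simp add: mult_ac)
      qed
      also have "\<dots> = 2 * a P * (\<Sum>Q\<in>?T. dside Q powr \<epsilon> * B Q)" by (simp add: sum_distrib_left)
      also have "(\<Sum>Q\<in>?T. dside Q powr \<epsilon> * B Q) = (\<Sum>j\<in>fst ` ?T. \<Sum>Q | Q \<in> ?T \<and> fst Q = j. dside Q powr \<epsilon> * B Q)"
        using T by (rule sum.image_gen)
      also have "\<dots> \<le> (\<Sum>j\<in>fst ` ?T. C1 * dside P powr \<epsilon> * B P * x ^ nat (fst P - j))"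
      proof (rule sum_mono)
        fix j assume "j \<in> fst ` ?T"
        then have j: "j \<le> fst P" by (auto simp: dsub_def)
        define l where "l = nat (fst P - j)"
        have l: "real_of_int (fst P - j) = real l" using j by (simp add: l_def)
        have p: "(1 + K * real l) ^ m > 0" using assms by (intro zero_less_power) (simp add: add_pos_nonneg)
        let ?R = "{Q. Q \<in> ?T \<and> fst Q = j}"
        have dj: "disjoint_family_on (dcube \<tau>) ?R" unfolding disjoint_family_on_def
        proof (intro ballI impI)
          fix Q Q' assume "Q \<in> ?R" "Q' \<in> ?R" "Q \<noteq> Q'"
          then show "dcube \<tau> Q \<inter> dcube \<tau> Q' = {}"
            using mem_dcube_iff_dat[of _ \<tau> Q] mem_dcube_iff_dat[of _ \<tau> Q'] by (auto simp: set_eq_iff)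
        qed
        have "(\<Sum>Q\<in>?R. dside Q powr \<epsilon> * B Q) =
          (\<Sum>Q\<in>?R. dside P powr \<epsilon> * 2 powr (- \<epsilon> * real l) * (1 + K * real l) ^ m * (B Q / (1 + K * real_of_int (fst P - fst Q)) ^ m))"
        proof (rule sum.cong)
          fix Q assume Q: "Q \<in> ?R"
          have lQ: "real_of_int (fst P - fst Q) = real l" using Q l by simp
          have "dside Q powr \<epsilon> = dside P powr \<epsilon> * 2 powr (- \<epsilon> * real l)"
            using dside_dsub[of \<tau> Q P \<epsilon>] Q by (simp add: l_def)
          then show "dside Q powr \<epsilon> * B Q = dside P powr \<epsilon> * 2 powr (- \<epsilon> * real l) * (1 + K * real l) ^ m * (B Q / (1 + K * real_of_int (fst P - fst Q)) ^ m)"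
            unfolding lQ using less_imp_neq[OF p] by (auto simp: mult_ac)
        qed simp
        also have "\<dots> = dside P powr \<epsilon> * 2 powr (- \<epsilon> * real l) * (1 + K * real l) ^ m * (\<Sum>Q\<in>?R. B Q / (1 + K * real_of_int (fst P - fst Q)) ^ m)"
          by (simp add: sum_distrib_left)
        also have "\<dots> \<le> dside P powr \<epsilon> * 2 powr (- \<epsilon> * real l) * (C1 * 2 powr (\<epsilon> / 2 * real l)) * B P"
        proof (intro mult_mono)
          have "finite ?R" by (rule finite_subset[OF _ T]) auto
          then show "(\<Sum>Q\<in>?R. B Q / (1 + K * real_of_int (fst P - fst Q)) ^ m) \<le> B P"
            using B dj unfolding dsuper_def by blast
          show "0 \<le> (\<Sum>Q\<in>?R. B Q / (1 + K * real_of_int (fst P - fst Q)) ^ m)"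
            using B0 assms by (intro sum_nonneg divide_nonneg_nonneg zero_le_power add_nonneg_nonneg mult_nonneg_nonneg) (auto simp: dsub_def)
        qed (use C1 p in auto)
        also have "\<dots> = C1 * dside P powr \<epsilon> * B P * (2 powr (- \<epsilon> * real l) * 2 powr (\<epsilon> / 2 * real l))"
          by (simp add: mult_ac)
        also have "2 powr (- \<epsilon> * real l) * 2 powr (\<epsilon> / 2 * real l) = 2 powr (- \<epsilon> / 2 * real l)"
          by (simp add: field_simps flip: powr_add)
        also have "\<dots> = x ^ l"
          by (simp add: x_def powr_powr flip: powr_realpow)
        finally show "(\<Sum>Q\<in>?R. dside Q powr \<epsilon> * B Q) \<le> C1 * dside P powr \<epsilon> * B P * x ^ nat (fst P - j)"
          unfolding l_def .
      qed
      also have "\<dots> = C1 * dside P powr \<epsilon> * B P * (\<Sum>j\<in>fst ` ?T. x ^ nat (fst P - j))"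
        by (simp add: sum_distrib_left)
      also have "\<dots> \<le> C1 * dside P powr \<epsilon> * B P * (1 / (1 - x))"
      proof (intro mult_left_mono finite_geometric_le)
        have "j \<le> fst P" if "j \<in> fst ` ?T" for j using that by (auto simp: dsub_def)
        then show "inj_on (\<lambda>j. nat (fst P - j)) (fst ` ?T)"
          by (rule inj_on_nat_diff_right)
      qed (use T x C1 B0 in auto)
      finally have "(\<Sum>Q\<in>?T. w Q) \<le> 2 * a P * (C1 * dside P powr \<epsilon> * B P * (1 / (1 - x)))"
        using aP by (simp add: mult_left_mono)
      also have "\<dots> = C / 2 * w P" using x by (simp add: weq C_def field_simps)
      also have "\<dots> \<le> C * w P" using C w0 by (intro mult_right_mono) auto
      finally show ?thesis .
    qed
    have "(\<Sum>Q\<in>\<F>. w Q) = (\<Sum>Q\<in>G. w Q)"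
      using F A0 by (intro sum.mono_neutral_right) (auto simp: G_def w_def less_le)
    also have "\<dots> \<le> (\<Sum>Q\<in>G. \<Sum>P\<in>\<S>. if dsub \<tau> Q P \<and> k Q \<le> k P then w Q else 0)"
    proof (rule sum_mono)
      fix Q assume "Q \<in> G"
      then obtain P where P: "P \<in> \<S>" "dsub \<tau> Q P" "k Q \<le> k P" using cover by blast
      then have "w Q = (if dsub \<tau> Q P \<and> k Q \<le> k P then w Q else 0)" by simp
      also have "\<dots> \<le> (\<Sum>P\<in>\<S>. if dsub \<tau> Q P \<and> k Q \<le> k P then w Q else 0)"
        using P(1) S(1) w0 by (intro member_le_sum) auto
      finally show "w Q \<le> (\<Sum>P\<in>\<S>. if dsub \<tau> Q P \<and> k Q \<le> k P then w Q else 0)" .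
    qed
    also have "\<dots> = (\<Sum>P\<in>\<S>. \<Sum>Q\<in>G. if dsub \<tau> Q P \<and> k Q \<le> k P then w Q else 0)"
      by (rule sum.swap)
    also have "\<dots> = (\<Sum>P\<in>\<S>. \<Sum>Q | Q \<in> G \<and> dsub \<tau> Q P \<and> k Q \<le> k P. w Q)"
      by (rule sum.cong[OF refl]) (use G in \<open>simp add: sum.inter_filter\<close>)
    also have "\<dots> \<le> (\<Sum>P\<in>\<S>. C * w P)" by (intro sum_mono inner)
    finally have "(\<Sum>Q\<in>\<F>. w Q) \<le> C * (\<Sum>P\<in>\<S>. w P)" by (simp add: sum_distrib_left)
    moreover have "\<S> \<subseteq> \<F>" "\<forall>P\<in>\<S>. A P > 0" using S G by (auto simp: G_def)
    ultimately show ?thesis using carl unfolding w_def by blast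
  qed
  show ?thesis using C(1) main by blast
qed

section \<open>The Carleson embedding for logarithmic Orlicz averages\<close>

lemma powr_superadditive:
  fixes r :: real
  assumes "finite I" "\<And>i. i \<in> I \<Longrightarrow> x i \<ge> 0" "r \<ge> 1"
  shows "(\<Sum>i\<in>I. x i powr r) \<le> (\<Sum>i\<in>I. x i) powr r"
proof (cases "(\<Sum>i\<in>I. x i) = 0")
  case True
  then have "\<And>i. i \<in> I \<Longrightarrow> x i = 0" using assms by (simp add: sum_nonneg_eq_0_iff)
  then show ?thesis by simp
next
  case False
  define S where "S = (\<Sum>i\<in>I. x i)"
  have S: "S > 0" using False assms(2) sum_nonneg[of I x] by (simp add: S_def less_le)
  have "(\<Sum>i\<in>I. x i powr r) \<le> (\<Sum>i\<in>I. x i * S powr (r - 1))"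
  proof (rule sum_mono)
    fix i assume i: "i \<in> I"
    have "x i \<le> S" unfolding S_def using assms i by (intro member_le_sum) auto
    then have "x i * x i powr (r - 1) \<le> x i * S powr (r - 1)"
      using assms i by (intro mult_left_mono powr_mono2) auto
    moreover have "x i powr r = x i * x i powr (r - 1)"
      using assms(2)[OF i] by (cases "x i = 0") (auto simp: powr_mult_base)
    ultimately show "x i powr r \<le> x i * S powr (r - 1)" by simp
  qed
  also have "\<dots> = S * S powr (r - 1)" by (simp add: S_def sum_distrib_right)
  also have "\<dots> = S powr r" using S by (simp add: powr_mult_base)
  finally show ?thesis by (simp add: S_def)
qed

lemma ennreal_lincomb:
  "0 \<le> a \<Longrightarrow> 0 \<le> b \<Longrightarrow> 0 \<le> c \<Longrightarrow> 0 \<le> d \<Longrightarrow>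
    ennreal a * ennreal b + ennreal c * ennreal d = ennreal (a * b + c * d)"
  by (simp add: ennreal_mult)

text \<open>Jensen's inequality for the measure g dM. Young's inequality is integrated pointwise at
  the mean value c = I / a of \<open>\<theta>\<close>, where it is an equality for constant
  \<open>\<theta>\<close>, so nothing is lost.\<close>

lemma nn_integral_power_mean:
  fixes g \<theta> :: "'a \<Rightarrow> real"
  assumes [measurable]: "g \<in> borel_measurable M" "\<theta> \<in> borel_measurable M"
    and g: "\<And>x. g x \<ge> 0" and \<theta>: "\<And>x. 0 \<le> \<theta> x"
    and a: "(\<integral>\<^sup>+x. ennreal (g x) \<partial>M) = ennreal a" "a \<ge> 0"
    and I: "(\<integral>\<^sup>+x. ennreal (g x * \<theta> x) \<partial>M) = ennreal I" "I \<ge> 0"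
    and r: "r \<ge> 1"
  shows "ennreal (I powr r) \<le> ennreal (a powr (r - 1)) * (\<integral>\<^sup>+x. ennreal (g x * \<theta> x powr r) \<partial>M)"
proof (cases "I = 0 \<or> r = 1")
  case True
  then show ?thesis
  proof
    assume "r = 1"
    have "a = 0 \<Longrightarrow> I = 0"
    proof -
      assume "a = 0"
      then have "AE x in M. g x = 0" using a g by (simp add: nn_integral_0_iff_AE)
      then have "(\<integral>\<^sup>+x. ennreal (g x * \<theta> x) \<partial>M) = 0"
        using g \<theta> by (subst nn_integral_0_iff_AE) auto
      then show "I = 0" using I by simp
    qed
    moreover have "(\<integral>\<^sup>+x. ennreal (g x * \<theta> x powr r) \<partial>M) = ennreal I"
      using \<theta> \<open>r = 1\<close> by (simp add: I(1)[symmetric])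
    ultimately show ?thesis using \<open>r = 1\<close> I a by (cases "a = 0") (auto simp: ennreal_mult[symmetric])
  qed simp
next
  case False
  then have I0: "I > 0" and r1: "r > 1" using I r by auto
  have a0: "a > 0"
  proof (rule ccontr)
    assume "\<not> a > 0"
    then have "a = 0" using a by simp
    then have "AE x in M. g x = 0" using a g by (simp add: nn_integral_0_iff_AE)
    then have "(\<integral>\<^sup>+x. ennreal (g x * \<theta> x) \<partial>M) = 0"
      using g \<theta> by (subst nn_integral_0_iff_AE) auto
    then show False using I I0 by simp
  qed
  define c where "c = I / a"
  have c: "c > 0" using I0 a0 by (simp add: c_def)
  show ?thesis
  proof (cases "(\<integral>\<^sup>+x. ennreal (g x * \<theta> x powr r) \<partial>M) = top")
    case True
    then show ?thesis using a0 by (simp add: ennreal_mult_top)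
  next
    case False
    then obtain Z where Z: "(\<integral>\<^sup>+x. ennreal (g x * \<theta> x powr r) \<partial>M) = ennreal Z" "Z \<ge> 0"
      by (metis ennreal_cases)
    have pw: "c powr (r - 1) * (g x * \<theta> x) \<le> (1 / r) * (g x * \<theta> x powr r) + ((1 - 1 / r) * c powr r) * g x" for x
    proof -
      have "\<theta> x * c powr (r - 1) \<le> \<theta> x powr r / r + (c powr (r - 1)) powr (r / (r - 1)) / (r / (r - 1))"
        using r1 \<theta> c by (intro Youngs_inequality) (auto simp: field_simps)
      also have "(c powr (r - 1)) powr (r / (r - 1)) = c powr r" using r1 by (simp add: powr_powr)
      also have "c powr r / (r / (r - 1)) = (1 - 1 / r) * c powr r" using r1 by (simp add: field_simps)
      finally have "g x * (\<theta> x * c powr (r - 1)) \<le> g x * (\<theta> x powr r / r + (1 - 1 / r) * c powr r)"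
        using g by (intro mult_left_mono)
      then show ?thesis by (simp add: algebra_simps)
    qed
    have "ennreal (c powr (r - 1) * I) = (\<integral>\<^sup>+x. ennreal (c powr (r - 1) * (g x * \<theta> x)) \<partial>M)"
      using g \<theta> I by (simp add: ennreal_mult nn_integral_cmult)
    also have "\<dots> \<le> (\<integral>\<^sup>+x. ennreal (1 / r) * ennreal (g x * \<theta> x powr r) + ennreal ((1 - 1 / r) * c powr r) * ennreal (g x) \<partial>M)"
    proof (rule nn_integral_mono)
      fix x
      have "ennreal (c powr (r - 1) * (g x * \<theta> x)) \<le> ennreal ((1 / r) * (g x * \<theta> x powr r) + ((1 - 1 / r) * c powr r) * g x)"
        by (rule ennreal_leI[OF pw])
      also have "\<dots> = ennreal (1 / r) * ennreal (g x * \<theta> x powr r) + ennreal ((1 - 1 / r) * c powr r) * ennreal (g x)"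
      proof -
        have "ennreal (1 / r) * ennreal (g x * \<theta> x powr r) = ennreal ((1 / r) * (g x * \<theta> x powr r))"
          using g[of x] r1 by (intro ennreal_mult[symmetric]) auto
        moreover have "ennreal ((1 - 1 / r) * c powr r) * ennreal (g x) = ennreal ((1 - 1 / r) * c powr r * g x)"
          using g[of x] r1 by (intro ennreal_mult[symmetric]) auto
        ultimately show ?thesis using g[of x] r1 by (simp only:, intro ennreal_plus) auto
      qed
      finally show "ennreal (c powr (r - 1) * (g x * \<theta> x)) \<le> ennreal (1 / r) * ennreal (g x * \<theta> x powr r) + ennreal ((1 - 1 / r) * c powr r) * ennreal (g x)" .
    qed
    also have "\<dots> = ennreal (1 / r) * ennreal Z + ennreal ((1 - 1 / r) * c powr r) * ennreal a"
      by (simp add: nn_integral_add nn_integral_cmult Z a)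
    also have "\<dots> = ennreal (Z / r + (1 - 1 / r) * c powr r * a)"
      using Z a r1 by (simp add: ennreal_mult[symmetric] ennreal_plus[symmetric] del: ennreal_plus)
    finally have "c powr (r - 1) * I \<le> Z / r + (1 - 1 / r) * c powr r * a"
      using Z a r1 by (subst (asm) ennreal_le_iff) (auto intro!: add_nonneg_nonneg)
    moreover have "c powr (r - 1) * I = c powr r * a"
    proof -
      have "c powr r = c * c powr (r - 1)" using powr_mult_base[of c "r - 1"] c by simp
      moreover have "I = c * a" using a0 by (simp add: c_def)
      ultimately show ?thesis by simp
    qed
    ultimately have "c powr r * a / r \<le> Z / r" by (simp add: left_diff_distrib)
    then have "c powr r * a \<le> Z" using r1 by (simp add: divide_le_cancel)
    then have "a powr (r - 1) * (c powr r * a) \<le> a powr (r - 1) * Z" by (intro mult_left_mono) auto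
    moreover have "a powr (r - 1) * (c powr r * a) = I powr r"
      using a0 I0 by (simp add: c_def powr_divide powr_diff)
    ultimately show ?thesis unfolding Z(1) using Z(2) by (subst ennreal_mult[symmetric]) (auto intro: ennreal_leI)
  qed
qed

section \<open>Logarithmic factors and their sums over dyadic levels\<close>

lemma ln_exp1_ge_1: "x \<ge> 0 \<Longrightarrow> ln (exp 1 + x) \<ge> (1::real)"
proof -
  assume "x \<ge> 0"
  then have "ln (exp 1) \<le> ln (exp 1 + x)" by (subst ln_le_cancel_iff) (auto intro: add_pos_nonneg)
  then show ?thesis by simp
qed

lemma LlogL_nonneg [simp]: "LlogL p a x \<ge> 0"
  by (simp add: LlogL_def)

lemma measurable_LlogL [measurable]: "LlogL p a \<in> borel_measurable borel"
  unfolding LlogL_def by measurable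

lemma ln_exp1_two_power_ge: "ln (exp 1 + 2 powr (real i - 1)) \<ge> (1 + real i) / 4"
proof (cases "i \<le> 3")
  case True
  then have "(1 + real i) / 4 \<le> 1" by simp
  also have "\<dots> \<le> ln (exp 1 + 2 powr (real i - 1))" by (intro ln_exp1_ge_1) simp
  finally show ?thesis .
next
  case False
  have "(1 + real i) / 4 \<le> (real i - 1) * (1/2)" using False by simp
  also have "\<dots> \<le> (real i - 1) * ln 2" using False ln2_ge_two_thirds by (intro mult_left_mono) auto
  also have "\<dots> = ln (2 powr (real i - 1))" by (simp add: ln_powr)
  also have "\<dots> \<le> ln (exp 1 + 2 powr (real i - 1))" by (subst ln_le_cancel_iff) (auto intro: add_pos_pos)
  finally show ?thesis .
qed

text \<open>If j lies i levels below the top level N, about log2 y, the logarithm is at least (1 +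
  i) / 4. The sum is therefore dominated, up to a constant, by the series of (1 + i) powr (-
  \<kappa>), uniformly in y; its convergence is where \<kappa> > 1 enters.\<close>

lemma log_tail_sum_bound:
  fixes \<kappa> :: real
  assumes "\<kappa> > 1"
  shows "\<exists>C>0. \<forall>J y. finite J \<and> y \<ge> 0 \<longrightarrow>
    (\<Sum>j\<in>J. if 2 powr (real_of_int j - 2) < y then ln (exp 1 + y / 2 powr (real_of_int j - 1)) powr (- \<kappa>) else 0) \<le> C"
proof -
  define z where "z i = 4 powr \<kappa> * real (Suc i) powr (- \<kappa>)" for i
  have "summable (\<lambda>i. real i powr (- \<kappa>))" using assms by (subst summable_real_powr_iff) simp
  then have "summable (\<lambda>i. real (Suc i) powr (- \<kappa>))" by (subst summable_Suc_iff)
  then have sz: "summable z" unfolding z_def by (rule summable_mult)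
  have z0: "z i \<ge> 0" for i by (simp add: z_def)
  have main: "(\<Sum>j\<in>J. if 2 powr (real_of_int j - 2) < y then ln (exp 1 + y / 2 powr (real_of_int j - 1)) powr (- \<kappa>) else 0) \<le> suminf z + 1"
    if J: "finite J" and y: "y \<ge> 0" for J y
  proof -
    define N where "N = \<lceil>log 2 y\<rceil> + 1"
    define J' where "J' = {j\<in>J. 2 powr (real_of_int j - 2) < y}"
    have J'N: "j \<le> N" "y > 0" if "j \<in> J'" for j
    proof -
      have lt: "2 powr (real_of_int j - 2) < y" using that by (simp add: J'_def)
      then show "y > 0" by (meson le_less_trans powr_ge_zero)
      then have "real_of_int j - 2 < log 2 y" using lt by (simp add: less_log_iff)
      then show "j \<le> N" unfolding N_def by linarith
    qed
    have term_le: "ln (exp 1 + y / 2 powr (real_of_int j - 1)) powr (- \<kappa>) \<le> z (nat (N - j))" if j: "j \<in> J'" for j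
    proof -
      define i where "i = nat (N - j)"
      have i: "real i = real_of_int N - real_of_int j" using J'N(1)[OF j] by (simp add: i_def)
      have yp: "y > 0" using J'N(2)[OF j] .
      have "real i - 1 \<le> log 2 y - (real_of_int j - 1)" unfolding i N_def by linarith
      then have "2 powr (real i - 1) \<le> 2 powr (log 2 y - (real_of_int j - 1))" by (intro powr_mono) auto
      also have "\<dots> = y / 2 powr (real_of_int j - 1)"
        using yp unfolding powr_diff[of 2 "log 2 y" "real_of_int j - 1"] by simp
      finally have "ln (exp 1 + 2 powr (real i - 1)) \<le> ln (exp 1 + y / 2 powr (real_of_int j - 1))"
        by (subst ln_le_cancel_iff) (auto intro!: add_pos_nonneg simp: y)
      then have "(1 + real i) / 4 \<le> ln (exp 1 + y / 2 powr (real_of_int j - 1))"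
        using ln_exp1_two_power_ge[of i] by linarith
      then have "ln (exp 1 + y / 2 powr (real_of_int j - 1)) powr (- \<kappa>) \<le> ((1 + real i) / 4) powr (- \<kappa>)"
        using assms by (intro powr_mono2') auto
      also have "\<dots> = z i" by (simp add: z_def powr_divide powr_minus field_simps)
      finally show ?thesis by (simp add: i_def)
    qed
    have "(\<Sum>j\<in>J. if 2 powr (real_of_int j - 2) < y then ln (exp 1 + y / 2 powr (real_of_int j - 1)) powr (- \<kappa>) else 0)
      = (\<Sum>j\<in>J'. ln (exp 1 + y / 2 powr (real_of_int j - 1)) powr (- \<kappa>))"
      unfolding J'_def using J by (simp add: sum.inter_filter)
    also have "\<dots> \<le> (\<Sum>j\<in>J'. z (nat (N - j)))" by (rule sum_mono) (rule term_le)
    also have "\<dots> = (\<Sum>i\<in>(\<lambda>j. nat (N - j)) ` J'. z i)"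
      using sum.reindex[OF inj_on_nat_diff_right[of J' N], of z] J'N by (simp add: o_def)
    also have "\<dots> \<le> suminf z" using J sz z0 by (intro sum_le_suminf) (auto simp: J'_def)
    finally show ?thesis by simp
  qed
  have "suminf z + 1 > 0" using suminf_nonneg[OF sz z0] by simp
  then show ?thesis using main by blast
qed

text \<open>Group the cubes by \<^term>\<open>k P\<close> and replace each group by its maximal cubes. The power mean
  inequality with respect to \<open>F\<^bsup>p\<^esup> dx\<close> then leaves a sum over levels of powers of logarithms, which
  converges because \<open>\<kappa> s / p > 1\<close>.\<close>

lemma carleson_embedding:
  fixes p s \<kappa> C :: real
  assumes p: "1 < p" "p \<le> s" and \<kappa>: "\<kappa> * s / p > 1" "\<kappa> > 0" and C: "C > 0"
  shows "\<exists>C'>0. \<forall>(\<tau> :: real ^ 'n::finite) \<S> F k a. finite \<S> \<and> carleson \<tau> C \<S> \<and>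
     F \<in> borel_measurable lebesgue \<and> (\<forall>x. F x \<ge> 0) \<and>
     (\<integral>\<^sup>+x. ennreal (F x powr p) \<partial>lebesgue) = ennreal a \<and> a \<ge> 0 \<and>
     (\<forall>P\<in>\<S>. ennreal (dvol P) \<le> (dint \<tau> P (\<lambda>x. LlogL p (- \<kappa>) (F x / 2 powr (real_of_int (k P) - 1)))))
    \<longrightarrow> (\<Sum>P\<in>\<S>. (dvol P powr (1 / p) * 2 powr real_of_int (k P)) powr s) \<le> C' * a powr (s / p)"
proof -
  define r where "r = s / p"
  have r: "r \<ge> 1" using p by (simp add: r_def)
  obtain C2 where C2: "C2 > 0" "\<And>J y. finite J \<Longrightarrow> y \<ge> 0 \<Longrightarrow>
    (\<Sum>j\<in>J. if 2 powr (real_of_int j - 2) < y then ln (exp 1 + y / 2 powr (real_of_int j - 1)) powr (- (\<kappa> * r)) else 0) \<le> C2"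
    using log_tail_sum_bound[of "\<kappa> * r"] \<kappa> by (auto simp: r_def)
  \<comment> \<open>The factor 2 powr (1 + p) is what remains of the constant in \<open>VI\<close>
    once 2 powr (- j * p) is split off.\<close>
  define C' where "C' = C * 2 powr ((1 + p) * r) * C2"
  have C': "C' > 0" using C C2 by (simp add: C'_def)
  have main: "(\<Sum>P\<in>\<S>. (dvol P powr (1 / p) * 2 powr real_of_int (k P)) powr s) \<le> C' * a powr (s / p)"
    if S: "finite \<S>" and carl: "carleson \<tau> C \<S>" and F[measurable]: "F \<in> borel_measurable lebesgue"
      and F0: "\<And>x. F x \<ge> 0" and a: "(\<integral>\<^sup>+x. ennreal (F x powr p) \<partial>lebesgue) = ennreal a" "a \<ge> 0"
      and k: "\<And>P. P \<in> \<S> \<Longrightarrow> ennreal (dvol P) \<le> (dint \<tau> P (\<lambda>x. LlogL p (- \<kappa>) (F x / 2 powr (real_of_int (k P) - 1))))"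
    for \<tau> :: "real ^ 'n" and \<S> F k a
  proof -
    \<comment> \<open>The cut lies at half of the test height 2 powr (j - 1): below it the modular
      integrand is at most (1/2) powr p \<le> 1/2, so this part can be absorbed into the volume of
      P.\<close>
    define \<theta> where "\<theta> j x = (if 2 powr (real_of_int j - 2) < F x then ln (exp 1 + F x / 2 powr (real_of_int j - 1)) powr (- \<kappa>) else 0)" for j :: int and x
    have \<theta>0: "\<theta> j x \<ge> 0" for j x by (simp add: \<theta>_def)
    have \<theta>1: "\<theta> j x \<le> 1" for j x
    proof -
      have "ln (exp 1 + F x / 2 powr (real_of_int j - 1)) \<ge> 1" using F0 by (intro ln_exp1_ge_1) auto
      then have "ln (exp 1 + F x / 2 powr (real_of_int j - 1)) powr (- \<kappa>) \<le> 1 powr (- \<kappa>)"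
        using \<kappa> by (intro powr_mono2') auto
      then show ?thesis by (auto simp: \<theta>_def)
    qed
    have [measurable]: "\<theta> j \<in> borel_measurable lebesgue" for j unfolding \<theta>_def by measurable
    define I where "I j = enn2real (\<integral>\<^sup>+x. ennreal (F x powr p * \<theta> j x) \<partial>lebesgue)" for j
    have Ile: "(\<integral>\<^sup>+x. ennreal (F x powr p * \<theta> j x) \<partial>lebesgue) \<le> ennreal a" for j
      unfolding a(1)[symmetric] by (intro nn_integral_mono ennreal_leI) (simp add: \<theta>1 mult_left_le)
    have I: "(\<integral>\<^sup>+x. ennreal (F x powr p * \<theta> j x) \<partial>lebesgue) = ennreal (I j)" "I j \<ge> 0" for j
      unfolding I_def using Ile[of j] by (auto simp: top_unique less_top le_less_trans[OF _ ennreal_less_top])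
    define \<S>k where "\<S>k j = {P\<in>\<S>. k P = j}" for j
    define V where "V j = (\<Sum>P\<in>dmax \<tau> (\<S>k j). dvol P)" for j
    have fin: "finite (\<S>k j)" "finite (dmax \<tau> (\<S>k j))" for j
      using S finite_subset[OF dmax_subset[of \<tau> "\<S>k j"]] by (auto simp: \<S>k_def)
    have V0: "V j \<ge> 0" for j unfolding V_def by (intro sum_nonneg) auto
    have vol: "ennreal (dvol P) \<le> ennreal (2 * 2 powr (- (real_of_int j - 1) * p)) * (dint \<tau> P (\<lambda>x. F x powr p * \<theta> j x))"
      if P: "P \<in> \<S>k j" for P j
    proof -
      let ?t = "2 powr (real_of_int j - 1)"
      let ?X = "dint \<tau> P (\<lambda>x. F x powr p * \<theta> j x)"
      have pw: "LlogL p (- \<kappa>) (F x / ?t) \<le> 1/2 + 2 powr (- (real_of_int j - 1) * p) * (F x powr p * \<theta> j x)" for x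
      proof -
        have eq: "(F x / ?t) powr p = 2 powr (- (real_of_int j - 1) * p) * F x powr p"
        proof -
          have "2 powr (- (real_of_int j - 1) * p) = inverse (2 powr ((real_of_int j - 1) * p))"
            by (simp only: mult_minus_left powr_minus)
          moreover have "(F x / ?t) powr p = F x powr p / 2 powr ((real_of_int j - 1) * p)"
            by (simp add: powr_divide F0 powr_powr)
          ultimately show ?thesis by (simp add: divide_inverse)
        qed
        show ?thesis
        proof (cases "2 powr (real_of_int j - 2) < F x")
          case True
          then show ?thesis by (simp add: LlogL_def eq \<theta>_def mult_ac)
        next
          case False
          have L: "ln (exp 1 + F x / ?t) \<ge> 1" using F0 by (intro ln_exp1_ge_1) auto
          have "ln (exp 1 + F x / ?t) powr (- \<kappa>) \<le> 1 powr (- \<kappa>)" using L \<kappa> by (intro powr_mono2') auto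
          then have "LlogL p (- \<kappa>) (F x / ?t) \<le> (F x / ?t) powr p * 1"
            unfolding LlogL_def by (intro mult_left_mono) auto
          also have "\<dots> \<le> (1/2) powr p"
          proof -
            have "F x \<le> 2 powr (real_of_int j - 2)" using False by simp
            also have "\<dots> = ?t * (1/2)" by (simp add: powr_diff)
            finally have "F x / ?t \<le> 1/2" by (simp add: field_simps)
            then show ?thesis using F0 p by (simp add: powr_mono2)
          qed
          also have "\<dots> \<le> (1/2) powr 1" using p by (intro powr_mono') auto
          finally show ?thesis using False by (simp add: \<theta>_def)
        qed
      qed
      have "ennreal (dvol P) \<le> (dint \<tau> P (\<lambda>x. LlogL p (- \<kappa>) (F x / ?t)))"
        using k[of P] P by (simp add: \<S>k_def)
      also have "\<dots> \<le> (\<integral>\<^sup>+x. ennreal (1/2) * indicator (dcube \<tau> P) x + ennreal (2 powr (- (real_of_int j - 1) * p)) * (ennreal (F x powr p * \<theta> j x) * indicator (dcube \<tau> P) x) \<partial>lebesgue)"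
      proof (rule nn_integral_mono)
        fix x
        have "ennreal (LlogL p (- \<kappa>) (F x / ?t)) \<le> ennreal (1/2 + 2 powr (- (real_of_int j - 1) * p) * (F x powr p * \<theta> j x))"
          by (rule ennreal_leI[OF pw])
        also have "\<dots> = ennreal (1/2) + ennreal (2 powr (- (real_of_int j - 1) * p)) * ennreal (F x powr p * \<theta> j x)"
          using \<theta>0[of j x] by (subst ennreal_plus) (auto simp: ennreal_mult)
        finally show "ennreal (LlogL p (- \<kappa>) (F x / ?t)) * indicator (dcube \<tau> P) x \<le> ennreal (1/2) * indicator (dcube \<tau> P) x + ennreal (2 powr (- (real_of_int j - 1) * p)) * (ennreal (F x powr p * \<theta> j x) * indicator (dcube \<tau> P) x)"
          by (cases "x \<in> dcube \<tau> P") auto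
      qed
      also have "\<dots> = ennreal (1/2) * ennreal (dvol P) + ennreal (2 powr (- (real_of_int j - 1) * p)) * ?X"
        by (subst nn_integral_add) (auto simp: nn_integral_cmult)
      finally have le: "ennreal (dvol P) \<le> ennreal (1/2) * ennreal (dvol P) + ennreal (2 powr (- (real_of_int j - 1) * p)) * ?X" .
      have "?X \<le> ennreal a"
        by (rule order_trans[OF _ Ile[of j]], rule nn_integral_mono) (auto simp: indicator_def)
      then have "?X \<noteq> top" by (auto simp: top_unique)
      then obtain X where X: "?X = ennreal X" "X \<ge> 0" using ennreal_cases[of ?X] by blast
      have "ennreal (1/2) * ennreal (dvol P) + ennreal (2 powr (- (real_of_int j - 1) * p)) * ennreal X
        = ennreal (1/2 * dvol P + 2 powr (- (real_of_int j - 1) * p) * X)"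
        by (rule ennreal_lincomb) (use X in auto)
      with le X(1) have "ennreal (dvol P) \<le> ennreal (1/2 * dvol P + 2 powr (- (real_of_int j - 1) * p) * X)"
        by (simp only:)
      then have "dvol P \<le> 1/2 * dvol P + 2 powr (- (real_of_int j - 1) * p) * X"
        by (subst (asm) ennreal_le_iff) (use X in auto)
      then show ?thesis unfolding X(1) using X(2)
        by (subst ennreal_mult[symmetric]) (auto intro!: ennreal_leI)
    qed
    have VI: "V j \<le> 2 * 2 powr (- (real_of_int j - 1) * p) * I j" for j
    proof -
      let ?M = "dmax \<tau> (\<S>k j)" and ?c = "2 * 2 powr (- (real_of_int j - 1) * p)"
      have "ennreal (V j) = (\<Sum>P\<in>?M. ennreal (dvol P))" unfolding V_def by (simp add: sum_ennreal)
      also have "\<dots> \<le> (\<Sum>P\<in>?M. ennreal ?c * (dint \<tau> P (\<lambda>x. F x powr p * \<theta> j x)))"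
        using dmax_subset[of \<tau> "\<S>k j"] by (intro sum_mono vol) blast
      also have "\<dots> = ennreal ?c * (\<integral>\<^sup>+x. (\<Sum>P\<in>?M. ennreal (F x powr p * \<theta> j x) * indicator (dcube \<tau> P) x) \<partial>lebesgue)"
        by (simp add: sum_distrib_left nn_integral_sum)
      also have "\<dots> \<le> ennreal ?c * (\<integral>\<^sup>+x. ennreal (F x powr p * \<theta> j x) \<partial>lebesgue)"
      proof (intro mult_left_mono nn_integral_mono)
        fix x
        have "(\<Sum>P\<in>?M. ennreal (F x powr p * \<theta> j x) * indicator (dcube \<tau> P) x) = ennreal (F x powr p * \<theta> j x) * indicator (\<Union>P\<in>?M. dcube \<tau> P) x"
          using fin dmax_disjoint[of \<tau> "\<S>k j"]
          by (simp add: indicator_UN_disjoint sum_distrib_left)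
        then show "(\<Sum>P\<in>?M. ennreal (F x powr p * \<theta> j x) * indicator (dcube \<tau> P) x) \<le> ennreal (F x powr p * \<theta> j x)"
          by (auto simp: indicator_def)
      qed simp
      also have "\<dots> = ennreal (?c * I j)" unfolding I(1) using I(2) by (simp add: ennreal_mult)
      finally show ?thesis using I(2)[of j] by (simp add: ennreal_le_iff)
    qed
    \<comment> \<open>Below a maximal cube R, dvol P powr r \<le> dvol P * dvol R powr (r - 1), so
      the packing condition applies; superadditivity of the power then collects the maximal
      cubes.\<close>
    have lev: "(\<Sum>P\<in>\<S>k j. dvol P powr r) \<le> C * V j powr r" for j
    proof -
      let ?M = "dmax \<tau> (\<S>k j)"
      have "(\<Sum>P\<in>\<S>k j. dvol P powr r) \<le> (\<Sum>P\<in>\<S>k j. \<Sum>R\<in>?M. if dsub \<tau> P R then dvol P powr r else 0)"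
      proof (rule sum_mono)
        fix P assume P: "P \<in> \<S>k j"
        have "\<And>R. R \<in> \<S>k j \<Longrightarrow> fst R \<le> Max (fst ` \<S>k j)" using fin by auto
        then obtain R where R: "R \<in> ?M" "dsub \<tau> P R" using dmax_above[OF P] by blast
        then have "dvol P powr r = (if dsub \<tau> P R then dvol P powr r else 0)" by simp
        also have "\<dots> \<le> (\<Sum>R\<in>?M. if dsub \<tau> P R then dvol P powr r else 0)"
          using R(1) fin by (intro member_le_sum) auto
        finally show "dvol P powr r \<le> (\<Sum>R\<in>?M. if dsub \<tau> P R then dvol P powr r else 0)" .
      qed
      also have "\<dots> = (\<Sum>R\<in>?M. \<Sum>P\<in>\<S>k j. if dsub \<tau> P R then dvol P powr r else 0)"
        by (rule sum.swap)
      also have "\<dots> \<le> (\<Sum>R\<in>?M. C * dvol R powr r)"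
      proof (rule sum_mono)
        fix R assume "R \<in> ?M"
        then have R: "R \<in> \<S>" using dmax_subset[of \<tau> "\<S>k j"] by (auto simp: \<S>k_def)
        have "(\<Sum>P\<in>\<S>k j. if dsub \<tau> P R then dvol P powr r else 0) \<le> (\<Sum>P\<in>\<S>. if dsub \<tau> P R then dvol P powr r else 0)"
          using S by (intro sum_mono2) (auto simp: \<S>k_def)
        also have "\<dots> = (\<Sum>P | P \<in> \<S> \<and> dsub \<tau> P R. dvol P powr r)" using S by (simp add: sum.inter_filter)
        also have "\<dots> \<le> (\<Sum>P | P \<in> \<S> \<and> dsub \<tau> P R. dvol P * dvol R powr (r - 1))"
        proof (rule sum_mono)
          fix P assume "P \<in> {P. P \<in> \<S> \<and> dsub \<tau> P R}"
          then have "dvol P \<le> dvol R" using dvol_dsub by blast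
          then have "dvol P * dvol P powr (r - 1) \<le> dvol P * dvol R powr (r - 1)"
            using r by (intro mult_left_mono powr_mono2) auto
          then show "dvol P powr r \<le> dvol P * dvol R powr (r - 1)" by (simp add: powr_mult_base)
        qed
        also have "\<dots> = (\<Sum>P | P \<in> \<S> \<and> dsub \<tau> P R. dvol P) * dvol R powr (r - 1)"
          by (simp add: sum_distrib_right)
        also have "\<dots> \<le> C * dvol R * dvol R powr (r - 1)"
          using carl R unfolding carleson_def by (intro mult_right_mono) auto
        also have "\<dots> = C * dvol R powr r" by (simp add: powr_mult_base mult.assoc)
        finally show "(\<Sum>P\<in>\<S>k j. if dsub \<tau> P R then dvol P powr r else 0) \<le> C * dvol R powr r" .
      qed
      also have "\<dots> = C * (\<Sum>R\<in>?M. dvol R powr r)" by (simp add: sum_distrib_left)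
      also have "\<dots> \<le> C * V j powr r"
        unfolding V_def using C fin r by (intro mult_left_mono powr_superadditive) auto
      finally show ?thesis .
    qed
    \<comment> \<open>The powers of 2^j cancel because s = p * r. No level is favoured, so
      convergence has to come from the functions \<open>\<theta> j\<close>.\<close>
    have lev2: "2 powr (real_of_int j * s) * V j powr r \<le> 2 powr ((1 + p) * r) * I j powr r" for j
    proof -
      have "V j powr r \<le> (2 * 2 powr (- (real_of_int j - 1) * p) * I j) powr r"
        using VI[of j] V0 r by (intro powr_mono2) auto
      also have "\<dots> = 2 powr ((1 - (real_of_int j - 1) * p) * r) * I j powr r"
      proof -
        have "2 * 2 powr (- X) = 2 powr (1 - X)" for X :: real
          by (simp add: powr_diff powr_minus divide_inverse)
        then have "2 * 2 powr (- (real_of_int j - 1) * p) = 2 powr (1 - (real_of_int j - 1) * p)"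
          by (simp only: mult_minus_left)
        then show ?thesis using I(2)[of j] by (simp add: powr_mult powr_powr)
      qed
      finally have "2 powr (real_of_int j * s) * V j powr r \<le> 2 powr (real_of_int j * s) * (2 powr ((1 - (real_of_int j - 1) * p) * r) * I j powr r)"
        by (intro mult_left_mono) auto
      also have "\<dots> = 2 powr (real_of_int j * s + (1 - (real_of_int j - 1) * p) * r) * I j powr r"
        by (simp add: powr_add)
      also have "real_of_int j * s + (1 - (real_of_int j - 1) * p) * r = (1 + p) * r"
        using p by (simp add: r_def field_simps)
      finally show ?thesis .
    qed
    have fink: "finite (k ` \<S>)" using S by simp
    \<comment> \<open>The power mean inequality moves the exponent r onto \<open>\<theta> j\<close>,
      where the sum over j is bounded pointwise; this is where \<kappa> * r > 1 enters.\<close>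
    have sumI: "(\<Sum>j\<in>k ` \<S>. I j powr r) \<le> C2 * a powr r"
    proof -
      have "ennreal (\<Sum>j\<in>k ` \<S>. I j powr r) = (\<Sum>j\<in>k ` \<S>. ennreal (I j powr r))" by (simp add: sum_ennreal)
      also have "\<dots> \<le> (\<Sum>j\<in>k ` \<S>. ennreal (a powr (r - 1)) * (\<integral>\<^sup>+x. ennreal (F x powr p * \<theta> j x powr r) \<partial>lebesgue))"
        using \<theta>0 by (intro sum_mono nn_integral_power_mean[OF _ _ _ _ a I r]) auto
      also have "\<dots> = ennreal (a powr (r - 1)) * (\<integral>\<^sup>+x. (\<Sum>j\<in>k ` \<S>. ennreal (F x powr p * \<theta> j x powr r)) \<partial>lebesgue)"
        by (subst nn_integral_sum) (auto simp: sum_distrib_left)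
      also have "\<dots> \<le> ennreal (a powr (r - 1)) * (\<integral>\<^sup>+x. ennreal C2 * ennreal (F x powr p) \<partial>lebesgue)"
      proof (intro mult_left_mono nn_integral_mono)
        fix x
        have "(\<Sum>j\<in>k ` \<S>. \<theta> j x powr r) = (\<Sum>j\<in>k ` \<S>. if 2 powr (real_of_int j - 2) < F x then ln (exp 1 + F x / 2 powr (real_of_int j - 1)) powr (- (\<kappa> * r)) else 0)"
          using r by (intro sum.cong refl) (auto simp: \<theta>_def powr_powr)
        also have "\<dots> \<le> C2" using C2(2)[OF fink F0] .
        finally have "F x powr p * (\<Sum>j\<in>k ` \<S>. \<theta> j x powr r) \<le> F x powr p * C2" by (intro mult_left_mono) auto
        then have "ennreal (F x powr p * (\<Sum>j\<in>k ` \<S>. \<theta> j x powr r)) \<le> ennreal (F x powr p * C2)" by (rule ennreal_leI)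
        then show "(\<Sum>j\<in>k ` \<S>. ennreal (F x powr p * \<theta> j x powr r)) \<le> ennreal C2 * ennreal (F x powr p)"
          using C2(1) by (simp add: sum_ennreal sum_distrib_left ennreal_mult[symmetric] mult.commute)
      qed simp
      also have "\<dots> = ennreal (a powr (r - 1)) * (ennreal C2 * ennreal a)"
        by (simp add: nn_integral_cmult a(1))
      also have "\<dots> = ennreal (C2 * a powr r)"
      proof -
        have "a powr (r - 1) * (C2 * a) = C2 * a powr r"
          using a(2) by (cases "a = 0") (auto simp: powr_diff)
        then show ?thesis using C2(1) a(2) by (simp add: ennreal_mult[symmetric])
      qed
      finally show ?thesis using C2(1) by (simp add: ennreal_le_iff)
    qed
    have "(\<Sum>P\<in>\<S>. (dvol P powr (1 / p) * 2 powr real_of_int (k P)) powr s) = (\<Sum>P\<in>\<S>. 2 powr (real_of_int (k P) * s) * dvol P powr r)"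
      by (intro sum.cong refl) (simp add: powr_mult powr_powr r_def mult.commute)
    also have "\<dots> = (\<Sum>j\<in>k ` \<S>. \<Sum>P | P \<in> \<S> \<and> k P = j. 2 powr (real_of_int (k P) * s) * dvol P powr r)"
      using S by (rule sum.image_gen)
    also have "\<dots> = (\<Sum>j\<in>k ` \<S>. 2 powr (real_of_int j * s) * (\<Sum>P\<in>\<S>k j. dvol P powr r))"
      by (intro sum.cong refl) (simp add: \<S>k_def sum_distrib_left)
    also have "\<dots> \<le> (\<Sum>j\<in>k ` \<S>. C * (2 powr ((1 + p) * r) * I j powr r))"
    proof (rule sum_mono)
      fix j
      have "2 powr (real_of_int j * s) * (\<Sum>P\<in>\<S>k j. dvol P powr r) \<le> 2 powr (real_of_int j * s) * (C * V j powr r)"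
        by (intro mult_left_mono lev) auto
      also have "\<dots> = C * (2 powr (real_of_int j * s) * V j powr r)" by simp
      also have "\<dots> \<le> C * (2 powr ((1 + p) * r) * I j powr r)" using C by (intro mult_left_mono lev2) auto
      finally show "2 powr (real_of_int j * s) * (\<Sum>P\<in>\<S>k j. dvol P powr r) \<le> C * (2 powr ((1 + p) * r) * I j powr r)" .
    qed
    also have "\<dots> = C * 2 powr ((1 + p) * r) * (\<Sum>j\<in>k ` \<S>. I j powr r)" by (simp add: sum_distrib_left mult.assoc)
    also have "\<dots> \<le> C * 2 powr ((1 + p) * r) * (C2 * a powr r)" using C by (intro mult_left_mono sumI) auto
    finally show ?thesis by (simp add: C'_def r_def mult_ac)
  qed
  show ?thesis using C' main by (intro exI[of _ C']) blast
qed

section \<open>Young inequalities with logarithms\<close>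

lemma powr_le_exp:
  fixes \<kappa> \<eta> :: real
  assumes "\<kappa> \<ge> 0" "\<eta> > 0"
  shows "\<exists>C\<ge>1. \<forall>u>0. u powr \<kappa> \<le> C * exp (\<eta> * u)"
proof (cases "\<kappa> = 0")
  case True
  then show ?thesis using assms by (intro exI[of _ 1]) auto
next
  case False
  then have k: "\<kappa> > 0" using assms by simp
  define C where "C = max 1 ((\<kappa> / \<eta>) powr \<kappa>)"
  have "u powr \<kappa> \<le> C * exp (\<eta> * u)" if u: "u > 0" for u
  proof -
    define t where "t = \<eta> * u / \<kappa>"
    have t: "t > 0" using u k assms by (simp add: t_def)
    have "u powr \<kappa> = (\<kappa> / \<eta> * t) powr \<kappa>" using k assms by (simp add: t_def)
    also have "\<dots> = (\<kappa> / \<eta>) powr \<kappa> * t powr \<kappa>" by (rule powr_mult)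
    also have "\<dots> \<le> C * (exp t) powr \<kappa>"
    proof (intro mult_mono powr_mono2)
      show "t \<le> exp t" using exp_ge_add_one_self[of t] by linarith
    qed (use k t in \<open>auto simp: C_def\<close>)
    also have "(exp t) powr \<kappa> = exp (\<eta> * u)" using k by (simp add: powr_def t_def)
    finally show ?thesis .
  qed
  then show ?thesis by (intro exI[of _ C]) (auto simp: C_def)
qed

text \<open>Up to constants the two functions are complementary. If Y is below x powr (p - 1) * L
  powr (- \<kappa>), the first term dominates; otherwise x powr (p - 1) < Y * L powr \<kappa>, and
  once log x is controlled by log Y this can be solved for x.\<close>

lemma young_log:
  fixes p \<kappa> :: real
  assumes p: "p > 1" and \<kappa>: "\<kappa> \<ge> 0"
  shows "\<exists>C>0. \<forall>x\<ge>0. \<forall>Y\<ge>0. x * Y \<le> LlogL p (- \<kappa>) x + C * LlogL (p / (p - 1)) (\<kappa> / (p - 1)) Y"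
proof -
  obtain C1 where C1: "C1 \<ge> 1" "\<And>u. u > 0 \<Longrightarrow> u powr \<kappa> \<le> C1 * exp ((p - 1) / 2 * u)"
    using powr_le_exp[of \<kappa> "(p - 1) / 2"] p \<kappa> by auto
  define C2 where "C2 = C1 * 2 powr ((p - 1) / 2)"
  have "2 powr ((p - 1) / 2) \<ge> 1" using p by (intro ge_one_powr_ge_zero) auto
  then have C2: "C2 \<ge> 1" using mult_mono[of 1 C1 1 "2 powr ((p - 1) / 2)"] C1(1) by (simp add: C2_def)
  \<comment> \<open>The 2 covers both x < e, where L \<le> 2, and the ln 2 lost in exp 1 + x \<le> 2
    * x; the other term is the slope of ln x against M.\<close>
  define C5 where "C5 = 2 + 2 / (p - 1) * (ln C2 + 1)"
  have lnC2: "ln C2 \<ge> 0" using C2 by simp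
  have C5: "C5 \<ge> 2" using p lnC2 by (simp add: C5_def)
  define C where "C = C5 powr (\<kappa> / (p - 1))"
  have C: "C > 0" using C5 by (simp add: C_def)
  have main: "x * Y \<le> LlogL p (- \<kappa>) x + C * LlogL (p / (p - 1)) (\<kappa> / (p - 1)) Y" if x: "x \<ge> 0" and Y: "Y \<ge> 0" for x Y
  proof -
    define L where "L = ln (exp 1 + x)"
    define M where "M = ln (exp 1 + Y)"
    have L: "L \<ge> 1" and M: "M \<ge> 1" unfolding L_def M_def using x Y by (auto intro: ln_exp1_ge_1)
    consider "x = 0" | "x > 0" "Y \<le> x powr (p - 1) * L powr (- \<kappa>)" | "x > 0" "Y > x powr (p - 1) * L powr (- \<kappa>)"
      using x by force
    then show ?thesis
    proof cases
      case 1 then show ?thesis using C by simp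
    next
      case 2
      have "x * Y \<le> x * (x powr (p - 1) * L powr (- \<kappa>))" using 2 by (intro mult_left_mono) auto
      also have "\<dots> = LlogL p (- \<kappa>) x"
        using powr_mult_base[of x "p - 1"] 2 by (simp add: LlogL_def L_def mult.assoc[symmetric])
      finally show ?thesis using C by (simp add: add_increasing2)
    next
      case 3
      have Y0: "Y > 0" using 3(2) by (meson le_less_trans mult_nonneg_nonneg powr_ge_zero)
      have "x powr (p - 1) * L powr (- \<kappa>) * L powr \<kappa> \<le> Y * L powr \<kappa>"
        using 3 by (intro mult_right_mono) auto
      moreover have "L powr (- \<kappa>) * L powr \<kappa> = 1" using L by (simp flip: powr_add)
      ultimately have xY: "x powr (p - 1) \<le> Y * L powr \<kappa>" by (simp add: mult.assoc)
      have LM: "L \<le> C5 * M"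
      proof (cases "x < exp 1")
        case True
        have "L \<le> ln (exp 1 * exp 1)" unfolding L_def
        proof (subst ln_le_cancel_iff)
          have "(2::real) \<le> exp 1" using exp_ge_add_one_self[of 1] by simp
          then have "2 * exp 1 \<le> exp 1 * exp (1::real)" by (intro mult_right_mono) auto
          then show "exp 1 + x \<le> exp 1 * exp 1" using True by linarith
        qed (use x in \<open>auto intro: add_pos_nonneg\<close>)
        also have "\<dots> = 2" by (simp flip: exp_add)
        also have "\<dots> \<le> C5 * M" using mult_mono[of 2 C5 1 M] C5 M by simp
        finally show ?thesis .
      next
        case False
        then have ex: "exp 1 + x \<le> 2 * x" by simp
        \<comment> \<open>Spending half of the power x powr (p - 1) on L powr \<kappa> leaves x powr
          ((p - 1) / 2) \<le> C2 * Y, which compares the logarithms without circularity.\<close>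
        have "L powr \<kappa> \<le> C1 * exp ((p - 1) / 2 * L)" using C1(2)[of L] L by simp
        also have "exp ((p - 1) / 2 * L) = (exp 1 + x) powr ((p - 1) / 2)"
          using x by (simp add: L_def powr_def add_pos_nonneg less_imp_neq[symmetric])
        also have "C1 * \<dots> \<le> C1 * (2 * x) powr ((p - 1) / 2)"
          using ex x p C1(1) by (intro mult_left_mono powr_mono2) (auto intro: add_nonneg_nonneg)
        also have "\<dots> = C2 * x powr ((p - 1) / 2)" using x by (simp add: C2_def powr_mult)
        finally have "Y * L powr \<kappa> \<le> Y * (C2 * x powr ((p - 1) / 2))" using Y by (intro mult_left_mono)
        with xY have "x powr (p - 1) \<le> Y * (C2 * x powr ((p - 1) / 2))" by (rule order_trans)
        moreover have "x powr (p - 1) = x powr ((p - 1) / 2) * x powr ((p - 1) / 2)"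
          by (simp flip: powr_add)
        ultimately have "x powr ((p - 1) / 2) * x powr ((p - 1) / 2) \<le> (C2 * Y) * x powr ((p - 1) / 2)" by (simp add: mult_ac)
        then have "x powr ((p - 1) / 2) \<le> C2 * Y" using 3(1) by (simp add: mult_le_cancel_right)
        then have "ln (x powr ((p - 1) / 2)) \<le> ln (C2 * Y)" using 3(1) C2 Y0 by (subst ln_le_cancel_iff) auto
        also have "\<dots> = ln C2 + ln Y" using C2 Y0 by (simp add: ln_mult)
        also have "ln Y \<le> M" unfolding M_def using Y0 by (subst ln_le_cancel_iff) (auto intro: add_pos_pos)
        finally have "(p - 1) / 2 * ln x \<le> ln C2 + M" using 3(1) by (simp add: ln_powr)
        then have "ln x \<le> 2 / (p - 1) * (ln C2 + M)" using p by (simp add: field_simps)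
        also have "\<dots> \<le> 2 / (p - 1) * ((ln C2 + 1) * M)"
        proof (rule mult_left_mono)
          have "ln C2 * 1 \<le> ln C2 * M" using lnC2 M by (intro mult_left_mono) auto
          then show "ln C2 + M \<le> (ln C2 + 1) * M" by (simp add: algebra_simps)
        qed (use p in simp)
        finally have lx: "ln x \<le> 2 / (p - 1) * (ln C2 + 1) * M" by (simp only: mult.assoc)
        have "L \<le> ln (2 * x)" unfolding L_def using ex x by (subst ln_le_cancel_iff) (auto intro: add_pos_nonneg simp: 3)
        also have "\<dots> = ln 2 + ln x" using 3 by (simp add: ln_mult)
        also have "ln 2 \<le> 2 * M" using ln_2_less_1 M by linarith
        finally have "L \<le> 2 * M + 2 / (p - 1) * (ln C2 + 1) * M" using lx by linarith
        then show ?thesis by (simp add: C5_def algebra_simps)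
      qed
      have "x = (x powr (p - 1)) powr (1 / (p - 1))" using 3(1) p by (simp add: powr_powr)
      also have "\<dots> \<le> (Y * (C5 * M) powr \<kappa>) powr (1 / (p - 1))"
      proof (rule powr_mono2)
        have "Y * L powr \<kappa> \<le> Y * (C5 * M) powr \<kappa>"
          using LM L Y \<kappa> by (intro mult_left_mono powr_mono2) auto
        then show "x powr (p - 1) \<le> Y * (C5 * M) powr \<kappa>" using xY by simp
      qed (use p in auto)
      also have "\<dots> = Y powr (1 / (p - 1)) * (C * M powr (\<kappa> / (p - 1)))"
        using Y0 C5 M by (simp add: powr_mult powr_powr C_def)
      finally have "x * Y \<le> Y powr (1 / (p - 1)) * (C * M powr (\<kappa> / (p - 1))) * Y" using Y by (rule mult_right_mono)
      also have "\<dots> = C * ((Y * Y powr (1 / (p - 1))) * M powr (\<kappa> / (p - 1)))" by (simp add: mult_ac)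
      also have "Y * Y powr (1 / (p - 1)) = Y powr (p / (p - 1))"
        using powr_mult_base[of Y "1 / (p - 1)"] Y0 p by (simp add: field_simps)
      finally show ?thesis unfolding LlogL_def M_def by (simp add: add_increasing)
    qed
  qed
  show ?thesis using C main by blast
qed

lemma LlogL_mono:
  assumes "0 \<le> x" "x \<le> y" "r \<ge> 0" "a \<ge> 0"
  shows "LlogL r a x \<le> LlogL r a y"
  unfolding LlogL_def
proof (intro mult_mono powr_mono2)
  show "ln (exp 1 + x) \<le> ln (exp 1 + y)" using assms by (subst ln_le_cancel_iff) (auto intro: add_pos_nonneg)
  show "0 \<le> ln (exp 1 + x)" using ln_exp1_ge_1[OF assms(1)] by simp
qed (use assms in auto)

text \<open>\<open>young_log\<close> is applied to x and D^m * y. If D is at most a multiple of ln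
  (e + y), the power D^m merely raises the logarithmic exponent by m * p'. Otherwise y is at most an
  exponential of D, and everything is paid for by exp (c * D).\<close>

lemma young_log_exp:
  fixes p \<kappa> c :: real
  assumes p: "p > 1" and \<kappa>: "\<kappa> \<ge> 0" and c: "c > 0"
  shows "\<exists>C>0. \<forall>x\<ge>0. \<forall>y\<ge>0. \<forall>D\<ge>1. D ^ m * x * y \<le>
    C * (LlogL p (- \<kappa>) x + LlogL (p / (p - 1)) (real m * (p / (p - 1)) + \<kappa> / (p - 1)) y + exp (c * D))"
proof -
  define p' where "p' = p / (p - 1)"
  define a where "a = \<kappa> / (p - 1)"
  have p': "p' > 1" and a: "a \<ge> 0" using p \<kappa> by (auto simp: p'_def a_def)
  obtain CA where CA: "CA > 0" "\<And>x Y. x \<ge> 0 \<Longrightarrow> Y \<ge> 0 \<Longrightarrow> x * Y \<le> LlogL p (- \<kappa>) x + CA * LlogL p' a Y"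
    using young_log[OF p \<kappa>] unfolding p'_def a_def by blast
  \<comment> \<open>In the exponential case Z, of size exp (2 * \<eta> * D), is raised to the power
    p' + 1, the extra 1 paying for the logarithm; hence the requirement 2 * \<eta> * (p' + 1) \<le>
    c.\<close>
  define \<eta> where "\<eta> = min 1 (c / (2 * (p' + 1)))"
  have \<eta>: "\<eta> > 0" "\<eta> \<le> 1" "2 * \<eta> * (p' + 1) \<le> c"
  proof -
    show "\<eta> > 0" "\<eta> \<le> 1" using c p' by (auto simp: \<eta>_def)
    have "\<eta> \<le> c / (2 * (p' + 1))" by (simp add: \<eta>_def)
    then show "2 * \<eta> * (p' + 1) \<le> c" using p' by (simp add: field_simps)
  qed
  define \<theta> where "\<theta> = 1 / \<eta>"
  have \<theta>: "\<theta> \<ge> 1" using \<eta> by (simp add: \<theta>_def)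
  obtain C0 where C0: "C0 \<ge> 1" "\<And>u. u > 0 \<Longrightarrow> u powr real m \<le> C0 * exp (\<eta> * u)"
    using powr_le_exp[of "real m" \<eta>] \<eta> by auto
  obtain C3 where C3: "C3 \<ge> 1" "\<And>u. u > 0 \<Longrightarrow> u powr a \<le> C3 * exp (1 * u)"
    using powr_le_exp[of a 1] a by auto
  define c1 where "c1 = real m * ln \<theta> + real m + 1"
  have c1: "c1 \<ge> 1" using \<theta> by (simp add: c1_def)
  define CB where "CB = \<theta> powr (real m * p') * c1 powr a + 4 * C3 * C0 powr (p' + 1)"
  have CB: "CB > 0" "\<theta> powr (real m * p') * c1 powr a \<le> CB" "4 * C3 * C0 powr (p' + 1) \<le> CB"
    using \<theta> c1 C3 C0 by (auto simp: CB_def intro!: add_pos_nonneg)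
  have key: "LlogL p' a (D ^ m * y) \<le> CB * (LlogL p' (real m * p' + a) y + exp (c * D))" if y: "y \<ge> 0" and D: "D \<ge> 1" for y D
  proof -
    define M where "M = ln (exp 1 + y)"
    have M: "M \<ge> 1" unfolding M_def using y by (rule ln_exp1_ge_1)
    have ey: "exp M = exp 1 + y" using y by (simp add: M_def add_pos_nonneg)
    show ?thesis
    proof (cases "D \<le> \<theta> * M")
      case True
      have Dm: "D ^ m \<le> \<theta> ^ m * M ^ m" using power_mono[OF True] D by (simp add: power_mult_distrib)
      have Mle: "M \<le> exp 1 + y" using exp_ge_add_one_self[of M] ey by linarith
      have ln_le: "ln (exp 1 + \<theta> ^ m * M ^ m * y) \<le> c1 * M"
      proof -
        have "exp 1 + \<theta> ^ m * M ^ m * y \<le> \<theta> ^ m * exp M ^ m * exp 1 + \<theta> ^ m * exp M ^ m * y"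
        proof (intro add_mono mult_right_mono mult_left_mono power_mono)
          have "1 \<le> \<theta> ^ m" "1 \<le> exp M ^ m" using \<theta> M by (auto intro: one_le_power)
          then have "1 * 1 \<le> \<theta> ^ m * exp M ^ m" by (intro mult_mono) auto
          then show "exp 1 \<le> \<theta> ^ m * exp M ^ m * exp 1" by simp
          show "M \<le> exp M" using Mle ey by simp
        qed (use \<theta> M y in auto)
        also have "\<dots> = \<theta> ^ m * exp M ^ m * exp M" by (simp add: ey distrib_left)
        finally have "ln (exp 1 + \<theta> ^ m * M ^ m * y) \<le> ln (\<theta> ^ m * exp M ^ m * exp M)"
          using \<theta> M y by (subst ln_le_cancel_iff) (auto intro!: add_pos_nonneg)
        also have "\<dots> = real m * ln \<theta> + (real m + 1) * M"
          using \<theta> by (simp add: ln_mult ln_realpow algebra_simps)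
        also have "\<dots> \<le> real m * ln \<theta> * M + (real m + 1) * M"
        proof -
          have "real m * ln \<theta> * 1 \<le> real m * ln \<theta> * M" using M \<theta> by (intro mult_left_mono) auto
          then show ?thesis by simp
        qed
        also have "\<dots> = c1 * M" by (simp add: c1_def algebra_simps)
        finally show ?thesis .
      qed
      have "LlogL p' a (D ^ m * y) \<le> LlogL p' a (\<theta> ^ m * M ^ m * y)"
        using Dm y D p' a by (intro LlogL_mono mult_right_mono) auto
      also have "\<dots> \<le> (\<theta> ^ m * M ^ m * y) powr p' * (c1 * M) powr a"
        unfolding LlogL_def
      proof (intro mult_left_mono powr_mono2 ln_le a)
        have "exp 1 + \<theta> ^ m * M ^ m * y \<ge> exp 1" using \<theta> M y by simp
        then show "0 \<le> ln (exp 1 + \<theta> ^ m * M ^ m * y)" using ln_exp1_ge_1[of "\<theta> ^ m * M ^ m * y"] by simp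
      qed simp
      also have "\<dots> = (\<theta> powr (real m * p') * c1 powr a) * (y powr p' * M powr (real m * p' + a))"
        using \<theta> M y c1 by (simp add: powr_mult powr_powr powr_add flip: powr_realpow)
      also have "\<dots> \<le> CB * (y powr p' * M powr (real m * p' + a))"
        using CB(2) by (intro mult_right_mono) auto
      also have "\<dots> = CB * LlogL p' (real m * p' + a) y" by (simp add: LlogL_def M_def)
      also have "\<dots> \<le> CB * (LlogL p' (real m * p' + a) y + exp (c * D))" using CB(1) by (intro mult_left_mono) auto
      finally show ?thesis .
    next
      case False
      then have "M < \<eta> * D" using \<eta> by (simp add: \<theta>_def field_simps)
      then have "exp M \<le> exp (\<eta> * D)" by simp
      then have yD: "y \<le> exp (\<eta> * D)" using ey by (smt (verit) exp_gt_zero)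
      define Z where "Z = C0 * exp (2 * \<eta> * D)"
      have Z: "Z \<ge> 1" unfolding Z_def using C0(1) \<eta> D by (intro order_trans[OF _ mult_mono[of 1 C0 1 "exp (2 * \<eta> * D)"]]) auto
      have "D ^ m * y \<le> (C0 * exp (\<eta> * D)) * exp (\<eta> * D)"
        using C0(2)[of D] D yD y C0(1) by (intro mult_mono) (auto simp: powr_realpow)
      also have "\<dots> = Z" by (simp add: Z_def flip: exp_add)
      finally have "LlogL p' a (D ^ m * y) \<le> LlogL p' a Z"
        using y D p' a by (intro LlogL_mono) auto
      also have "\<dots> \<le> Z powr p' * (C3 * (exp 1 + Z))"
      proof -
        have "ln (exp 1 + Z) > 0" using ln_exp1_ge_1[of Z] Z by simp
        from C3(2)[OF this] have "ln (exp 1 + Z) powr a \<le> C3 * (exp 1 + Z)" using Z by (simp add: add_pos_nonneg)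
        then show ?thesis unfolding LlogL_def by (intro mult_left_mono) auto
      qed
      also have "\<dots> \<le> Z powr p' * (C3 * (4 * Z))"
        using exp_le Z C3(1) by (intro mult_left_mono) auto
      also have "\<dots> = 4 * C3 * Z powr (p' + 1)" using Z by (simp add: powr_add mult_ac)
      also have "Z powr (p' + 1) = C0 powr (p' + 1) * exp (2 * \<eta> * (p' + 1) * D)"
        unfolding Z_def using C0(1) by (subst powr_mult) (auto simp: powr_def algebra_simps)
      also have "4 * C3 * (C0 powr (p' + 1) * exp (2 * \<eta> * (p' + 1) * D)) \<le> 4 * C3 * (C0 powr (p' + 1) * exp (c * D))"
        using \<eta>(3) D C3(1) by (intro mult_left_mono) (auto intro!: mult_right_mono)
      also have "\<dots> \<le> CB * exp (c * D)" using CB(3) by (simp add: mult.assoc[symmetric])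
      also have "\<dots> \<le> CB * (LlogL p' (real m * p' + a) y + exp (c * D))" using CB(1) by (intro mult_left_mono) auto
      finally show ?thesis .
    qed
  qed
  define C where "C = 1 + CA * CB"
  have C: "C > 0" "1 \<le> C" "CA * CB \<le> C" using CA(1) CB(1) by (auto simp: C_def add_pos_pos)
  have "D ^ m * x * y \<le> C * (LlogL p (- \<kappa>) x + LlogL p' (real m * p' + a) y + exp (c * D))" if x: "x \<ge> 0" and y: "y \<ge> 0" and D: "D \<ge> 1" for x y D
  proof -
    have "D ^ m * x * y = x * (D ^ m * y)" by (simp add: mult_ac)
    also have "\<dots> \<le> LlogL p (- \<kappa>) x + CA * LlogL p' a (D ^ m * y)" using x y D by (intro CA(2)) auto
    also have "\<dots> \<le> LlogL p (- \<kappa>) x + CA * (CB * (LlogL p' (real m * p' + a) y + exp (c * D)))"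
      using CA(1) key[OF y D] by (intro add_left_mono mult_left_mono) auto
    also have "\<dots> \<le> C * LlogL p (- \<kappa>) x + C * (LlogL p' (real m * p' + a) y + exp (c * D))"
    proof (intro add_mono)
      show "LlogL p (- \<kappa>) x \<le> C * LlogL p (- \<kappa>) x" using mult_right_mono[OF C(2), of "LlogL p (- \<kappa>) x"] by simp
      show "CA * (CB * (LlogL p' (real m * p' + a) y + exp (c * D))) \<le> C * (LlogL p' (real m * p' + a) y + exp (c * D))"
        unfolding mult.assoc[symmetric] using C(3) by (intro mult_right_mono) (auto intro: add_nonneg_nonneg)
    qed
    finally show ?thesis by (simp add: algebra_simps)
  qed
  then show ?thesis using C(1) unfolding p'_def a_def by blast
qed

text \<open>Integrated and rescaled form of \<open>young_log_exp\<close>. It works with modular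
  inequalities at given heights t and l, so \<open>LlogL p (- \<kappa>)\<close> never has to define
  a norm.\<close>

lemma orlicz_holder:
  fixes p \<kappa> c C0 :: real
  assumes p: "p > 1" and \<kappa>: "\<kappa> \<ge> 0" and c: "c > 0" and C0: "C0 \<ge> 0"
  shows "\<exists>C>0. \<forall>(\<tau> :: real ^ 'n::finite) P D F w t l.
     D \<in> borel_measurable lebesgue \<and> F \<in> borel_measurable lebesgue \<and> w \<in> borel_measurable lebesgue \<and>
     (\<forall>x. D x \<ge> 1) \<and> (\<forall>x. F x \<ge> 0) \<and> (\<forall>x. w x \<ge> 0) \<and> t > 0 \<and> l > 0 \<and>
     (dint \<tau> P (\<lambda>x. exp (c * D x))) \<le> ennreal (C0 * dvol P) \<and>
     (dint \<tau> P (\<lambda>x. LlogL p (- \<kappa>) (F x / t))) \<le> ennreal (dvol P) \<and>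
     (dint \<tau> P (\<lambda>x. LlogL (p / (p - 1)) (real m * (p / (p - 1)) + \<kappa> / (p - 1)) (w x / l))) \<le> ennreal (dvol P)
     \<longrightarrow> (dint \<tau> P (\<lambda>x. D x ^ m * (F x * w x))) \<le> ennreal (C * t * l * dvol P)"
proof -
  define \<Psi> where "\<Psi> = LlogL (p / (p - 1)) (real m * (p / (p - 1)) + \<kappa> / (p - 1))"
  have [measurable]: "\<Psi> \<in> borel_measurable borel" unfolding \<Psi>_def by measurable
  have \<Psi>0: "\<Psi> y \<ge> 0" for y by (simp add: \<Psi>_def)
  obtain C where C: "C > 0" "\<And>x y D. x \<ge> 0 \<Longrightarrow> y \<ge> 0 \<Longrightarrow> D \<ge> 1 \<Longrightarrow> D ^ m * x * y \<le> C * (LlogL p (- \<kappa>) x + \<Psi> y + exp (c * D))"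
    using young_log_exp[OF p \<kappa> c, of m] unfolding \<Psi>_def by blast
  define C' where "C' = C * (2 + C0)"
  have main: "(dint \<tau> P (\<lambda>x. D x ^ m * (F x * w x))) \<le> ennreal (C' * t * l * dvol P)"
    if [measurable]: "D \<in> borel_measurable lebesgue" "F \<in> borel_measurable lebesgue" "w \<in> borel_measurable lebesgue"
      and D: "\<And>x. D x \<ge> 1" and F: "\<And>x. F x \<ge> 0" and w: "\<And>x. w x \<ge> 0" and t: "t > 0" and l: "l > 0"
      and 1: "(dint \<tau> P (\<lambda>x. exp (c * D x))) \<le> ennreal (C0 * dvol P)"
      and 2: "(dint \<tau> P (\<lambda>x. LlogL p (- \<kappa>) (F x / t))) \<le> ennreal (dvol P)"
      and 3: "(dint \<tau> P (\<lambda>x. \<Psi> (w x / l))) \<le> ennreal (dvol P)"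
    for \<tau> :: "real ^ 'n" and P D F w t l
  proof -
    let ?I = "indicator (dcube \<tau> P) :: _ \<Rightarrow> ennreal"
    have "(dint \<tau> P (\<lambda>x. D x ^ m * (F x * w x))) \<le>
      (\<integral>\<^sup>+x. ennreal (C * t * l) * (ennreal (LlogL p (- \<kappa>) (F x / t)) * ?I x + ennreal (\<Psi> (w x / l)) * ?I x + ennreal (exp (c * D x)) * ?I x) \<partial>lebesgue)"
    proof (rule nn_integral_mono)
      fix x
      have "D x ^ m * (F x * w x) = t * l * (D x ^ m * (F x / t) * (w x / l))" using t l by simp
      also have "\<dots> \<le> t * l * (C * (LlogL p (- \<kappa>) (F x / t) + \<Psi> (w x / l) + exp (c * D x)))"
        using C(2)[of "F x / t" "w x / l" "D x"] D F w t l by (intro mult_left_mono) auto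
      finally have "ennreal (D x ^ m * (F x * w x)) \<le> ennreal ((C * t * l) * (LlogL p (- \<kappa>) (F x / t) + \<Psi> (w x / l) + exp (c * D x)))"
        by (intro ennreal_leI) (simp add: mult_ac)
      also have "\<dots> = ennreal (C * t * l) * (ennreal (LlogL p (- \<kappa>) (F x / t)) + ennreal (\<Psi> (w x / l)) + ennreal (exp (c * D x)))"
        using C(1) t l \<Psi>0[of "w x / l"] by (simp add: ennreal_mult add_nonneg_nonneg)
      finally show "ennreal (D x ^ m * (F x * w x)) * ?I x \<le> ennreal (C * t * l) * (ennreal (LlogL p (- \<kappa>) (F x / t)) * ?I x + ennreal (\<Psi> (w x / l)) * ?I x + ennreal (exp (c * D x)) * ?I x)"
        by (cases "x \<in> dcube \<tau> P") auto
    qed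
    also have "\<dots> = ennreal (C * t * l) * ((dint \<tau> P (\<lambda>x. LlogL p (- \<kappa>) (F x / t))) +
        (dint \<tau> P (\<lambda>x. \<Psi> (w x / l))) + (dint \<tau> P (\<lambda>x. exp (c * D x))))"
      by (simp add: nn_integral_cmult nn_integral_add)
    also have "\<dots> \<le> ennreal (C * t * l) * (ennreal (dvol P) + ennreal (dvol P) + ennreal (C0 * dvol P))"
      by (intro mult_left_mono add_mono 1 2 3) simp
    also have "\<dots> = ennreal (C' * t * l * dvol P)"
    proof -
      have "ennreal (dvol P) + ennreal (dvol P) + ennreal (C0 * dvol P) = ennreal ((2 + C0) * dvol P)"
        using C0 by (simp add: algebra_simps flip: ennreal_plus)
      then show ?thesis using C t l C0 by (simp add: C'_def ennreal_mult[symmetric] mult_ac)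
    qed
    finally show ?thesis .
  qed
  have "C' > 0" using C(1) C0 by (simp add: C'_def)
  then show ?thesis using main unfolding \<Psi>_def by (intro exI[of _ C']) blast
qed

section \<open>Oscillation-weighted averages\<close>

text \<open>\<^term>\<open>D Q\<close> abstracts the normalised oscillation \<open>1 + \<Sum>\<^sub>j |b\<^sub>j - (b\<^sub>j)\<^sub>Q| / \<parallel>b\<^sub>j\<parallel>\<close>.\<close>

definition osc_family :: "real ^ 'n :: finite \<Rightarrow> real \<Rightarrow> real \<Rightarrow> real \<Rightarrow> ('n dindex \<Rightarrow> real ^ 'n \<Rightarrow> real) \<Rightarrow> bool" where
  "osc_family \<tau> c C0 K D \<longleftrightarrow>
    (\<forall>Q. D Q \<in> borel_measurable lebesgue) \<and> (\<forall>Q x. D Q x \<ge> 1) \<and>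
    (\<forall>Q. (dint \<tau> Q (\<lambda>x. exp (c * D Q x))) \<le> ennreal (C0 * dvol Q)) \<and>
    (\<forall>Q P x. dsub \<tau> Q P \<longrightarrow> D Q x \<le> (1 + K * real_of_int (fst P - fst Q)) * D P x)"

text \<open>Valued in \<open>ennreal\<close> because finiteness on every cube is a conclusion of
  \<open>orlicz_embedding\<close>, not known in advance.\<close>

definition osc_int :: "real ^ 'n :: finite \<Rightarrow> ('n dindex \<Rightarrow> real ^ 'n \<Rightarrow> real) \<Rightarrow> nat \<Rightarrow> (real ^ 'n \<Rightarrow> real) \<Rightarrow> 'n dindex \<Rightarrow> ennreal" where
  "osc_int \<tau> D m f Q = (dint \<tau> Q (\<lambda>x. D Q x ^ m * f x))"

lemma osc_familyD:
  assumes "osc_family \<tau> c C0 K D"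
  shows "D Q \<in> borel_measurable lebesgue" "D Q x \<ge> 1"
    "(dint \<tau> Q (\<lambda>x. exp (c * D Q x))) \<le> ennreal (C0 * dvol Q)"
    "dsub \<tau> Q P \<Longrightarrow> D Q x \<le> (1 + K * real_of_int (fst P - fst Q)) * D P x"
  using assms unfolding osc_family_def by blast+

text \<open>On R the change of reference cube costs the factor g R, whose m-th power is the
  denominator in \<open>dsuper\<close>; what remains is the integral of one function over disjoint
  subsets of P.\<close>

lemma dsuper_osc_int:
  assumes D: "osc_family \<tau> c C0 K D" and K: "K \<ge> 0"
    and f[measurable]: "f \<in> borel_measurable lebesgue" and f0: "\<And>x. f x \<ge> 0"
    and fin: "\<And>Q. osc_int \<tau> D m f Q \<noteq> top"
  shows "dsuper \<tau> K m (\<lambda>Q. enn2real (osc_int \<tau> D m f Q))"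
  unfolding dsuper_def
proof (intro conjI allI impI)
  fix P \<R> assume R: "finite \<R> \<and> disjoint_family_on (dcube \<tau>) \<R> \<and> (\<forall>R\<in>\<R>. dsub \<tau> R P)"
  note [measurable] = osc_familyD(1)[OF D]
  define g where "g R = 1 + K * real_of_int (fst P - fst R)" for R :: "'a dindex"
  have g: "g R \<ge> 1" if "R \<in> \<R>" for R
    using R that K unfolding g_def by (auto simp: dsub_def)
  have eq: "ennreal (enn2real (osc_int \<tau> D m f Q)) = osc_int \<tau> D m f Q" for Q
    using fin by (simp add: less_top)
  have "ennreal (\<Sum>R\<in>\<R>. enn2real (osc_int \<tau> D m f R) / g R ^ m) = (\<Sum>R\<in>\<R>. ennreal (enn2real (osc_int \<tau> D m f R) / g R ^ m))"
    using g by (intro sum_ennreal[symmetric]) (auto intro!: divide_nonneg_nonneg zero_le_power intro: order_trans[OF zero_le_one])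
  also have "\<dots> = (\<Sum>R\<in>\<R>. ennreal (1 / g R ^ m) * osc_int \<tau> D m f R)"
  proof (rule sum.cong[OF refl])
    fix R assume "R \<in> \<R>"
    then have "1 / g R ^ m \<ge> 0" using g[of R] by (intro divide_nonneg_nonneg zero_le_power) auto
    then show "ennreal (enn2real (osc_int \<tau> D m f R) / g R ^ m) = ennreal (1 / g R ^ m) * osc_int \<tau> D m f R"
      by (subst eq[symmetric], subst ennreal_mult[symmetric]) auto
  qed
  also have "\<dots> \<le> (\<Sum>R\<in>\<R>. \<integral>\<^sup>+x. ennreal (D P x ^ m * f x) * indicator (dcube \<tau> R) x \<partial>lebesgue)"
  proof (rule sum_mono)
    fix R assume RR: "R \<in> \<R>"
    have gp: "g R ^ m > 0" using g[OF RR] by (intro zero_less_power) simp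
    have "ennreal (1 / g R ^ m) * osc_int \<tau> D m f R = (\<integral>\<^sup>+x. ennreal (1 / g R ^ m) * (ennreal (D R x ^ m * f x) * indicator (dcube \<tau> R) x) \<partial>lebesgue)"
      unfolding osc_int_def by (subst nn_integral_cmult) auto
    also have "\<dots> \<le> (\<integral>\<^sup>+x. ennreal (D P x ^ m * f x) * indicator (dcube \<tau> R) x \<partial>lebesgue)"
    proof (rule nn_integral_mono)
      fix x
      have "D R x ^ m \<le> (g R * D P x) ^ m"
        using osc_familyD(4)[OF D, of R P x] osc_familyD(2)[OF D, of R x] R RR
        by (intro power_mono) (auto simp: g_def intro: order_trans[OF zero_le_one])
      then have "1 / g R ^ m * (D R x ^ m * f x) \<le> D P x ^ m * f x"
        using gp mult_right_mono[OF _ f0[of x], of "D R x ^ m" "(g R * D P x) ^ m"]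
        by (simp add: power_mult_distrib pos_divide_le_eq mult_ac)
      then have "ennreal (1 / g R ^ m) * ennreal (D R x ^ m * f x) \<le> ennreal (D P x ^ m * f x)"
        using gp by (subst ennreal_mult'[symmetric]) (auto intro: ennreal_leI)
      then show "ennreal (1 / g R ^ m) * (ennreal (D R x ^ m * f x) * indicator (dcube \<tau> R) x) \<le> ennreal (D P x ^ m * f x) * indicator (dcube \<tau> R) x"
        by (cases "x \<in> dcube \<tau> R") auto
    qed
    finally show "ennreal (1 / g R ^ m) * osc_int \<tau> D m f R \<le> (\<integral>\<^sup>+x. ennreal (D P x ^ m * f x) * indicator (dcube \<tau> R) x \<partial>lebesgue)" .
  qed
  also have "\<dots> = (\<integral>\<^sup>+x. (\<Sum>R\<in>\<R>. ennreal (D P x ^ m * f x) * indicator (dcube \<tau> R) x) \<partial>lebesgue)"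
    by (subst nn_integral_sum) auto
  also have "\<dots> \<le> osc_int \<tau> D m f P"
    unfolding osc_int_def
  proof (rule nn_integral_mono)
    fix x
    have "(\<Sum>R\<in>\<R>. ennreal (D P x ^ m * f x) * indicator (dcube \<tau> R) x) = ennreal (D P x ^ m * f x) * indicator (\<Union>R\<in>\<R>. dcube \<tau> R) x"
      using R by (simp add: indicator_UN_disjoint sum_distrib_left)
    also have "\<dots> \<le> ennreal (D P x ^ m * f x) * indicator (dcube \<tau> P) x"
      using R by (intro mult_left_mono) (auto simp: indicator_def dsub_def)
    finally show "(\<Sum>R\<in>\<R>. ennreal (D P x ^ m * f x) * indicator (dcube \<tau> R) x) \<le> ennreal (D P x ^ m * f x) * indicator (dcube \<tau> P) x" .
  qed
  finally have "ennreal (\<Sum>R\<in>\<R>. enn2real (osc_int \<tau> D m f R) / g R ^ m) \<le> ennreal (enn2real (osc_int \<tau> D m f P))"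
    unfolding eq .
  then show "(\<Sum>R\<in>\<R>. enn2real (osc_int \<tau> D m f R) / (1 + K * real_of_int (fst P - fst R)) ^ m) \<le> enn2real (osc_int \<tau> D m f P)"
    unfolding g_def by (subst (asm) ennreal_le_iff) auto
qed simp

text \<open>The negative logarithmic power only lowers the integrand, so the modular at height t is
  at most a / t powr p, and t = 2^k with k \<ge> a / dvol P is high enough.\<close>

lemma exists_large_level:
  fixes F :: "real ^ 'n::finite \<Rightarrow> real"
  assumes p: "p > 1" and \<kappa>: "\<kappa> \<ge> 0" and F[measurable]: "F \<in> borel_measurable lebesgue" and F0: "\<And>x. F x \<ge> 0"
    and a: "(\<integral>\<^sup>+x. ennreal (F x powr p) \<partial>lebesgue) = ennreal a" "a \<ge> 0"
  shows "\<exists>k::int. (dint \<tau> P (\<lambda>x. LlogL p (- \<kappa>) (F x / 2 powr real_of_int k))) \<le> ennreal (dvol P)"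
proof -
  define k where "k = nat \<lceil>a / dvol P\<rceil>"
  let ?t = "2 powr real_of_int (int k)"
  have t: "?t \<ge> 1" by (simp add: ge_one_powr_ge_zero)
  have "a / dvol P \<le> real k" unfolding k_def by linarith
  also have "\<dots> \<le> 2 ^ k" using of_nat_less_two_power[of k] by (metis less_imp_le)
  also have "\<dots> = ?t" by (simp add: powr_realpow)
  finally have ak: "a \<le> ?t * dvol P" by (simp add: pos_divide_le_eq)
  have "(dint \<tau> P (\<lambda>x. LlogL p (- \<kappa>) (F x / ?t))) \<le> (\<integral>\<^sup>+x. ennreal (1 / ?t) * ennreal (F x powr p) \<partial>lebesgue)"
  proof (rule nn_integral_mono)
    fix x
    have L: "ln (exp 1 + F x / ?t) \<ge> 1" using F0 t by (intro ln_exp1_ge_1) auto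
    have "ln (exp 1 + F x / ?t) powr (- \<kappa>) \<le> 1 powr (- \<kappa>)" using L \<kappa> by (intro powr_mono2') auto
    then have "LlogL p (- \<kappa>) (F x / ?t) \<le> (F x / ?t) powr p * 1"
      unfolding LlogL_def by (intro mult_left_mono) auto
    also have "\<dots> = F x powr p / ?t powr p" using F0 by (simp add: powr_divide)
    also have "\<dots> \<le> F x powr p / ?t powr 1"
      using t p by (intro divide_left_mono powr_mono mult_pos_pos) auto
    also have "\<dots> = 1 / ?t * F x powr p" by simp
    finally have "ennreal (LlogL p (- \<kappa>) (F x / ?t)) \<le> ennreal (1 / ?t) * ennreal (F x powr p)"
      by (subst ennreal_mult'[symmetric]) (auto intro: ennreal_leI)
    then show "ennreal (LlogL p (- \<kappa>) (F x / ?t)) * indicator (dcube \<tau> P) x \<le> ennreal (1 / ?t) * ennreal (F x powr p)"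
      by (cases "x \<in> dcube \<tau> P") auto
  qed
  also have "\<dots> = ennreal (1 / ?t) * ennreal a" by (simp add: nn_integral_cmult a(1))
  also have "\<dots> = ennreal (a / ?t)" using a by (subst ennreal_mult[symmetric]) auto
  also have "\<dots> \<le> ennreal (dvol P)" using ak t by (intro ennreal_leI) (simp add: pos_divide_le_eq mult.commute)
  finally show ?thesis by blast
qed

text \<open>For each cube take a height 2^k that is admissible for F while 2^(k-1) is not.
  Admissibility feeds \<open>orlicz_holder\<close> and bounds the oscillation integral; failure one
  step below is the hypothesis of \<open>carleson_embedding\<close>, which sums these bounds. The
  factor h P isolates the part that depends on F and is summable in l^s, while l P carries the
  weight.\<close>

lemma orlicz_embedding:
  fixes p s \<delta> c C0 Cc K :: real and m :: nat
  assumes p: "1 < p" "p \<le> s" and \<delta>: "\<delta> > 0" and c: "c > 0" and C0: "C0 \<ge> 0" and Cc: "Cc > 0"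
  shows "\<exists>C>0. \<forall>(\<tau> :: real ^ 'n::finite) D F w a l.
     osc_family \<tau> c C0 K D \<and> F \<in> borel_measurable lebesgue \<and> w \<in> borel_measurable lebesgue \<and>
     (\<forall>x. F x \<ge> 0) \<and> (\<forall>x. w x \<ge> 0) \<and>
     (\<integral>\<^sup>+x. ennreal (F x powr p) \<partial>lebesgue) = ennreal a \<and> a \<ge> 0 \<and>
     (\<forall>P. l P > 0 \<and> (dint \<tau> P (\<lambda>x. LlogL (conj_exp p) ((real m + 1 / s) * conj_exp p + \<delta>) (w x / l P))) \<le> ennreal (dvol P))
     \<longrightarrow> (\<forall>P. osc_int \<tau> D m (\<lambda>x. F x * w x) P \<noteq> top) \<and>
       (\<forall>\<S>. finite \<S> \<and> carleson \<tau> Cc \<S> \<and> (\<forall>P\<in>\<S>. osc_int \<tau> D m (\<lambda>x. F x * w x) P \<noteq> 0) \<longrightarrow>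
       (\<exists>h. (\<forall>P\<in>\<S>. h P \<ge> 0 \<and> enn2real (osc_int \<tau> D m (\<lambda>x. F x * w x) P) \<le> l P * dvol P powr (1 - 1 / p) * h P) \<and>
         (\<Sum>P\<in>\<S>. h P powr s) \<le> C * a powr (s / p)))"
proof -
  \<comment> \<open>Two demands meet: \<kappa> * s / p > 1 for the level sums, and \<kappa> / (p -
    1) = conj_exp p / s + \<delta>, so that the bump exponent of the hypothesis comes out
    exactly.\<close>
  define \<kappa> where "\<kappa> = p / s + \<delta> * (p - 1)"
  have s: "s > 1" using p by simp
  have \<kappa>: "\<kappa> > 0" using p s \<delta> by (simp add: \<kappa>_def add_pos_pos)
  have \<kappa>s: "\<kappa> * s / p > 1"
  proof -
    have "\<kappa> * s / p = 1 + \<delta> * (p - 1) * s / p" using p s by (simp add: \<kappa>_def field_simps)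
    then show ?thesis using p s \<delta> by simp
  qed
  have expo: "real m * conj_exp p + \<kappa> / (p - 1) = (real m + 1 / s) * conj_exp p + \<delta>"
  proof -
    have "\<kappa> / (p - 1) = p / (p - 1) / s + \<delta>" using p by (simp add: \<kappa>_def add_divide_distrib)
    then show ?thesis by (simp add: conj_exp_def distrib_right add_divide_distrib)
  qed
  obtain C1 where C1: "C1 > 0" "\<And>(\<tau> :: real ^ 'n::finite) P D F w t l.
     D \<in> borel_measurable lebesgue \<and> F \<in> borel_measurable lebesgue \<and> w \<in> borel_measurable lebesgue \<and>
     (\<forall>x. D x \<ge> 1) \<and> (\<forall>x. F x \<ge> 0) \<and> (\<forall>x. w x \<ge> 0) \<and> t > 0 \<and> l > 0 \<and>
     (dint \<tau> P (\<lambda>x. exp (c * D x))) \<le> ennreal (C0 * dvol P) \<and>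
     (dint \<tau> P (\<lambda>x. LlogL p (- \<kappa>) (F x / t))) \<le> ennreal (dvol P) \<and>
     (dint \<tau> P (\<lambda>x. LlogL (conj_exp p) ((real m + 1 / s) * conj_exp p + \<delta>) (w x / l))) \<le> ennreal (dvol P)
     \<Longrightarrow> (dint \<tau> P (\<lambda>x. D x ^ m * (F x * w x))) \<le> ennreal (C1 * t * l * dvol P)"
    using orlicz_holder[where 'n = 'n, OF p(1) less_imp_le[OF \<kappa>] c C0, of m] unfolding conj_exp_def[of p, symmetric] expo by blast
  obtain C2 where C2: "C2 > 0" "\<And>(\<tau> :: real ^ 'n::finite) \<S> F k a. finite \<S> \<and> carleson \<tau> Cc \<S> \<and>
     F \<in> borel_measurable lebesgue \<and> (\<forall>x. F x \<ge> 0) \<and>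
     (\<integral>\<^sup>+x. ennreal (F x powr p) \<partial>lebesgue) = ennreal a \<and> a \<ge> 0 \<and>
     (\<forall>P\<in>\<S>. ennreal (dvol P) \<le> (dint \<tau> P (\<lambda>x. LlogL p (- \<kappa>) (F x / 2 powr (real_of_int (k P) - 1)))))
    \<Longrightarrow> (\<Sum>P\<in>\<S>. (dvol P powr (1 / p) * 2 powr real_of_int (k P)) powr s) \<le> C2 * a powr (s / p)"
    using carleson_embedding[where 'n = 'n, OF p \<kappa>s \<kappa> Cc] by blast
  define C where "C = C1 powr s * C2"
  have C: "C > 0" using C1 C2 by (simp add: C_def)
  have main: "(\<forall>P. osc_int \<tau> D m (\<lambda>x. F x * w x) P \<noteq> top) \<and>
       (\<forall>\<S>. finite \<S> \<and> carleson \<tau> Cc \<S> \<and> (\<forall>P\<in>\<S>. osc_int \<tau> D m (\<lambda>x. F x * w x) P \<noteq> 0) \<longrightarrow>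
       (\<exists>h. (\<forall>P\<in>\<S>. h P \<ge> 0 \<and> enn2real (osc_int \<tau> D m (\<lambda>x. F x * w x) P) \<le> l P * dvol P powr (1 - 1 / p) * h P) \<and>
         (\<Sum>P\<in>\<S>. h P powr s) \<le> C * a powr (s / p)))"
    if D: "osc_family \<tau> c C0 K D" and F: "F \<in> borel_measurable lebesgue" and w: "w \<in> borel_measurable lebesgue"
      and F0: "\<And>x. F x \<ge> 0" and w0: "\<And>x. w x \<ge> 0"
      and a: "(\<integral>\<^sup>+x. ennreal (F x powr p) \<partial>lebesgue) = ennreal a" "a \<ge> 0"
      and l: "\<And>P. l P > 0" "\<And>P. (dint \<tau> P (\<lambda>x. LlogL (conj_exp p) ((real m + 1 / s) * conj_exp p + \<delta>) (w x / l P))) \<le> ennreal (dvol P)"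
    for \<tau> :: "real ^ 'n" and D F w a l
  proof -
    define ok where "ok P k \<longleftrightarrow> (dint \<tau> P (\<lambda>x. LlogL p (- \<kappa>) (F x / 2 powr real_of_int k))) \<le> ennreal (dvol P)" for P and k :: int
    let ?A = "osc_int \<tau> D m (\<lambda>x. F x * w x)"
    have hold: "?A P \<le> ennreal (C1 * 2 powr real_of_int k * l P * dvol P)" if "ok P k" for P k
      unfolding osc_int_def
      using osc_familyD(1-3)[OF D] F w F0 w0 l that[unfolded ok_def] by (intro C1(2)) auto
    have ex: "\<exists>k. ok P k" for P
      unfolding ok_def using exists_large_level[OF p(1) less_imp_le[OF \<kappa>] F F0 a] .
    have top: "?A P \<noteq> top" for P
      using ex[of P] hold[of P] by (auto simp: top_unique)
    \<comment> \<open>If every lower height were admissible too, the Hoelder bound would tend to 0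
      along them and force the oscillation integral to vanish.\<close>
    have least: "\<exists>k. ok P k \<and> \<not> ok P (k - 1)" if nz: "?A P \<noteq> 0" for P
    proof (rule ccontr)
      assume "\<not> ?thesis"
      then have step: "ok P k \<Longrightarrow> ok P (k - 1)" for k by blast
      obtain k0 where "ok P k0" using ex by blast
      then have all: "ok P (k0 - int i)" for i
      proof (induction i)
        case (Suc i)
        then have "ok P (k0 - int i - 1)" using step by blast
        then show ?case by (simp add: algebra_simps)
      qed simp
      obtain A where A: "?A P = ennreal A" "A \<ge> 0" using top[of P] by (metis ennreal_cases)
      define X where "X = C1 * 2 powr real_of_int k0 * l P * dvol P"
      have X: "X > 0" using C1(1) l(1)[of P] by (simp add: X_def)
      have le: "A \<le> X * (1/2) ^ i" for i
      proof -
        have "ennreal A \<le> ennreal (C1 * 2 powr real_of_int (k0 - int i) * l P * dvol P)"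
          using hold[OF all[of i]] A by simp
        also have "C1 * 2 powr real_of_int (k0 - int i) * l P * dvol P = X * (1/2) ^ i"
          by (simp add: X_def powr_diff powr_realpow power_one_over field_simps)
        finally show ?thesis using X by (subst (asm) ennreal_le_iff) auto
      qed
      have "(\<lambda>i. X * (1/2) ^ i) \<longlonglongrightarrow> X * 0" by (intro tendsto_intros LIMSEQ_realpow_zero) auto
      then have "A \<le> X * 0" by (rule LIMSEQ_le_const) (use le in blast)
      then show False using nz A by simp
    qed
    show ?thesis
    proof (intro conjI allI impI)
      show "?A P \<noteq> top" for P by (rule top)
    next
      fix \<S> assume S: "finite \<S> \<and> carleson \<tau> Cc \<S> \<and> (\<forall>P\<in>\<S>. ?A P \<noteq> 0)"
      then have "\<forall>P\<in>\<S>. \<exists>k. ok P k \<and> \<not> ok P (k - 1)" using least by blast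
      then obtain k where k: "\<And>P. P \<in> \<S> \<Longrightarrow> ok P (k P) \<and> \<not> ok P (k P - 1)" by metis
      define h where "h P = C1 * (dvol P powr (1 / p) * 2 powr real_of_int (k P))" for P
      have "enn2real (?A P) \<le> l P * dvol P powr (1 - 1 / p) * h P" if "P \<in> \<S>" for P
      proof -
        have "?A P \<le> ennreal (C1 * 2 powr real_of_int (k P) * l P * dvol P)" using hold k[OF that] by blast
        then have "enn2real (?A P) \<le> enn2real (ennreal (C1 * 2 powr real_of_int (k P) * l P * dvol P))"
          by (intro enn2real_mono) auto
        also have "\<dots> = C1 * 2 powr real_of_int (k P) * l P * dvol P" using C1(1) l(1)[of P] by simp
        also have "dvol P = dvol P powr (1 - 1 / p) * dvol P powr (1 / p)" by (simp flip: powr_add)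
        finally show ?thesis by (simp add: h_def mult_ac)
      qed
      moreover have "h P \<ge> 0" for P using C1(1) by (simp add: h_def)
      moreover have "(\<Sum>P\<in>\<S>. h P powr s) \<le> C * a powr (s / p)"
      proof -
        have "(\<Sum>P\<in>\<S>. h P powr s) = C1 powr s * (\<Sum>P\<in>\<S>. (dvol P powr (1 / p) * 2 powr real_of_int (k P)) powr s)"
          unfolding h_def powr_mult[of C1] by (simp add: sum_distrib_left)
        also have "\<dots> \<le> C1 powr s * (C2 * a powr (s / p))"
        proof (intro mult_left_mono C2(2)[of \<S> \<tau> F] conjI ballI allI)
          fix P assume "P \<in> \<S>"
          then have "\<not> ok P (k P - 1)" using k by blast
          then show "ennreal (dvol P) \<le> (dint \<tau> P (\<lambda>x. LlogL p (- \<kappa>) (F x / 2 powr (real_of_int (k P) - 1))))"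
            unfolding ok_def by simp
        qed (use S F F0 a in auto)
        finally show ?thesis by (simp add: C_def)
      qed
      ultimately show "\<exists>h. (\<forall>P\<in>\<S>. h P \<ge> 0 \<and> enn2real (?A P) \<le> l P * dvol P powr (1 - 1 / p) * h P) \<and> (\<Sum>P\<in>\<S>. h P powr s) \<le> C * a powr (s / p)"
        by blast
    qed
  qed
  show ?thesis using C main by (intro exI[of _ C]) blast
qed

section \<open>Conjugate exponents, discrete Hoelder and subfamilies\<close>

lemma conj_exp_facts:
  assumes "1 < s"
  shows "conj_exp s > 1" "1 / conj_exp s = 1 - 1 / s" "conj_exp (conj_exp s) = s"
proof -
  have "conj_exp s = 1 + 1 / (s - 1)" using assms by (simp add: conj_exp_def field_simps)
  then show "conj_exp s > 1" using assms by simp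
  show "1 / conj_exp s = 1 - 1 / s" using assms by (simp add: conj_exp_def field_simps)
  have "conj_exp s - 1 = 1 / (s - 1)" using assms by (simp add: conj_exp_def field_simps)
  then show "conj_exp (conj_exp s) = s" using assms by (simp add: conj_exp_def[of "conj_exp s"]) (simp add: conj_exp_def)
qed

lemma sum_holder:
  fixes x y :: "'a \<Rightarrow> real"
  assumes s: "s > 1" and x: "\<And>i. i \<in> I \<Longrightarrow> x i \<ge> 0" and y: "\<And>i. i \<in> I \<Longrightarrow> y i \<ge> 0" and I: "finite I"
  shows "(\<Sum>i\<in>I. x i * y i) \<le> (\<Sum>i\<in>I. x i powr s) powr (1 / s) * (\<Sum>i\<in>I. y i powr conj_exp s) powr (1 / conj_exp s)"
proof -
  define s' where "s' = conj_exp s"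
  have s': "s' > 1" "1 / s + 1 / s' = 1" using conj_exp_facts[OF s] by (auto simp: s'_def)
  define X where "X = (\<Sum>i\<in>I. x i powr s)"
  define Y where "Y = (\<Sum>i\<in>I. y i powr s')"
  have X0: "X \<ge> 0" "Y \<ge> 0" unfolding X_def Y_def by (auto intro: sum_nonneg)
  show ?thesis
  proof (cases "X = 0 \<or> Y = 0")
    case True
    then have "\<forall>i\<in>I. x i * y i = 0"
      using I unfolding X_def Y_def by (auto simp: sum_nonneg_eq_0_iff)
    then have "(\<Sum>i\<in>I. x i * y i) = 0" by (intro sum.neutral)
    then show ?thesis by simp
  next
    case False
    then have XY: "X > 0" "Y > 0" using X0 by auto
    define A where "A = X powr (1 / s)"
    define B where "B = Y powr (1 / s')"
    have AB: "A > 0" "B > 0" "A powr s = X" "B powr s' = Y" using XY s s'(1) by (auto simp: A_def B_def powr_powr)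
    have "(\<Sum>i\<in>I. x i / A * (y i / B)) \<le> (\<Sum>i\<in>I. x i powr s / (s * X) + y i powr s' / (s' * Y))"
    proof (rule sum_mono)
      fix i assume i: "i \<in> I"
      have "x i / A * (y i / B) \<le> (x i / A) powr s / s + (y i / B) powr s' / s'"
        using s s' x[OF i] y[OF i] AB by (intro Youngs_inequality) auto
      also have "\<dots> = x i powr s / (s * X) + y i powr s' / (s' * Y)"
        using x[OF i] y[OF i] AB by (simp add: powr_divide mult.commute)
      finally show "x i / A * (y i / B) \<le> x i powr s / (s * X) + y i powr s' / (s' * Y)" .
    qed
    also have "\<dots> = X / (s * X) + Y / (s' * Y)"
      by (simp add: sum.distrib X_def Y_def sum_divide_distrib)
    also have "\<dots> = 1" using XY s' by simp
    finally have "(\<Sum>i\<in>I. x i * y i) / (A * B) \<le> 1" by (simp add: sum_divide_distrib)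
    then have "(\<Sum>i\<in>I. x i * y i) \<le> A * B" using AB by (simp add: pos_divide_le_eq)
    then show ?thesis by (simp add: A_def B_def X_def Y_def s'_def)
  qed
qed

lemma carleson_subset:
  assumes "carleson \<tau> C \<S>" "\<S>' \<subseteq> \<S>" "finite \<S>"
  shows "carleson \<tau> C \<S>'"
  unfolding carleson_def
proof
  fix P assume "P \<in> \<S>'"
  then have "P \<in> \<S>" using assms by auto
  have "(\<Sum>R | R \<in> \<S>' \<and> dsub \<tau> R P. dvol R) \<le> (\<Sum>R | R \<in> \<S> \<and> dsub \<tau> R P. dvol R)"
    using assms by (intro sum_mono2) auto
  also have "\<dots> \<le> C * dvol P" using assms(1) \<open>P \<in> \<S>\<close> by (auto simp: carleson_def)
  finally show "(\<Sum>R | R \<in> \<S>' \<and> dsub \<tau> R P. dvol R) \<le> C * dvol P" .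
qed

lemma conj_exp_antimono: "1 < s \<Longrightarrow> s \<le> q \<Longrightarrow> conj_exp q \<le> conj_exp s"
proof -
  assume a: "1 < s" "s \<le> q"
  have "conj_exp r = 1 + 1 / (r - 1)" if "1 < r" for r :: real
    using that by (simp add: conj_exp_def field_simps)
  then show ?thesis using a by (simp add: frac_le)
qed

section \<open>The bilinear form and duality\<close>

text \<open>Finiteness of K_hat on grid cubes, with explicit heights in place of Luxemburg infima:
  an infimum may fail to be attained, and a zero infimum could not serve as a divisor.\<close>

definition bump_cond :: "real \<Rightarrow> real \<Rightarrow> real \<Rightarrow> nat \<Rightarrow> real \<Rightarrow> real \<Rightarrow> real ^ 'n :: finite \<Rightarrow> (real ^ 'n \<Rightarrow> real) \<Rightarrow> (real ^ 'n \<Rightarrow> real) \<Rightarrow> real \<Rightarrow> bool" where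
  "bump_cond \<alpha> p q m s \<delta> \<tau> wu wv Kc \<longleftrightarrow> (\<forall>P. \<exists>lu>0. \<exists>lv>0.
     (dint \<tau> P (\<lambda>x. LlogL q ((real m + 1 / conj_exp s) * q + \<delta>) (wu x / lu))) \<le> ennreal (dvol P) \<and>
     (dint \<tau> P (\<lambda>x. LlogL (conj_exp p) ((real m + 1 / s) * conj_exp p + \<delta>) (wv x / lv))) \<le> ennreal (dvol P) \<and>
     dvol P powr (\<alpha> / real CARD('n) + 1 / q - 1 / p) * lu * lv \<le> Kc)"

text \<open>\<open>orlicz_embedding\<close> is used twice, with (p, s) for F and with (q', s') for
  h. The volume powers left by both combine to that of the bump condition, the heights lu and lv are
  absorbed by Kc, and discrete Hoelder joins the l^s and l^s' sums.\<close>

lemma bilinear_bound: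
  fixes p q s \<alpha> \<delta> c C0 K :: real and m :: nat
  assumes p: "1 < p" "p \<le> s" "s \<le> q" and \<alpha>: "\<alpha> > 0" and \<delta>: "\<delta> > 0" and c: "c > 0" and C0: "C0 \<ge> 0" and K: "K \<ge> 0"
  shows "\<exists>C>0. \<forall>(\<tau> :: real ^ 'n::finite) D F h wv wu a a' Kc.
     osc_family \<tau> c C0 K D \<and> F \<in> borel_measurable lebesgue \<and> h \<in> borel_measurable lebesgue \<and>
     wv \<in> borel_measurable lebesgue \<and> wu \<in> borel_measurable lebesgue \<and>
     (\<forall>x. F x \<ge> 0) \<and> (\<forall>x. h x \<ge> 0) \<and> (\<forall>x. wv x \<ge> 0) \<and> (\<forall>x. wu x \<ge> 0) \<and>
     (\<integral>\<^sup>+x. ennreal (F x powr p) \<partial>lebesgue) = ennreal a \<and> a \<ge> 0 \<and>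
     (\<integral>\<^sup>+x. ennreal (h x powr conj_exp q) \<partial>lebesgue) = ennreal a' \<and> a' \<ge> 0 \<and>
     bump_cond \<alpha> p q m s \<delta> \<tau> wu wv Kc
     \<longrightarrow> (\<forall>P. osc_int \<tau> D m (\<lambda>x. F x * wv x) P \<noteq> top) \<and> (\<forall>P. osc_int \<tau> D m (\<lambda>x. h x * wu x) P \<noteq> top) \<and>
       (\<forall>\<F>. finite \<F> \<longrightarrow> (\<Sum>Q\<in>\<F>. dside Q powr (\<alpha> - real CARD('n)) *
          enn2real (osc_int \<tau> D m (\<lambda>x. F x * wv x) Q) * enn2real (osc_int \<tau> D m (\<lambda>x. h x * wu x) Q))
          \<le> C * Kc * a powr (1 / p) * a' powr (1 / conj_exp q))"
proof -
  define s' where "s' = conj_exp s"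
  define q' where "q' = conj_exp q"
  have s1: "s > 1" and q1: "q > 1" using p by auto
  have s': "s' > 1" "1 / s' = 1 - 1 / s" "conj_exp s' = s" using conj_exp_facts[OF s1] by (auto simp: s'_def)
  have q': "q' > 1" "1 / q' = 1 - 1 / q" "conj_exp q' = q" using conj_exp_facts[OF q1] by (auto simp: q'_def)
  \<comment> \<open>This is where s \<le> q enters: the second embedding needs its summation
    exponent s' to be at least its integrability exponent q'.\<close>
  have qs: "q' \<le> s'" unfolding q'_def s'_def using s1 p(3) by (rule conj_exp_antimono)
  obtain Cc where Cc: "Cc > 0" "\<And>(\<tau> :: real ^ 'n) \<F> A B. finite \<F> \<and> dsuper \<tau> K m A \<and> dsuper \<tau> K m B \<Longrightarrow>
    (\<exists>\<S>\<subseteq>\<F>. carleson \<tau> Cc \<S> \<and> (\<forall>P\<in>\<S>. A P > 0) \<and>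
      (\<Sum>Q\<in>\<F>. dside Q powr (\<alpha> - real CARD('n)) * A Q * B Q) \<le>
      Cc * (\<Sum>P\<in>\<S>. dside P powr (\<alpha> - real CARD('n)) * A P * B P))"
    using sparse_selection[where 'n = 'n, OF \<alpha> K, of m] by blast
  obtain C1 where C1: "C1 > 0" "\<And>(\<tau> :: real ^ 'n) D F w a l.
     osc_family \<tau> c C0 K D \<and> F \<in> borel_measurable lebesgue \<and> w \<in> borel_measurable lebesgue \<and>
     (\<forall>x. F x \<ge> 0) \<and> (\<forall>x. w x \<ge> 0) \<and>
     (\<integral>\<^sup>+x. ennreal (F x powr p) \<partial>lebesgue) = ennreal a \<and> a \<ge> 0 \<and>
     (\<forall>P. l P > 0 \<and> (dint \<tau> P (\<lambda>x. LlogL (conj_exp p) ((real m + 1 / s) * conj_exp p + \<delta>) (w x / l P))) \<le> ennreal (dvol P))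
     \<Longrightarrow> (\<forall>P. osc_int \<tau> D m (\<lambda>x. F x * w x) P \<noteq> top) \<and>
       (\<forall>\<S>. finite \<S> \<and> carleson \<tau> Cc \<S> \<and> (\<forall>P\<in>\<S>. osc_int \<tau> D m (\<lambda>x. F x * w x) P \<noteq> 0) \<longrightarrow>
       (\<exists>h. (\<forall>P\<in>\<S>. h P \<ge> 0 \<and> enn2real (osc_int \<tau> D m (\<lambda>x. F x * w x) P) \<le> l P * dvol P powr (1 - 1 / p) * h P) \<and>
         (\<Sum>P\<in>\<S>. h P powr s) \<le> C1 * a powr (s / p)))"
    using orlicz_embedding[where 'n = 'n, OF p(1,2) \<delta> c C0 Cc(1), of K m] by blast
  obtain C2 where C2: "C2 > 0" "\<And>(\<tau> :: real ^ 'n) D F w a l.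
     osc_family \<tau> c C0 K D \<and> F \<in> borel_measurable lebesgue \<and> w \<in> borel_measurable lebesgue \<and>
     (\<forall>x. F x \<ge> 0) \<and> (\<forall>x. w x \<ge> 0) \<and>
     (\<integral>\<^sup>+x. ennreal (F x powr q') \<partial>lebesgue) = ennreal a \<and> a \<ge> 0 \<and>
     (\<forall>P. l P > 0 \<and> (dint \<tau> P (\<lambda>x. LlogL q ((real m + 1 / s') * q + \<delta>) (w x / l P))) \<le> ennreal (dvol P))
     \<Longrightarrow> (\<forall>P. osc_int \<tau> D m (\<lambda>x. F x * w x) P \<noteq> top) \<and>
       (\<forall>\<S>. finite \<S> \<and> carleson \<tau> Cc \<S> \<and> (\<forall>P\<in>\<S>. osc_int \<tau> D m (\<lambda>x. F x * w x) P \<noteq> 0) \<longrightarrow>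
       (\<exists>h. (\<forall>P\<in>\<S>. h P \<ge> 0 \<and> enn2real (osc_int \<tau> D m (\<lambda>x. F x * w x) P) \<le> l P * dvol P powr (1 - 1 / q') * h P) \<and>
         (\<Sum>P\<in>\<S>. h P powr s') \<le> C2 * a powr (s' / q')))"
    using orlicz_embedding[where 'n = 'n, OF q'(1) qs \<delta> c C0 Cc(1), of K m] unfolding q'(3) by blast
  define C where "C = Cc * (C1 powr (1 / s) * C2 powr (1 / s'))"
  have C: "C > 0" using Cc C1 C2 by (simp add: C_def)
  have main: "(\<forall>P. osc_int \<tau> D m (\<lambda>x. F x * wv x) P \<noteq> top) \<and> (\<forall>P. osc_int \<tau> D m (\<lambda>x. h x * wu x) P \<noteq> top) \<and>
       (\<forall>\<F>. finite \<F> \<longrightarrow> (\<Sum>Q\<in>\<F>. dside Q powr (\<alpha> - real CARD('n)) *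
          enn2real (osc_int \<tau> D m (\<lambda>x. F x * wv x) Q) * enn2real (osc_int \<tau> D m (\<lambda>x. h x * wu x) Q))
          \<le> C * Kc * a powr (1 / p) * a' powr (1 / q'))"
    if D: "osc_family \<tau> c C0 K D"
      and me [measurable]: "F \<in> borel_measurable lebesgue" "h \<in> borel_measurable lebesgue" "wv \<in> borel_measurable lebesgue" "wu \<in> borel_measurable lebesgue"
      and nn: "\<forall>x. F x \<ge> 0" "\<forall>x. h x \<ge> 0" "\<forall>x. wv x \<ge> 0" "\<forall>x. wu x \<ge> 0"
      and a: "(\<integral>\<^sup>+x. ennreal (F x powr p) \<partial>lebesgue) = ennreal a" "a \<ge> 0"
      and a': "(\<integral>\<^sup>+x. ennreal (h x powr q') \<partial>lebesgue) = ennreal a'" "a' \<ge> 0"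
      and ex: "bump_cond \<alpha> p q m s \<delta> \<tau> wu wv Kc"
    for \<tau> :: "real ^ 'n" and D F h wv wu a a' Kc
  proof -
    define A where "A = osc_int \<tau> D m (\<lambda>x. F x * wv x)"
    define B where "B = osc_int \<tau> D m (\<lambda>x. h x * wu x)"
    define U where "U P t \<longleftrightarrow> (dint \<tau> P (\<lambda>x. LlogL q ((real m + 1 / s') * q + \<delta>) (wu x / t))) \<le> ennreal (dvol P)" for P t
    define V where "V P t \<longleftrightarrow> (dint \<tau> P (\<lambda>x. LlogL (conj_exp p) ((real m + 1 / s) * conj_exp p + \<delta>) (wv x / t))) \<le> ennreal (dvol P)" for P t
    have "\<forall>P. \<exists>lu lv. lu > 0 \<and> lv > 0 \<and> U P lu \<and> V P lv \<and> dvol P powr (\<alpha> / real CARD('n) + 1 / q - 1 / p) * lu * lv \<le> Kc"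
      using ex unfolding bump_cond_def s'_def[symmetric] U_def[symmetric] V_def[symmetric] by blast
    then obtain lu lv where l: "\<And>P. lu P > 0 \<and> lv P > 0 \<and> U P (lu P) \<and> V P (lv P) \<and> dvol P powr (\<alpha> / real CARD('n) + 1 / q - 1 / p) * lu P * lv P \<le> Kc"
      by metis
    have lu: "\<forall>P. lu P > 0 \<and> (dint \<tau> P (\<lambda>x. LlogL q ((real m + 1 / s') * q + \<delta>) (wu x / lu P))) \<le> ennreal (dvol P)"
      using l unfolding U_def by blast
    have lv: "\<forall>P. lv P > 0 \<and> (dint \<tau> P (\<lambda>x. LlogL (conj_exp p) ((real m + 1 / s) * conj_exp p + \<delta>) (wv x / lv P))) \<le> ennreal (dvol P)"
      using l unfolding V_def by blast
    have luv: "dvol P powr (\<alpha> / real CARD('n) + 1 / q - 1 / p) * lu P * lv P \<le> Kc" for P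
      using l by blast
    have Kc: "Kc \<ge> 0"
    proof -
      have "0 \<le> dvol P powr (\<alpha> / real CARD('n) + 1 / q - 1 / p) * lu P * lv P" for P
        using l[of P] by (intro mult_nonneg_nonneg) auto
      then show ?thesis using luv order_trans by blast
    qed
    have E1: "(\<forall>P. A P \<noteq> top) \<and> (\<forall>\<S>. finite \<S> \<and> carleson \<tau> Cc \<S> \<and> (\<forall>P\<in>\<S>. A P \<noteq> 0) \<longrightarrow>
       (\<exists>h. (\<forall>P\<in>\<S>. h P \<ge> 0 \<and> enn2real (A P) \<le> lv P * dvol P powr (1 - 1 / p) * h P) \<and>
         (\<Sum>P\<in>\<S>. h P powr s) \<le> C1 * a powr (s / p)))"
      unfolding A_def by (rule C1(2)) (use D me nn a lv in blast)
    have E2: "(\<forall>P. B P \<noteq> top) \<and> (\<forall>\<S>. finite \<S> \<and> carleson \<tau> Cc \<S> \<and> (\<forall>P\<in>\<S>. B P \<noteq> 0) \<longrightarrow>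
       (\<exists>h. (\<forall>P\<in>\<S>. h P \<ge> 0 \<and> enn2real (B P) \<le> lu P * dvol P powr (1 - 1 / q') * h P) \<and>
         (\<Sum>P\<in>\<S>. h P powr s') \<le> C2 * a' powr (s' / q')))"
      unfolding B_def by (rule C2(2)) (use D me nn a' lu in blast)
    have sA: "dsuper \<tau> K m (\<lambda>Q. enn2real (A Q))" and sB: "dsuper \<tau> K m (\<lambda>Q. enn2real (B Q))"
      unfolding A_def B_def using E1 E2 nn by (auto intro!: dsuper_osc_int[OF D K] simp: A_def B_def)
    have "\<forall>\<F>. finite \<F> \<longrightarrow> (\<Sum>Q\<in>\<F>. dside Q powr (\<alpha> - real CARD('n)) * enn2real (A Q) * enn2real (B Q)) \<le> C * Kc * a powr (1 / p) * a' powr (1 / q')"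
    proof (intro allI impI)
      fix \<F> :: "'n dindex set" assume F: "finite \<F>"
      define W where "W P = dside P powr (\<alpha> - real CARD('n)) * enn2real (A P) * enn2real (B P)" for P
      obtain \<S> where S: "\<S> \<subseteq> \<F>" "carleson \<tau> Cc \<S>" "\<forall>P\<in>\<S>. enn2real (A P) > 0" "(\<Sum>Q\<in>\<F>. W Q) \<le> Cc * (\<Sum>P\<in>\<S>. W P)"
        using Cc(2)[of \<F> \<tau> "\<lambda>Q. enn2real (A Q)" "\<lambda>Q. enn2real (B Q)"] F sA sB unfolding W_def by blast
      have finS: "finite \<S>" using S F finite_subset by blast
      \<comment> \<open>The selection guarantees A P > 0 only, while a last admissible height for h
        is available where B P does not vanish. Dropping the other cubes keeps the packing condition
        and loses no term.\<close>
      define T where "T = {P\<in>\<S>. enn2real (B P) > 0}"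
      have T: "finite T" "T \<subseteq> \<S>" "carleson \<tau> Cc T"
        using finS carleson_subset[OF S(2) _ finS, of T] by (auto simp: T_def)
      have "\<forall>P\<in>T. A P \<noteq> 0" "\<forall>P\<in>T. B P \<noteq> 0" using S(3) by (auto simp: T_def)
      then obtain h1 h2 where h1: "\<forall>P\<in>T. h1 P \<ge> 0 \<and> enn2real (A P) \<le> lv P * dvol P powr (1 - 1 / p) * h1 P" "(\<Sum>P\<in>T. h1 P powr s) \<le> C1 * a powr (s / p)"
        and h2: "\<forall>P\<in>T. h2 P \<ge> 0 \<and> enn2real (B P) \<le> lu P * dvol P powr (1 - 1 / q') * h2 P" "(\<Sum>P\<in>T. h2 P powr s') \<le> C2 * a' powr (s' / q')"
        using conjunct2[OF E1, rule_format, of T] conjunct2[OF E2, rule_format, of T] T(1,3) by blast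
      have "(\<Sum>P\<in>\<S>. W P) = (\<Sum>P\<in>T. W P)"
        using finS by (intro sum.mono_neutral_right) (auto simp: T_def W_def less_le)
      also have "\<dots> \<le> (\<Sum>P\<in>T. Kc * (h1 P * h2 P))"
      proof (rule sum_mono)
        fix P assume P: "P \<in> T"
        have "W P \<le> dside P powr (\<alpha> - real CARD('n)) * (lv P * dvol P powr (1 - 1 / p) * h1 P) * (lu P * dvol P powr (1 - 1 / q') * h2 P)"
          unfolding W_def using h1(1) h2(1) P l[of P]
          by (intro mult_mono) (auto intro!: mult_nonneg_nonneg simp: less_imp_le)
        also have "\<dots> = (dside P powr (\<alpha> - real CARD('n)) * dvol P powr (1 - 1 / p) * dvol P powr (1 - 1 / q')) * lu P * lv P * (h1 P * h2 P)"
          by (simp add: mult_ac)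
        \<comment> \<open>The exponents are \<alpha>/n - 1, 1 - 1/p and 1 - 1/q' = 1/q.\<close>
        also have "dside P powr (\<alpha> - real CARD('n)) * dvol P powr (1 - 1 / p) * dvol P powr (1 - 1 / q') = dvol P powr (\<alpha> / real CARD('n) + 1 / q - 1 / p)"
        proof -
          have "dside P powr (\<alpha> - real CARD('n)) = dvol P powr (\<alpha> / real CARD('n) - 1)"
            unfolding dvol_powr powr_powr by (simp add: right_diff_distrib)
          then show ?thesis unfolding q'(2) by (simp add: algebra_simps flip: powr_add)
        qed
        also have "dvol P powr (\<alpha> / real CARD('n) + 1 / q - 1 / p) * lu P * lv P * (h1 P * h2 P) \<le> Kc * (h1 P * h2 P)"
          using luv h1(1) h2(1) P by (intro mult_right_mono) auto
        finally show "W P \<le> Kc * (h1 P * h2 P)" .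
      qed
      also have "\<dots> = Kc * (\<Sum>P\<in>T. h1 P * h2 P)" by (simp add: sum_distrib_left)
      also have "\<dots> \<le> Kc * ((\<Sum>P\<in>T. h1 P powr s) powr (1 / s) * (\<Sum>P\<in>T. h2 P powr s') powr (1 / s'))"
        using h1(1) h2(1) T Kc s1 unfolding s'_def by (intro mult_left_mono sum_holder) auto
      also have "\<dots> \<le> Kc * ((C1 * a powr (s / p)) powr (1 / s) * (C2 * a' powr (s' / q')) powr (1 / s'))"
        using Kc h1(2) h2(2) s1 s'(1) by (intro mult_left_mono mult_mono powr_mono2) (auto intro: sum_nonneg)
      also have "\<dots> = Kc * ((C1 powr (1 / s) * a powr (1 / p)) * (C2 powr (1 / s') * a' powr (1 / q')))"
      proof -
        have "s / p * (1 / s) = 1 / p" "s' / q' * (1 / s') = 1 / q'" using s1 s'(1) by auto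
        then show ?thesis by (simp only: powr_mult powr_powr)
      qed
      finally have "Cc * (\<Sum>P\<in>\<S>. W P) \<le> Cc * (Kc * ((C1 powr (1 / s) * a powr (1 / p)) * (C2 powr (1 / s') * a' powr (1 / q'))))"
        using Cc(1) by (intro mult_left_mono) auto
      then have "(\<Sum>Q\<in>\<F>. W Q) \<le> Cc * (Kc * ((C1 powr (1 / s) * a powr (1 / p)) * (C2 powr (1 / s') * a' powr (1 / q'))))"
        using S(4) by simp
      then show "(\<Sum>Q\<in>\<F>. dside Q powr (\<alpha> - real CARD('n)) * enn2real (A Q) * enn2real (B Q)) \<le> C * Kc * a powr (1 / p) * a' powr (1 / q')"
        unfolding W_def C_def by (simp add: mult_ac)
    qed
    then show ?thesis using conjunct1[OF E1] conjunct1[OF E2] unfolding A_def B_def by (intro conjI)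
  qed
  show ?thesis
  proof (intro exI[of _ C] conjI[OF C] allI impI, goal_cases)
    case (1 \<tau> D F h wv wu a a' Kc)
    then show ?case unfolding q'_def[symmetric] by (elim conjE) (rule main)
  qed
qed

text \<open>Passes a uniform bound to a function known only to lie below a liminf almost everywhere;
  measurability is asked of the approximants, which suits the commutator as a limit object.\<close>

lemma nn_integral_le_Fatou:
  assumes "\<And>n. u n \<in> borel_measurable M" "AE x in M. v x \<le> liminf (\<lambda>n. u n x)" "\<And>n. (\<integral>\<^sup>+x. u n x \<partial>M) \<le> C"
  shows "(\<integral>\<^sup>+x. v x \<partial>M) \<le> C"
proof -
  have "(\<integral>\<^sup>+x. v x \<partial>M) \<le> (\<integral>\<^sup>+x. liminf (\<lambda>n. u n x) \<partial>M)" using assms(2) by (rule nn_integral_mono_AE)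
  also have "\<dots> \<le> liminf (\<lambda>n. \<integral>\<^sup>+x. u n x \<partial>M)" by (rule nn_integral_liminf) (rule assms)
  also have "\<dots> \<le> limsup (\<lambda>n. \<integral>\<^sup>+x. u n x \<partial>M)" by (rule Liminf_le_Limsup) simp
  also have "\<dots> \<le> C" by (rule Limsup_bounded) (simp add: assms)
  finally show ?thesis .
qed

text \<open>The extremal test function is h = g^(q-1). It is built from a truncation g of G, bounded
  and compactly supported, because a \<le> C * a powr (1 / q') can be divided out only for finite a;
  Fatou's lemma removes the truncation.\<close>

lemma Lq_le_by_duality:
  fixes G :: "real ^ 'n::finite \<Rightarrow> real"
  assumes q: "q > 1" and G[measurable]: "G \<in> borel_measurable lebesgue" and G0: "\<And>x. G x \<ge> 0" and C: "C \<ge> 0"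
    and dual: "\<And>h a. h \<in> borel_measurable lebesgue \<Longrightarrow> (\<And>x. h x \<ge> 0) \<Longrightarrow> a \<ge> 0 \<Longrightarrow>
       (\<integral>\<^sup>+x. ennreal (h x powr conj_exp q) \<partial>lebesgue) = ennreal a \<Longrightarrow>
       (\<integral>\<^sup>+x. ennreal (G x * h x) \<partial>lebesgue) \<le> ennreal (C * a powr (1 / conj_exp q))"
  shows "(\<integral>\<^sup>+x. ennreal (G x powr q) \<partial>lebesgue) \<le> ennreal (C powr q)"
proof (rule nn_integral_le_Fatou)
  define g where "g N x = min (G x) (real N) * indicator (cball 0 (real N)) x" for N and x :: "real ^ 'n"
  have g[measurable]: "g N \<in> borel_measurable lebesgue" for N
  proof -
    have [measurable]: "cball (0 :: real ^ 'n) (real N) \<in> sets lebesgue" by simp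
    show ?thesis unfolding g_def by measurable
  qed
  show "(\<lambda>x. ennreal (g N x powr q)) \<in> borel_measurable lebesgue" for N by measurable
  show "AE x in lebesgue. ennreal (G x powr q) \<le> liminf (\<lambda>N. ennreal (g N x powr q))"
  proof (rule AE_I2)
    fix x
    obtain N0 :: nat where N0: "max (G x) (norm x) \<le> real N0" using real_arch_simple by blast
    have "\<forall>\<^sub>F N in sequentially. ennreal (G x powr q) \<le> ennreal (g N x powr q)"
      unfolding eventually_sequentially
    proof (intro exI allI impI)
      fix N assume "N \<ge> N0"
      then have "g N x = G x" using N0 unfolding g_def by (auto simp: indicator_def min_def)
      then show "ennreal (G x powr q) \<le> ennreal (g N x powr q)" by simp
    qed
    then show "ennreal (G x powr q) \<le> liminf (\<lambda>N. ennreal (g N x powr q))" by (rule Liminf_bounded)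
  qed
  show "(\<integral>\<^sup>+x. ennreal (g N x powr q) \<partial>lebesgue) \<le> ennreal (C powr q)" for N
  proof -
    have g0: "g N x \<ge> 0" for x using G0 by (simp add: g_def)
    have gG: "g N x \<le> G x" for x using G0[of x] by (auto simp: g_def indicator_def)
    have "(\<integral>\<^sup>+x. ennreal (g N x powr q) \<partial>lebesgue) \<le> (\<integral>\<^sup>+x. ennreal (real N powr q) * indicator (cball (0 :: real ^ 'n) (real N)) x \<partial>lebesgue)"
    proof (rule nn_integral_mono)
      fix x
      show "ennreal (g N x powr q) \<le> ennreal (real N powr q) * indicator (cball 0 (real N)) x"
        using q G0[of x] by (auto simp: g_def indicator_def intro!: ennreal_leI powr_mono2)
    qed
    also have "\<dots> = ennreal (real N powr q) * emeasure lebesgue (cball (0 :: real ^ 'n) (real N))"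
      by (rule nn_integral_cmult_indicator) simp
    also have "\<dots> < top"
      using emeasure_compact_finite[of "cball (0 :: real ^ 'n) (real N)"] by (simp add: ennreal_mult_less_top)
    finally obtain a where a: "(\<integral>\<^sup>+x. ennreal (g N x powr q) \<partial>lebesgue) = ennreal a" "a \<ge> 0"
      by (metis ennreal_cases less_irrefl)
    define h where "h x = g N x powr (q - 1)" for x
    have hq: "h x powr conj_exp q = g N x powr q" for x using q by (simp add: h_def powr_powr conj_exp_def)
    have "(\<integral>\<^sup>+x. ennreal (g N x powr q) \<partial>lebesgue) \<le> (\<integral>\<^sup>+x. ennreal (G x * h x) \<partial>lebesgue)"
    proof (intro nn_integral_mono ennreal_leI)
      fix x
      have "g N x powr q = g N x * h x" using powr_mult_base[of "g N x" "q - 1"] g0[of x] by (simp add: h_def)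
      also have "\<dots> \<le> G x * h x" using gG by (intro mult_right_mono) (auto simp: h_def)
      finally show "g N x powr q \<le> G x * h x" .
    qed
    also have "\<dots> \<le> ennreal (C * a powr (1 / conj_exp q))"
    proof (rule dual)
      show "h \<in> borel_measurable lebesgue" unfolding h_def by measurable
      show "(\<integral>\<^sup>+x. ennreal (h x powr conj_exp q) \<partial>lebesgue) = ennreal a" unfolding hq by (rule a)
    qed (auto simp: h_def a)
    finally have le: "a \<le> C * a powr (1 / conj_exp q)" using a C by (simp add: ennreal_le_iff)
    have "a \<le> C powr q"
    proof (cases "a = 0")
      case False
      then have a0: "a > 0" using a by simp
      have "a = a powr (1 / q) * a powr (1 / conj_exp q)"
        using conj_exp_facts(2)[OF q] a0 by (simp flip: powr_add)
      with le have "a powr (1 / q) * a powr (1 / conj_exp q) \<le> C * a powr (1 / conj_exp q)" by simp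
      then have "a powr (1 / q) \<le> C" using a0 by (simp add: mult_le_cancel_right)
      then have "(a powr (1 / q)) powr q \<le> C powr q" using q by (intro powr_mono2) auto
      then show ?thesis using a0 q by (simp add: powr_powr)
    qed simp
    then show ?thesis unfolding a(1) by (rule ennreal_leI)
  qed
qed

section \<open>Dyadic operators and oscillations of BMO functions\<close>

text \<open>The positive operator whose pairing with \<open>h * wu\<close> is the bilinear form of
  \<open>bilinear_bound\<close>; the factor D Q x ^ m keeps the oscillation on the x side.\<close>

definition dyadic_op :: "real \<Rightarrow> real ^ 'n :: finite \<Rightarrow> ('n dindex \<Rightarrow> real ^ 'n \<Rightarrow> real) \<Rightarrow> nat \<Rightarrow> 'n dindex set \<Rightarrow> (real ^ 'n \<Rightarrow> real) \<Rightarrow> real ^ 'n \<Rightarrow> real" where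
  "dyadic_op \<alpha> \<tau> D m \<F> f x = (\<Sum>Q\<in>\<F>. dside Q powr (\<alpha> - real CARD('n)) * enn2real (osc_int \<tau> D m f Q) * (D Q x ^ m * indicator (dcube \<tau> Q) x))"

lemma dyadic_op_bound:
  fixes p q s \<alpha> \<delta> c C0 K :: real and m :: nat
  assumes p: "1 < p" "p \<le> s" "s \<le> q" and \<alpha>: "\<alpha> > 0" and \<delta>: "\<delta> > 0" and c: "c > 0" and C0: "C0 \<ge> 0" and K: "K \<ge> 0"
  shows "\<exists>C>0. \<forall>(\<tau> :: real ^ 'n::finite) D F wv wu a Kc \<F>.
     osc_family \<tau> c C0 K D \<and> F \<in> borel_measurable lebesgue \<and>
     wv \<in> borel_measurable lebesgue \<and> wu \<in> borel_measurable lebesgue \<and>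
     (\<forall>x. F x \<ge> 0) \<and> (\<forall>x. wv x \<ge> 0) \<and> (\<forall>x. wu x \<ge> 0) \<and>
     (\<integral>\<^sup>+x. ennreal (F x powr p) \<partial>lebesgue) = ennreal a \<and> a \<ge> 0 \<and> Kc \<ge> 0 \<and>
     bump_cond \<alpha> p q m s \<delta> \<tau> wu wv Kc \<and> finite \<F>
     \<longrightarrow> (\<forall>P. osc_int \<tau> D m (\<lambda>x. F x * wv x) P \<noteq> top) \<and>
       (\<integral>\<^sup>+x. ennreal ((dyadic_op \<alpha> \<tau> D m \<F> (\<lambda>x. F x * wv x) x * wu x) powr q) \<partial>lebesgue) \<le> ennreal ((C * Kc * a powr (1 / p)) powr q)"
proof -
  have q1: "q > 1" using p by simp
  obtain C where C: "C > 0" and bil: "\<And>(\<tau> :: real ^ 'n) D F h wv wu a a' Kc.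
     osc_family \<tau> c C0 K D \<and> F \<in> borel_measurable lebesgue \<and> h \<in> borel_measurable lebesgue \<and>
     wv \<in> borel_measurable lebesgue \<and> wu \<in> borel_measurable lebesgue \<and>
     (\<forall>x. F x \<ge> 0) \<and> (\<forall>x. h x \<ge> 0) \<and> (\<forall>x. wv x \<ge> 0) \<and> (\<forall>x. wu x \<ge> 0) \<and>
     (\<integral>\<^sup>+x. ennreal (F x powr p) \<partial>lebesgue) = ennreal a \<and> a \<ge> 0 \<and>
     (\<integral>\<^sup>+x. ennreal (h x powr conj_exp q) \<partial>lebesgue) = ennreal a' \<and> a' \<ge> 0 \<and> bump_cond \<alpha> p q m s \<delta> \<tau> wu wv Kc
     \<Longrightarrow> (\<forall>P. osc_int \<tau> D m (\<lambda>x. F x * wv x) P \<noteq> top) \<and> (\<forall>P. osc_int \<tau> D m (\<lambda>x. h x * wu x) P \<noteq> top) \<and>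
       (\<forall>\<F>. finite \<F> \<longrightarrow> (\<Sum>Q\<in>\<F>. dside Q powr (\<alpha> - real CARD('n)) *
          enn2real (osc_int \<tau> D m (\<lambda>x. F x * wv x) Q) * enn2real (osc_int \<tau> D m (\<lambda>x. h x * wu x) Q))
          \<le> C * Kc * a powr (1 / p) * a' powr (1 / conj_exp q))"
    using bilinear_bound[where 'n = 'n, OF p \<alpha> \<delta> c C0 K, of m] by blast
  have main: "(\<forall>P. osc_int \<tau> D m (\<lambda>x. F x * wv x) P \<noteq> top) \<and>
       (\<integral>\<^sup>+x. ennreal ((dyadic_op \<alpha> \<tau> D m \<F> (\<lambda>x. F x * wv x) x * wu x) powr q) \<partial>lebesgue) \<le> ennreal ((C * Kc * a powr (1 / p)) powr q)"
    if D: "osc_family \<tau> c C0 K D"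
      and me [measurable]: "F \<in> borel_measurable lebesgue" "wv \<in> borel_measurable lebesgue" "wu \<in> borel_measurable lebesgue"
      and nn: "\<forall>x. F x \<ge> 0" "\<forall>x. wv x \<ge> 0" "\<forall>x. wu x \<ge> 0"
      and a: "(\<integral>\<^sup>+x. ennreal (F x powr p) \<partial>lebesgue) = ennreal a" "a \<ge> 0" and Kc: "Kc \<ge> 0"
      and ex: "bump_cond \<alpha> p q m s \<delta> \<tau> wu wv Kc" and F: "finite \<F>"
    for \<tau> :: "real ^ 'n" and D F wv wu a Kc \<F>
  proof -
    note [measurable] = osc_familyD(1)[OF D]
    have D0: "D Q x \<ge> 0" for Q x using osc_familyD(2)[OF D, of Q x] by simp
    let ?f = "\<lambda>x. F x * wv x"
    \<comment> \<open>This finiteness does not involve the dual function, so h = 0 is a legitimate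
      choice for extracting it.\<close>
    have fin: "\<forall>P. osc_int \<tau> D m ?f P \<noteq> top"
      using bil[of \<tau> D F "\<lambda>x. 0" wv wu a 0 Kc] D me nn a ex by simp
    let ?G = "\<lambda>x. dyadic_op \<alpha> \<tau> D m \<F> ?f x * wu x"
    have [measurable]: "dyadic_op \<alpha> \<tau> D m \<F> ?f \<in> borel_measurable lebesgue"
      unfolding dyadic_op_def by measurable
    have G0: "dyadic_op \<alpha> \<tau> D m \<F> ?f x \<ge> 0" for x
      unfolding dyadic_op_def using D0 by (intro sum_nonneg) auto
    have "(\<integral>\<^sup>+x. ennreal (?G x powr q) \<partial>lebesgue) \<le> ennreal ((C * Kc * a powr (1 / p)) powr q)"
    proof (rule Lq_le_by_duality[OF q1])
      fix h :: "real ^ 'n \<Rightarrow> real" and a'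
      assume h[measurable]: "h \<in> borel_measurable lebesgue" and h0: "\<And>x. h x \<ge> 0" and a': "a' \<ge> 0"
        "(\<integral>\<^sup>+x. ennreal (h x powr conj_exp q) \<partial>lebesgue) = ennreal a'"
      let ?g = "\<lambda>x. h x * wu x"
      have "osc_family \<tau> c C0 K D \<and> F \<in> borel_measurable lebesgue \<and> h \<in> borel_measurable lebesgue \<and>
        wv \<in> borel_measurable lebesgue \<and> wu \<in> borel_measurable lebesgue \<and>
        (\<forall>x. F x \<ge> 0) \<and> (\<forall>x. h x \<ge> 0) \<and> (\<forall>x. wv x \<ge> 0) \<and> (\<forall>x. wu x \<ge> 0) \<and>
        (\<integral>\<^sup>+x. ennreal (F x powr p) \<partial>lebesgue) = ennreal a \<and> a \<ge> 0 \<and>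
        (\<integral>\<^sup>+x. ennreal (h x powr conj_exp q) \<partial>lebesgue) = ennreal a' \<and> a' \<ge> 0 \<and> bump_cond \<alpha> p q m s \<delta> \<tau> wu wv Kc"
        using D me nn a ex a' h h0 by auto
      from bil[OF this] have fin2: "\<forall>P. osc_int \<tau> D m ?g P \<noteq> top" and
        le: "(\<Sum>Q\<in>\<F>. dside Q powr (\<alpha> - real CARD('n)) * enn2real (osc_int \<tau> D m ?f Q) * enn2real (osc_int \<tau> D m ?g Q))
          \<le> C * Kc * a powr (1 / p) * a' powr (1 / conj_exp q)" using F by blast+
      define w where "w Q = dside Q powr (\<alpha> - real CARD('n)) * enn2real (osc_int \<tau> D m ?f Q)" for Q
      have w0: "w Q \<ge> 0" for Q by (simp add: w_def)
      have "(\<integral>\<^sup>+x. ennreal (?G x * h x) \<partial>lebesgue) = (\<integral>\<^sup>+x. (\<Sum>Q\<in>\<F>. ennreal (w Q) * (ennreal (D Q x ^ m * ?g x) * indicator (dcube \<tau> Q) x)) \<partial>lebesgue)"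
      proof (rule nn_integral_cong)
        fix x
        have "?G x * h x = (\<Sum>Q\<in>\<F>. w Q * (D Q x ^ m * ?g x * indicator (dcube \<tau> Q) x))"
          unfolding dyadic_op_def w_def by (simp add: sum_distrib_right sum_distrib_left mult_ac)
        also have "ennreal \<dots> = (\<Sum>Q\<in>\<F>. ennreal (w Q * (D Q x ^ m * ?g x * indicator (dcube \<tau> Q) x)))"
          using w0 D0 h0 nn by (intro sum_ennreal[symmetric]) auto
        also have "\<dots> = (\<Sum>Q\<in>\<F>. ennreal (w Q) * (ennreal (D Q x ^ m * ?g x) * indicator (dcube \<tau> Q) x))"
          using w0 by (intro sum.cong refl) (auto simp: ennreal_mult' indicator_def)
        finally show "ennreal (?G x * h x) = (\<Sum>Q\<in>\<F>. ennreal (w Q) * (ennreal (D Q x ^ m * ?g x) * indicator (dcube \<tau> Q) x))" .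
      qed
      also have "\<dots> = (\<Sum>Q\<in>\<F>. ennreal (w Q) * osc_int \<tau> D m ?g Q)"
        unfolding osc_int_def by (subst nn_integral_sum) (auto simp: nn_integral_cmult)
      also have "\<dots> = (\<Sum>Q\<in>\<F>. ennreal (w Q * enn2real (osc_int \<tau> D m ?g Q)))"
        using fin2 w0 by (intro sum.cong refl) (auto simp: ennreal_mult less_top)
      also have "\<dots> = ennreal (\<Sum>Q\<in>\<F>. w Q * enn2real (osc_int \<tau> D m ?g Q))"
        using w0 by (intro sum_ennreal) auto
      also have "\<dots> \<le> ennreal (C * Kc * a powr (1 / p) * a' powr (1 / conj_exp q))"
        using le unfolding w_def by (rule ennreal_leI)
      finally show "(\<integral>\<^sup>+x. ennreal (?G x * h x) \<partial>lebesgue) \<le> ennreal (C * Kc * a powr (1 / p) * a' powr (1 / conj_exp q))" .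
    qed (use G0 nn C Kc in auto)
    then show ?thesis using fin by (intro conjI)
  qed
  show ?thesis
  proof (intro exI[of _ C] conjI[OF C] allI impI, goal_cases)
    case (1 \<tau> D F wv wu a Kc \<F>)
    then show ?case by (elim conjE) (rule main)
  qed
qed

text \<open>The leading 1 makes every value at least 1: sums can then be bounded by products, and an
  additive drift by a multiplicative one. B j stands for a positive bound of the BMO norm.\<close>

definition bmo_osc :: "nat \<Rightarrow> (nat \<Rightarrow> real ^ 'n :: finite \<Rightarrow> real) \<Rightarrow> (nat \<Rightarrow> real) \<Rightarrow> real ^ 'n \<Rightarrow> 'n dindex \<Rightarrow> real ^ 'n \<Rightarrow> real" where
  "bmo_osc m b B \<tau> Q x = 1 + (\<Sum>j\<in>{1..m}. \<bar>b j x - davg \<tau> (b j) Q\<bar> / B j)"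

text \<open>The sum is at most card I times its largest term. This separates the b j at the cost of
  a factor card I in the exponent, so that John--Nirenberg can be applied to each one alone.\<close>

lemma exp_sum_le:
  fixes X :: "'a \<Rightarrow> real"
  assumes "finite I" "I \<noteq> {}" "c \<ge> 0"
  shows "exp (c * (\<Sum>i\<in>I. X i)) \<le> (\<Sum>i\<in>I. exp (c * real (card I) * X i))"
proof -
  have "Max (X ` I) \<in> X ` I" using assms by (intro Max_in) auto
  then obtain i where i: "i \<in> I" "X i = Max (X ` I)" by auto
  have "(\<Sum>i\<in>I. X i) \<le> (\<Sum>j\<in>I. X i)" using assms i(2) by (intro sum_mono) auto
  then have "c * (\<Sum>i\<in>I. X i) \<le> c * real (card I) * X i" using assms by (simp add: mult_left_mono mult.assoc)
  then have "exp (c * (\<Sum>i\<in>I. X i)) \<le> exp (c * real (card I) * X i)" by simp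
  also have "\<dots> \<le> (\<Sum>i\<in>I. exp (c * real (card I) * X i))" using assms i by (intro member_le_sum) auto
  finally show ?thesis .
qed

text \<open>The m in the denominator of c cancels the factor from \<open>exp_sum_le\<close>, leaving
  powers of 3/2 as in \<open>john_nirenberg_exp\<close>. Adding m bounds 8 * dvol Q, with exp c from
  the leading 1, gives C0. The drift 2^n * l of each of the m normalised averages, multiplied by D
  \<ge> 1, gives K.\<close>

lemma osc_family_bmo:
  fixes b :: "nat \<Rightarrow> real ^ 'n::finite \<Rightarrow> real"
  assumes m: "m \<ge> 1" and b: "\<And>j. j \<in> {1..m} \<Longrightarrow> locally_integrable (b j)"
    and B: "\<And>j. j \<in> {1..m} \<Longrightarrow> bmo_norm (b j) \<le> ennreal (B j)" "\<And>j. j \<in> {1..m} \<Longrightarrow> B j > 0"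
    and c: "c = ln (3/2) / (2 ^ (CARD('n) + 1) * real m)"
  shows "osc_family \<tau> c (8 * real m * exp c) (real m * 2 ^ CARD('n)) (bmo_osc m b B \<tau>)"
  unfolding osc_family_def
proof (intro conjI allI impI)
  have bm: "b j \<in> borel_measurable lebesgue" if "j \<in> {1..m}" for j
    using b[OF that] by (rule locally_integrable_measurable)
  have c0: "c > 0" using m by (simp add: c)
  fix Q :: "'n dindex"
  show "bmo_osc m b B \<tau> Q \<in> borel_measurable lebesgue"
    unfolding bmo_osc_def
    by (intro borel_measurable_add borel_measurable_sum borel_measurable_divide borel_measurable_abs borel_measurable_diff bm) auto
  fix x
  show "1 \<le> bmo_osc m b B \<tau> Q x"
    unfolding bmo_osc_def using B(2) by (auto intro!: sum_nonneg divide_nonneg_nonneg simp: less_imp_le)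
next
  have bm: "b j \<in> borel_measurable lebesgue" if "j \<in> {1..m}" for j
    using b[OF that] by (rule locally_integrable_measurable)
  have c0: "c > 0" using m by (simp add: c)
  fix Q :: "'n dindex"
  let ?e = "\<lambda>j x. (3/2 :: real) powr (\<bar>b j x - davg \<tau> (b j) Q\<bar> / (2 ^ (CARD('n) + 1) * B j))"
  have pw: "exp (c * bmo_osc m b B \<tau> Q x) \<le> exp c * (\<Sum>j\<in>{1..m}. ?e j x)" for x
  proof -
    have "exp (c * bmo_osc m b B \<tau> Q x) = exp c * exp (c * (\<Sum>j\<in>{1..m}. \<bar>b j x - davg \<tau> (b j) Q\<bar> / B j))"
      by (simp add: bmo_osc_def distrib_left exp_add)
    also have "\<dots> \<le> exp c * (\<Sum>j\<in>{1..m}. exp (c * real (card {1..m}) * (\<bar>b j x - davg \<tau> (b j) Q\<bar> / B j)))"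
      using m c0 by (intro mult_left_mono exp_sum_le) auto
    also have "(\<Sum>j\<in>{1..m}. exp (c * real (card {1..m}) * (\<bar>b j x - davg \<tau> (b j) Q\<bar> / B j))) = (\<Sum>j\<in>{1..m}. ?e j x)"
      using m by (intro sum.cong refl) (simp add: c powr_def field_simps)
    finally show ?thesis .
  qed
  have "(dint \<tau> Q (\<lambda>x. exp (c * bmo_osc m b B \<tau> Q x))) \<le>
     (\<integral>\<^sup>+x. ennreal (exp c) * (\<Sum>j\<in>{1..m}. ennreal (?e j x) * indicator (dcube \<tau> Q) x) \<partial>lebesgue)"
  proof (rule nn_integral_mono)
    fix x
    have "ennreal (exp (c * bmo_osc m b B \<tau> Q x)) \<le> ennreal (exp c * (\<Sum>j\<in>{1..m}. ?e j x))" by (rule ennreal_leI[OF pw])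
    also have "\<dots> = ennreal (exp c) * (\<Sum>j\<in>{1..m}. ennreal (?e j x))" by (simp add: ennreal_mult sum_nonneg)
    finally show "ennreal (exp (c * bmo_osc m b B \<tau> Q x)) * indicator (dcube \<tau> Q) x \<le> ennreal (exp c) * (\<Sum>j\<in>{1..m}. ennreal (?e j x) * indicator (dcube \<tau> Q) x)"
      by (cases "x \<in> dcube \<tau> Q") auto
  qed
  also have "\<dots> = ennreal (exp c) * (\<Sum>j\<in>{1..m}. dint \<tau> Q (\<lambda>x. ?e j x))"
  proof -
    have me: "(\<lambda>x. ennreal (?e j x) * indicator (dcube \<tau> Q) x) \<in> borel_measurable lebesgue" if j: "j \<in> {1..m}" for j
    proof -
      note [measurable] = bm[OF j]
      show ?thesis by measurable
    qed
    show ?thesis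
      by (subst nn_integral_cmult[OF borel_measurable_sum[OF me]], assumption, subst nn_integral_sum[OF me]) auto
  qed
  also have "\<dots> \<le> ennreal (exp c) * (\<Sum>j\<in>{1..m}. ennreal (8 * dvol Q))"
    by (intro mult_left_mono sum_mono john_nirenberg_exp b B) auto
  also have "\<dots> = ennreal (8 * real m * exp c * dvol Q)"
    by (simp add: ennreal_of_nat_eq_real_of_nat ennreal_mult[symmetric] mult_ac)
  finally show "(dint \<tau> Q (\<lambda>x. exp (c * bmo_osc m b B \<tau> Q x))) \<le> ennreal (8 * real m * exp c * dvol Q)" .
next
  fix Q P :: "'n dindex" and x assume QP: "dsub \<tau> Q P"
  define l where "l = real_of_int (fst P - fst Q)"
  have l: "l \<ge> 0" using QP by (simp add: l_def dsub_def)
  have D1: "1 \<le> bmo_osc m b B \<tau> P x"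
    unfolding bmo_osc_def using B(2) by (auto intro!: sum_nonneg divide_nonneg_nonneg simp: less_imp_le)
  have "bmo_osc m b B \<tau> Q x \<le> 1 + (\<Sum>j\<in>{1..m}. \<bar>b j x - davg \<tau> (b j) P\<bar> / B j + 2 ^ CARD('n) * l)"
    unfolding bmo_osc_def
  proof (intro add_left_mono sum_mono)
    fix j assume j: "j \<in> {1..m}"
    have "\<bar>davg \<tau> (b j) Q - davg \<tau> (b j) P\<bar> \<le> 2 ^ CARD('n) * B j * l"
      unfolding l_def using B(2)[OF j] by (intro davg_growth b B QP j) auto
    then have "\<bar>b j x - davg \<tau> (b j) Q\<bar> \<le> \<bar>b j x - davg \<tau> (b j) P\<bar> + 2 ^ CARD('n) * l * B j" by (simp add: mult_ac)
    then have "\<bar>b j x - davg \<tau> (b j) Q\<bar> / B j \<le> (\<bar>b j x - davg \<tau> (b j) P\<bar> + 2 ^ CARD('n) * l * B j) / B j"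
      using B(2)[OF j] by (intro divide_right_mono) auto
    then show "\<bar>b j x - davg \<tau> (b j) Q\<bar> / B j \<le> \<bar>b j x - davg \<tau> (b j) P\<bar> / B j + 2 ^ CARD('n) * l"
      using B(2)[OF j] by (simp add: add_divide_distrib)
  qed
  also have "\<dots> = bmo_osc m b B \<tau> P x + real m * 2 ^ CARD('n) * l * 1"
    by (simp add: bmo_osc_def sum.distrib)
  also have "\<dots> \<le> bmo_osc m b B \<tau> P x + real m * 2 ^ CARD('n) * l * bmo_osc m b B \<tau> P x"
    using D1 l by (intro add_left_mono mult_left_mono) auto
  finally show "bmo_osc m b B \<tau> Q x \<le> (1 + real m * 2 ^ CARD('n) * real_of_int (fst P - fst Q)) * bmo_osc m b B \<tau> P x"
    unfolding l_def by (simp add: algebra_simps)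
qed

text \<open>Each factor satisfies |b(x) - b(y)| \<le> B * (D x + D y) \<le> 2 * B * D x * D y, the
  last step since D \<ge> 1.\<close>

lemma prod_diff_le_bmo_osc:
  assumes B: "\<And>j. j \<in> {1..m} \<Longrightarrow> B j > 0"
  shows "\<bar>\<Prod>j\<in>{1..m}. b j x - b j y\<bar> \<le> (\<Prod>j\<in>{1..m}. B j) * 2 ^ m * (bmo_osc m b B \<tau> Q x ^ m * bmo_osc m b B \<tau> Q y ^ m)"
proof -
  let ?D = "bmo_osc m b B \<tau> Q"
  have D1: "1 \<le> ?D z" for z
    unfolding bmo_osc_def using B by (auto intro!: sum_nonneg divide_nonneg_nonneg simp: less_imp_le)
  have "\<bar>\<Prod>j\<in>{1..m}. b j x - b j y\<bar> = (\<Prod>j\<in>{1..m}. \<bar>b j x - b j y\<bar>)" by (simp add: abs_prod)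
  also have "\<dots> \<le> (\<Prod>j\<in>{1..m}. B j * (2 * (?D x * ?D y)))"
  proof (rule prod_mono, rule conjI)
    fix j assume j: "j \<in> {1..m}"
    have t: "\<bar>b j z - davg \<tau> (b j) Q\<bar> \<le> B j * ?D z - B j" for z
    proof -
      have "\<bar>b j z - davg \<tau> (b j) Q\<bar> / B j \<le> (\<Sum>j\<in>{1..m}. \<bar>b j z - davg \<tau> (b j) Q\<bar> / B j)"
        using j B by (intro member_le_sum) (auto intro!: divide_nonneg_nonneg simp: less_imp_le)
      also have "\<dots> = ?D z - 1" by (simp add: bmo_osc_def)
      finally have "\<bar>b j z - davg \<tau> (b j) Q\<bar> \<le> (?D z - 1) * B j" using B[OF j] by (simp add: pos_divide_le_eq)
      then show ?thesis by (simp add: algebra_simps)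
    qed
    have "\<bar>b j x - b j y\<bar> \<le> B j * (?D x + ?D y)"
      using t[of x] t[of y] B[OF j] by (simp add: distrib_left)
    also have "\<dots> \<le> B j * (2 * (?D x * ?D y))"
    proof (rule mult_left_mono)
      have "?D x * 1 \<le> ?D x * ?D y" "1 * ?D y \<le> ?D x * ?D y" using D1[of x] D1[of y] by (intro mult_mono; simp)+
      then show "?D x + ?D y \<le> 2 * (?D x * ?D y)" by simp
    qed (use B[OF j] in simp)
    finally show "\<bar>b j x - b j y\<bar> \<le> B j * (2 * (?D x * ?D y))" .
  qed simp
  also have "\<dots> = (\<Prod>j\<in>{1..m}. B j) * 2 ^ m * (?D x ^ m * ?D y ^ m)"
    by (simp add: prod.distrib power_mult_distrib)
  finally show ?thesis .
qed

text \<open>If both grids separate u and v, an integer i and a point j + 2^l / 3 lie within 1/3 of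
  each other. Then the integer 3 * (i - j) - 2^l has absolute value below 1 and vanishes, although 3
  does not divide a power of 2.\<close>

lemma floor_shift_third:
  fixes u v :: real and l :: nat
  assumes "\<bar>u - v\<bar> < 1 / 3"
  shows "\<lfloor>u\<rfloor> = \<lfloor>v\<rfloor> \<or> \<lfloor>u - 2 ^ l / 3\<rfloor> = \<lfloor>v - 2 ^ l / 3\<rfloor>"
proof -
  have main: "\<lfloor>u\<rfloor> = \<lfloor>v\<rfloor> \<or> \<lfloor>u - 2 ^ l / 3\<rfloor> = \<lfloor>v - 2 ^ l / 3\<rfloor>" if uv: "u \<le> v" "v - u < 1 / 3" for u v :: real
  proof (rule ccontr)
    assume neg: "\<not> ?thesis"
    define i where "i = \<lfloor>v\<rfloor>"
    define j where "j = \<lfloor>v - 2 ^ l / 3\<rfloor>"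
    have "\<lfloor>u\<rfloor> \<le> i" "\<lfloor>u - 2 ^ l / 3\<rfloor> \<le> j" unfolding i_def j_def using uv by (auto intro: floor_mono)
    then have "\<lfloor>u\<rfloor> < i" "\<lfloor>u - 2 ^ l / 3\<rfloor> < j" using neg unfolding i_def j_def by auto
    then have "u < real_of_int i" "u - 2 ^ l / 3 < real_of_int j" by (auto simp: floor_less_iff)
    moreover have "real_of_int i \<le> v" "real_of_int j \<le> v - 2 ^ l / 3" unfolding i_def j_def by auto
    ultimately have "\<bar>real_of_int i - real_of_int j - 2 ^ l / 3\<bar> < 1 / 3" using uv by linarith
    then have "\<bar>3 * real_of_int i - 3 * real_of_int j - 2 ^ l\<bar> < 1" by linarith
    then have "\<bar>real_of_int (3 * (i - j) - 2 ^ l)\<bar> < 1" by simp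
    then have "3 * (i - j) = 2 ^ l" by linarith
    then have "(3::int) dvd 2 ^ l" by (metis dvd_triv_left)
    moreover have "coprime (3::int) (2 ^ l)" by simp
    ultimately have "is_unit (3::int)" by (metis coprime_absorb_left)
    then show False by simp
  qed
  show ?thesis
  proof (cases "u \<le> v")
    case True then show ?thesis using main[of u v] assms by auto
  next
    case False then show ?thesis using main[of v u] assms by auto
  qed
qed

section \<open>From the kernel to dyadic operators\<close>

text \<open>A third of the largest side in use, 2^(M + 4). Relative to a side 2^k with k \<le> M + 4
  it is 2^l / 3, at distance a third from the integers, so one shift works at all truncated levels.
  S lists the shifted coordinates, whence 2^n grids for each M.\<close>

definition dshift :: "nat \<Rightarrow> 'n :: finite set \<Rightarrow> real ^ 'n" where
  "dshift M S = (\<chi> i. if i \<in> S then 2 ^ (M + 4) / 3 else 0)"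

text \<open>Levels and positions are truncated to make the family finite; the range from - M to M +
  4 is that of the cubes produced by \<open>kernel_cover\<close>.\<close>

definition dtrunc :: "nat \<Rightarrow> real ^ 'n :: finite \<Rightarrow> 'n dindex set" where
  "dtrunc M \<tau> = {Q. - int M \<le> fst Q \<and> fst Q \<le> int M + 4 \<and> (\<exists>x. (\<forall>i. \<bar>x $ i\<bar> \<le> real M) \<and> x \<in> dcube \<tau> Q)}"

lemma finite_dtrunc: "finite (dtrunc M \<tau>)"
proof (rule finite_subset)
  let ?I = "\<lambda>k i. {\<lfloor>(- real M - \<tau> $ i) / 2 powr real_of_int k\<rfloor>..\<lfloor>(real M - \<tau> $ i) / 2 powr real_of_int k\<rfloor>}"
  show "dtrunc M \<tau> \<subseteq> (\<Union>k\<in>{- int M..int M + 4}. Pair k ` (Pi\<^sub>E UNIV (?I k)))"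
  proof
    fix Q assume "Q \<in> dtrunc M \<tau>"
    then obtain x where Q: "- int M \<le> fst Q" "fst Q \<le> int M + 4" and x: "\<And>i. \<bar>x $ i\<bar> \<le> real M" "x \<in> dcube \<tau> Q"
      unfolding dtrunc_def by blast
    have "snd Q i \<in> ?I (fst Q) i" for i
    proof -
      have "snd Q i = \<lfloor>(x $ i - \<tau> $ i) / 2 powr real_of_int (fst Q)\<rfloor>"
        using x(2) by (simp add: dcube_def dside_def)
      moreover have "- real M \<le> x $ i" "x $ i \<le> real M" using x(1)[of i] by auto
      ultimately show ?thesis by (auto intro!: floor_mono divide_right_mono)
    qed
    then have "snd Q \<in> Pi\<^sub>E UNIV (?I (fst Q))" by (auto simp: PiE_def)
    then show "Q \<in> (\<Union>k\<in>{- int M..int M + 4}. Pair k ` (Pi\<^sub>E UNIV (?I k)))"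
      using Q by (intro UN_I[of "fst Q"] image_eqI[of _ _ "snd Q"]) auto
  qed
  show "finite (\<Union>k\<in>{- int M..int M + 4}. Pair k ` (Pi\<^sub>E UNIV (?I k)))"
    by (intro finite_UN_I finite_imageI finite_PiE) auto
qed

text \<open>With d the largest coordinate distance, the side t lies between 3 * d and 6 * d. Then x
  and y are less than a third of a side apart in each coordinate, so the shifted or the unshifted
  grid keeps them together there. Since dist x y \<ge> d \<ge> t / 6 and the exponent is negative,
  the factor 6 powr (n - \<alpha>) results.\<close>

lemma kernel_cover:
  fixes x y :: "real ^ 'n::finite"
  assumes \<alpha>: "\<alpha> < real CARD('n)" and x: "\<And>i. \<bar>x $ i\<bar> \<le> real M" and y: "\<And>i. \<bar>y $ i\<bar> \<le> real M"
    and xy: "1 / 2 ^ M \<le> \<bar>x $ i0 - y $ i0\<bar>"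
  shows "\<exists>S. \<exists>Q\<in>dtrunc M (dshift M S). x \<in> dcube (dshift M S) Q \<and> y \<in> dcube (dshift M S) Q \<and>
    dist x y powr (\<alpha> - real CARD('n)) \<le> 6 powr (real CARD('n) - \<alpha>) * dside Q powr (\<alpha> - real CARD('n))"
proof -
  define d where "d = Max (range (\<lambda>i. \<bar>x $ i - y $ i\<bar>))"
  have dge: "\<bar>x $ i - y $ i\<bar> \<le> d" for i unfolding d_def by (intro Max_ge) auto
  have "d \<in> range (\<lambda>i. \<bar>x $ i - y $ i\<bar>)" unfolding d_def by (intro Max_in) auto
  then obtain i1 where i1: "d = \<bar>x $ i1 - y $ i1\<bar>" by auto
  have d1: "1 / 2 ^ M \<le> d" using xy dge[of i0] by linarith
  have d0: "d > 0" by (rule less_le_trans[OF _ d1]) simp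
  have d2: "d \<le> 2 * real M" using i1 x[of i1] y[of i1] by linarith
  have dd: "d \<le> dist x y" unfolding i1 dist_norm using component_le_norm_cart[of "x - y" i1] by simp
  define k where "k = \<lfloor>log 2 (3 * d)\<rfloor> + 1"
  define t where "t = 2 powr real_of_int k"
  have t0: "t > 0" by (simp add: t_def)
  have t3: "3 * d < t"
  proof -
    have "2 powr (log 2 (3 * d)) < 2 powr real_of_int k" unfolding k_def by (intro powr_less_mono) linarith+
    then show ?thesis using d0 by (simp add: t_def)
  qed
  have t6: "t \<le> 6 * d"
  proof -
    have "2 powr (real_of_int k - 1) \<le> 2 powr (log 2 (3 * d))" unfolding k_def by (intro powr_mono) auto
    then show ?thesis using d0 by (simp add: t_def powr_diff)
  qed
  have k1: "- int M \<le> k"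
  proof -
    have "2 powr (- real M) = 1 / 2 ^ M" by (simp add: powr_minus powr_realpow divide_inverse)
    also have "\<dots> < t" using d1 t3 d0 by linarith
    finally have "- real M < real_of_int k" unfolding t_def by simp
    then show ?thesis by linarith
  qed
  \<comment> \<open>From d \<le> 2 * M one gets t \<le> 12 * M < 16 * 2^M, which explains the 4 in
    \<open>dshift\<close> and \<open>dtrunc\<close>.\<close>
  have k2: "k \<le> int M + 4"
  proof -
    have "t \<le> 12 * real M" using t6 d2 by linarith
    also have "\<dots> < 16 * 2 ^ M" using of_nat_less_two_power[of M, where 'a = real] by linarith
    also have "\<dots> = 2 powr (real M + 4)" by (simp add: powr_add powr_realpow)
    finally have "real_of_int k < real M + 4" unfolding t_def by simp
    then show ?thesis by linarith
  qed
  \<comment> \<open>Exactly the coordinates in which the unshifted grid separates x and y are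
    shifted.\<close>
  define S where "S = {i. \<lfloor>x $ i / t\<rfloor> \<noteq> \<lfloor>y $ i / t\<rfloor>}"
  let ?\<tau> = "dshift M S"
  define l where "l = nat (int M + 4 - k)"
  have tl: "2 ^ (M + 4) = t * 2 ^ l"
  proof -
    have "t * 2 ^ l = 2 powr real_of_int k * 2 powr real l" by (simp add: t_def powr_realpow)
    also have "\<dots> = 2 powr (real (M + 4))" using k2 by (simp add: l_def flip: powr_add)
    also have "\<dots> = 2 ^ (M + 4)" by (rule powr_realpow) simp
    finally show ?thesis by simp
  qed
  have fl: "\<lfloor>(x $ i - ?\<tau> $ i) / t\<rfloor> = \<lfloor>(y $ i - ?\<tau> $ i) / t\<rfloor>" for i
  proof (cases "i \<in> S")
    case True
    have "\<bar>x $ i / t - y $ i / t\<bar> = \<bar>x $ i - y $ i\<bar> / t" using t0 by (simp flip: diff_divide_distrib)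
    also have "\<dots> < 1 / 3" using dge[of i] t3 t0 by (simp add: field_simps)
    finally have "\<lfloor>x $ i / t - 2 ^ l / 3\<rfloor> = \<lfloor>y $ i / t - 2 ^ l / 3\<rfloor>"
      using floor_shift_third[of "x $ i / t" "y $ i / t" l] True by (auto simp: S_def)
    moreover have "(z - ?\<tau> $ i) / t = z / t - 2 ^ l / 3" for z
      using True t0 unfolding dshift_def tl by (simp add: diff_divide_distrib)
    ultimately show ?thesis by simp
  next
    case False
    then show ?thesis by (simp add: S_def dshift_def)
  qed
  let ?Q = "dat ?\<tau> k x"
  have xQ: "x \<in> dcube ?\<tau> ?Q" by simp
  have yQ: "y \<in> dcube ?\<tau> ?Q"
    unfolding dcube_def using fl by (simp add: dat_def dside_def t_def)
  have QT: "?Q \<in> dtrunc M ?\<tau>" unfolding dtrunc_def using k1 k2 x by (intro CollectI conjI exI[of _ x] allI) simp_all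
  have "dist x y powr (\<alpha> - real CARD('n)) \<le> (t / 6) powr (\<alpha> - real CARD('n))"
    using \<alpha> dd t6 t0 by (intro powr_mono2') auto
  also have "\<dots> = 6 powr (real CARD('n) - \<alpha>) * t powr (\<alpha> - real CARD('n))"
    using t0 by (simp add: powr_divide powr_diff)
  also have "t = dside ?Q" by (simp add: t_def)
  finally show ?thesis using xQ yQ QT by blast
qed

lemma osc_int_cong_AE:
  assumes "AE x in lebesgue. f x = g x"
  shows "osc_int \<tau> D m f Q = osc_int \<tau> D m g Q"
  unfolding osc_int_def by (rule nn_integral_cong_AE) (use assms in auto)

lemma dyadic_op_cong_AE:
  assumes "AE x in lebesgue. f x = g x"
  shows "dyadic_op \<alpha> \<tau> D m \<F> f = dyadic_op \<alpha> \<tau> D m \<F> g"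
  unfolding dyadic_op_def osc_int_cong_AE[OF assms] by (rule refl)

text \<open>Each y in R M is charged to one grid cube containing both x and y, and the remaining
  nonnegative terms of the double sum are then added. The truncated integrals increase with M, but
  the grids that dominate them change with M; hence a liminf on the right.\<close>

lemma frac_comm_le_dyadic:
  fixes f :: "real ^ 'n::finite \<Rightarrow> real"
  assumes \<alpha>: "\<alpha> < real CARD('n)" and f[measurable]: "f \<in> borel_measurable lebesgue"
    and b: "\<And>j. j \<in> {1..m} \<Longrightarrow> b j \<in> borel_measurable lebesgue" and B: "\<And>j. j \<in> {1..m} \<Longrightarrow> B j > 0"
    and fin: "\<And>\<tau> P. osc_int \<tau> (bmo_osc m b B \<tau>) m (\<lambda>x. \<bar>f x\<bar>) P \<noteq> top"
  shows "ennreal \<bar>frac_comm \<alpha> m b f x\<bar> \<le> liminf (\<lambda>M. ennreal (6 powr (real CARD('n) - \<alpha>) * (\<Prod>j\<in>{1..m}. B j) * 2 ^ m *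
     (\<Sum>S\<in>UNIV. dyadic_op \<alpha> (dshift M S) (bmo_osc m b B (dshift M S)) m (dtrunc M (dshift M S)) (\<lambda>x. \<bar>f x\<bar>) x)))"
    (is "_ \<le> liminf (\<lambda>M. ennreal (?c1 * ?\<beta> * 2 ^ m * ?G M))")
proof -
  define \<phi> where "\<phi> y = (\<Prod>j\<in>{1..m}. b j x - b j y) * f y / dist x y powr (real CARD('n) - \<alpha>)" for y
  have frac: "frac_comm \<alpha> m b f x = (\<integral>y. \<phi> y \<partial>lebesgue)" by (simp add: frac_comm_def \<phi>_def)
  have [measurable]: "(\<lambda>y. \<Prod>j\<in>{1..m}. b j x - b j y) \<in> borel_measurable lebesgue"
    using b by (intro borel_measurable_prod borel_measurable_diff) auto
  have bmo_meas: "bmo_osc m b B \<tau> Q \<in> borel_measurable lebesgue" for \<tau> Q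
    unfolding bmo_osc_def using b
    by (intro borel_measurable_add borel_measurable_sum borel_measurable_divide borel_measurable_abs borel_measurable_diff) auto
  have [measurable]: "(\<lambda>y. dist x y) \<in> borel_measurable lebesgue"
    by (intro measurable_completion) (auto intro!: borel_measurable_continuous_onI continuous_intros)
  have [measurable]: "\<phi> \<in> borel_measurable lebesgue" unfolding \<phi>_def by measurable
  \<comment> \<open>The part of the domain where \<open>kernel_cover\<close> applies; as M grows it
    exhausts everything but the point x.\<close>
  define R where "R M = {y. (\<forall>i. \<bar>y $ i\<bar> \<le> real M) \<and> (\<exists>i. 1 / 2 ^ M \<le> \<bar>x $ i - y $ i\<bar>)}" for M :: nat
  have R[measurable]: "R M \<in> sets lebesgue" for M
  proof -
    have "R M = {y. \<forall>i. \<bar>y $ i\<bar> \<le> real M} \<inter> (\<Union>i\<in>UNIV. {y. 1 / 2 ^ M \<le> \<bar>x $ i - y $ i\<bar>})"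
      by (auto simp: R_def)
    moreover have "closed \<dots>"
      by (intro closed_Int closed_UN ballI closed_Collect_all closed_Collect_le continuous_intros) auto
    ultimately have "closed (R M)" by simp
    then show ?thesis by auto
  qed
  show ?thesis
  proof (cases "integrable lebesgue \<phi>")
    \<comment> \<open>Without integrability the Bochner integral is 0 by convention and the bound is
      trivial.\<close>
    case False
    then show ?thesis by (simp add: frac not_integrable_integral_eq)
  next
    case True
    have "ennreal \<bar>frac_comm \<alpha> m b f x\<bar> \<le> (\<integral>\<^sup>+y. ennreal \<bar>\<phi> y\<bar> \<partial>lebesgue)"
      unfolding frac using integral_norm_bound_ennreal[OF True] by simp
    also have "\<dots> \<le> (\<integral>\<^sup>+y. liminf (\<lambda>M. ennreal \<bar>\<phi> y\<bar> * indicator (R M) y) \<partial>lebesgue)"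
    proof (rule nn_integral_mono)
      fix y
      show "ennreal \<bar>\<phi> y\<bar> \<le> liminf (\<lambda>M. ennreal \<bar>\<phi> y\<bar> * indicator (R M) y)"
      proof (cases "x = y")
        \<comment> \<open>On the diagonal the kernel divides by a power of 0, and division by 0
          yields 0 by convention.\<close>
        case True
        then show ?thesis by (simp add: \<phi>_def)
      next
        case False
        then obtain i where i: "x $ i \<noteq> y $ i" by (auto simp: vec_eq_iff)
        obtain M1 :: nat where M1: "Max (range (\<lambda>i. \<bar>y $ i\<bar>)) \<le> real M1" using real_arch_simple by blast
        have y: "\<bar>y $ i\<bar> \<le> real M1" for i by (rule order_trans[OF Max_ge M1]) auto
        obtain M2 where M2: "(1 / 2 :: real) ^ M2 < \<bar>x $ i - y $ i\<bar>"
          using real_arch_pow_inv[of "\<bar>x $ i - y $ i\<bar>" "1 / 2"] i by auto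
        have "\<forall>\<^sub>F M in sequentially. ennreal \<bar>\<phi> y\<bar> \<le> ennreal \<bar>\<phi> y\<bar> * indicator (R M) y"
          unfolding eventually_sequentially
        proof (intro exI allI impI)
          fix M assume M: "M \<ge> max M1 M2"
          have "(1 / 2 :: real) ^ M \<le> (1 / 2) ^ M2" using M by (intro power_decreasing) auto
          then have "1 / 2 ^ M \<le> \<bar>x $ i - y $ i\<bar>" using M2 by (simp add: power_one_over)
          moreover have "\<bar>y $ i\<bar> \<le> real M" for i using y[of i] M by simp
          ultimately have "y \<in> R M" unfolding R_def by blast
          then show "ennreal \<bar>\<phi> y\<bar> \<le> ennreal \<bar>\<phi> y\<bar> * indicator (R M) y" by simp
        qed
        then show ?thesis by (rule Liminf_bounded)
      qed
    qed
    also have "\<dots> \<le> liminf (\<lambda>M. \<integral>\<^sup>+y. ennreal \<bar>\<phi> y\<bar> * indicator (R M) y \<partial>lebesgue)"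
      by (rule nn_integral_liminf) measurable
    also have "\<dots> \<le> liminf (\<lambda>M. ennreal (?c1 * ?\<beta> * 2 ^ m * ?G M))"
    proof (rule Liminf_mono)
      obtain M1 :: nat where M1: "Max (range (\<lambda>i. \<bar>x $ i\<bar>)) \<le> real M1" using real_arch_simple by blast
      have x: "\<bar>x $ i\<bar> \<le> real M1" for i by (rule order_trans[OF Max_ge M1]) auto
      show "\<forall>\<^sub>F M in sequentially. (\<integral>\<^sup>+y. ennreal \<bar>\<phi> y\<bar> * indicator (R M) y \<partial>lebesgue) \<le> ennreal (?c1 * ?\<beta> * 2 ^ m * ?G M)"
        unfolding eventually_sequentially
      proof (intro exI allI impI)
        fix M assume M: "M \<ge> M1"
        have xM: "\<bar>x $ i\<bar> \<le> real M" for i using x[of i] M by simp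
        define D where "D S = bmo_osc m b B (dshift M S)" for S
        define W where "W S Q = dside Q powr (\<alpha> - real CARD('n)) * (D S Q x ^ m * indicator (dcube (dshift M S) Q) x)" for S Q
        define c where "c = ?c1 * ?\<beta> * 2 ^ m"
        have P0: "?\<beta> \<ge> 0" using B by (intro prod_nonneg less_imp_le)
        have c0: "c \<ge> 0" using P0 by (simp add: c_def)
        have D1: "D S Q z \<ge> 1" for S Q z
          unfolding D_def bmo_osc_def using B by (auto intro!: sum_nonneg divide_nonneg_nonneg simp: less_imp_le)
        have D0: "D S Q z \<ge> 0" for S Q z using D1[of S Q z] by simp
        have W0: "W S Q \<ge> 0" for S Q using D0 by (simp add: W_def)
        have [measurable]: "D S Q \<in> borel_measurable lebesgue" for S Q unfolding D_def by (rule bmo_meas)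
        have pw: "ennreal \<bar>\<phi> y\<bar> * indicator (R M) y \<le>
          ennreal c * (\<Sum>S\<in>UNIV. \<Sum>Q\<in>dtrunc M (dshift M S). ennreal (W S Q) * (ennreal (D S Q y ^ m * \<bar>f y\<bar>) * indicator (dcube (dshift M S) Q) y))" for y
        proof (cases "y \<in> R M")
          case False
          then show ?thesis by simp
        next
          case True
          then obtain i0 where y: "\<And>i. \<bar>y $ i\<bar> \<le> real M" "1 / 2 ^ M \<le> \<bar>x $ i0 - y $ i0\<bar>" unfolding R_def by blast
          obtain S Q where Q: "Q \<in> dtrunc M (dshift M S)" "x \<in> dcube (dshift M S) Q" "y \<in> dcube (dshift M S) Q"
            and ker: "dist x y powr (\<alpha> - real CARD('n)) \<le> ?c1 * dside Q powr (\<alpha> - real CARD('n))"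
            using kernel_cover[OF \<alpha> xM y] by blast
          have "\<bar>\<phi> y\<bar> = \<bar>\<Prod>j\<in>{1..m}. b j x - b j y\<bar> * dist x y powr (\<alpha> - real CARD('n)) * \<bar>f y\<bar>"
          proof -
            have "dist x y powr (\<alpha> - real CARD('n)) = 1 / dist x y powr (real CARD('n) - \<alpha>)"
              using powr_minus_divide[of "dist x y" "real CARD('n) - \<alpha>"] by simp
            then show ?thesis by (simp add: \<phi>_def abs_mult abs_divide)
          qed
          also have "\<dots> \<le> (?\<beta> * 2 ^ m * (D S Q x ^ m * D S Q y ^ m)) * (?c1 * dside Q powr (\<alpha> - real CARD('n))) * \<bar>f y\<bar>"
          proof (intro mult_right_mono mult_mono ker)
            show "\<bar>\<Prod>j\<in>{1..m}. b j x - b j y\<bar> \<le> ?\<beta> * 2 ^ m * (D S Q x ^ m * D S Q y ^ m)"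
              unfolding D_def by (rule prod_diff_le_bmo_osc) (rule B)
            show "0 \<le> ?\<beta> * 2 ^ m * (D S Q x ^ m * D S Q y ^ m)"
              using P0 D0 by (intro mult_nonneg_nonneg) auto
          qed auto
          also have "\<dots> = c * (W S Q * (D S Q y ^ m * \<bar>f y\<bar>))" using Q(2) by (simp add: W_def c_def mult_ac)
          finally have "ennreal \<bar>\<phi> y\<bar> \<le> ennreal (c * (W S Q * (D S Q y ^ m * \<bar>f y\<bar>)))" by (rule ennreal_leI)
          also have "\<dots> = ennreal c * (ennreal (W S Q) * (ennreal (D S Q y ^ m * \<bar>f y\<bar>) * indicator (dcube (dshift M S) Q) y))"
            using c0 W0 Q(3) by (simp add: ennreal_mult')
          also have "\<dots> \<le> ennreal c * (\<Sum>S\<in>UNIV. \<Sum>Q\<in>dtrunc M (dshift M S). ennreal (W S Q) * (ennreal (D S Q y ^ m * \<bar>f y\<bar>) * indicator (dcube (dshift M S) Q) y))"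
          proof (rule mult_left_mono)
            have "ennreal (W S Q) * (ennreal (D S Q y ^ m * \<bar>f y\<bar>) * indicator (dcube (dshift M S) Q) y)
              \<le> (\<Sum>Q\<in>dtrunc M (dshift M S). ennreal (W S Q) * (ennreal (D S Q y ^ m * \<bar>f y\<bar>) * indicator (dcube (dshift M S) Q) y))"
              using Q(1) finite_dtrunc by (intro member_le_sum) auto
            also have "\<dots> \<le> (\<Sum>S\<in>UNIV. \<Sum>Q\<in>dtrunc M (dshift M S). ennreal (W S Q) * (ennreal (D S Q y ^ m * \<bar>f y\<bar>) * indicator (dcube (dshift M S) Q) y))"
              by (rule member_le_sum[of S UNIV "\<lambda>S. \<Sum>Q\<in>dtrunc M (dshift M S). ennreal (W S Q) * (ennreal (D S Q y ^ m * \<bar>f y\<bar>) * indicator (dcube (dshift M S) Q) y)"]) auto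
            finally show "ennreal (W S Q) * (ennreal (D S Q y ^ m * \<bar>f y\<bar>) * indicator (dcube (dshift M S) Q) y) \<le> (\<Sum>S\<in>UNIV. \<Sum>Q\<in>dtrunc M (dshift M S). ennreal (W S Q) * (ennreal (D S Q y ^ m * \<bar>f y\<bar>) * indicator (dcube (dshift M S) Q) y))" .
          qed simp
          finally show ?thesis using True by simp
        qed
        have "(\<integral>\<^sup>+y. ennreal \<bar>\<phi> y\<bar> * indicator (R M) y \<partial>lebesgue) \<le>
          (\<integral>\<^sup>+y. ennreal c * (\<Sum>S\<in>UNIV. \<Sum>Q\<in>dtrunc M (dshift M S). ennreal (W S Q) * (ennreal (D S Q y ^ m * \<bar>f y\<bar>) * indicator (dcube (dshift M S) Q) y)) \<partial>lebesgue)"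
          by (rule nn_integral_mono) (rule pw)
        also have "\<dots> = ennreal c * (\<Sum>S\<in>UNIV. \<Sum>Q\<in>dtrunc M (dshift M S). ennreal (W S Q) * osc_int (dshift M S) (D S) m (\<lambda>x. \<bar>f x\<bar>) Q)"
          unfolding osc_int_def by (simp add: nn_integral_cmult nn_integral_sum)
        also have "\<dots> = ennreal c * (\<Sum>S\<in>UNIV. \<Sum>Q\<in>dtrunc M (dshift M S). ennreal (W S Q * enn2real (osc_int (dshift M S) (D S) m (\<lambda>x. \<bar>f x\<bar>) Q)))"
          using fin W0 unfolding D_def by (intro arg_cong2[where f = "(*)"] sum.cong refl) (simp add: ennreal_mult less_top)
        also have "\<dots> = ennreal c * ennreal (\<Sum>S\<in>UNIV. \<Sum>Q\<in>dtrunc M (dshift M S). W S Q * enn2real (osc_int (dshift M S) (D S) m (\<lambda>x. \<bar>f x\<bar>) Q))"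
          using W0 by (simp add: sum_ennreal sum_nonneg)
        also have "(\<Sum>S\<in>UNIV. \<Sum>Q\<in>dtrunc M (dshift M S). W S Q * enn2real (osc_int (dshift M S) (D S) m (\<lambda>x. \<bar>f x\<bar>) Q)) = ?G M"
          unfolding dyadic_op_def W_def D_def by (intro sum.cong refl) (simp add: mult_ac)
        also have "ennreal c * ennreal (?G M) = ennreal (?c1 * ?\<beta> * 2 ^ m * ?G M)"
          using c0 unfolding c_def[symmetric] by (rule ennreal_mult'[symmetric])
        finally show "(\<integral>\<^sup>+y. ennreal \<bar>\<phi> y\<bar> * indicator (R M) y \<partial>lebesgue) \<le> ennreal (?c1 * ?\<beta> * 2 ^ m * ?G M)" .
      qed
    qed
    finally show ?thesis .
  qed
qed

text \<open>A liminf bound at t gives an eventual bound only for each r < t. The increasing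
  continuous map is applied there, and r then tends to t from below.\<close>

lemma ennreal_powr_le_liminf:
  fixes g :: "nat \<Rightarrow> real"
  assumes le: "ennreal t \<le> liminf (\<lambda>n. ennreal (g n))" and t: "t \<ge> 0" and q: "q > 0" and w: "w \<ge> 0"
  shows "ennreal ((t * w) powr q) \<le> liminf (\<lambda>n. ennreal ((g n * w) powr q))"
proof (cases "t = 0")
  case True
  then show ?thesis by simp
next
  case False
  then have t0: "t > 0" using t by simp
  have *: "ennreal ((r * w) powr q) \<le> liminf (\<lambda>n. ennreal ((g n * w) powr q))" if r: "0 \<le> r" "r < t" for r
  proof -
    have "ennreal r < ennreal t" using r by (simp add: ennreal_less_iff)
    then have "ennreal r < liminf (\<lambda>n. ennreal (g n))" using le by (rule less_le_trans)
    then have "\<forall>\<^sub>F n in sequentially. ennreal r < ennreal (g n)" by (rule less_LiminfD)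
    then have "\<forall>\<^sub>F n in sequentially. ennreal ((r * w) powr q) \<le> ennreal ((g n * w) powr q)"
    proof eventually_elim
      case (elim n)
      then have "r < g n" using r by (simp add: ennreal_less_iff)
      then show ?case using r w q by (intro ennreal_leI powr_mono2 mult_right_mono) auto
    qed
    then show ?thesis by (rule Liminf_bounded)
  qed
  define r where "r i = t * (1 - 1 / real (Suc i))" for i
  have r: "0 \<le> r i" "r i < t" for i using t0 by (auto simp: r_def field_simps)
  have "(\<lambda>i. 1 / real (Suc i)) \<longlonglongrightarrow> 0" by (rule LIMSEQ_Suc[OF lim_1_over_n])
  then have "(\<lambda>i. r i) \<longlonglongrightarrow> t * (1 - 0)" unfolding r_def by (intro tendsto_intros)
  then have rt: "(\<lambda>i. r i * w) \<longlonglongrightarrow> t * w" by (intro tendsto_mult_right) simp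
  have "(\<lambda>i. (r i * w) powr q) \<longlonglongrightarrow> (t * w) powr q"
  proof (rule tendsto_powr2[OF rt tendsto_const])
    show "\<forall>\<^sub>F i in sequentially. 0 \<le> r i * w" using r(1) w by auto
  qed (use q in auto)
  then have "(\<lambda>i. ennreal ((r i * w) powr q)) \<longlonglongrightarrow> ennreal ((t * w) powr q)" by (rule tendsto_ennrealI)
  then show ?thesis by (rule LIMSEQ_le_const2) (use * r in blast)
qed

lemma sum_powr_le:
  fixes x :: "'a \<Rightarrow> real"
  assumes "finite I" "\<And>i. i \<in> I \<Longrightarrow> x i \<ge> 0" "q > 0"
  shows "(\<Sum>i\<in>I. x i) powr q \<le> real (card I) powr q * (\<Sum>i\<in>I. x i powr q)"
proof (cases "I = {}")
  case False
  have "Max (x ` I) \<in> x ` I" using assms False by (intro Max_in) auto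
  then obtain i where i: "i \<in> I" "x i = Max (x ` I)" by auto
  have "(\<Sum>i\<in>I. x i) \<le> (\<Sum>j\<in>I. x i)" using assms i(2) by (intro sum_mono) auto
  then have "(\<Sum>i\<in>I. x i) powr q \<le> (real (card I) * x i) powr q"
    using assms by (intro powr_mono2 sum_nonneg) auto
  also have "\<dots> = real (card I) powr q * x i powr q" by (rule powr_mult)
  also have "\<dots> \<le> real (card I) powr q * (\<Sum>i\<in>I. x i powr q)"
    using assms i by (intro mult_left_mono member_le_sum) auto
  finally show ?thesis .
qed simp

section \<open>Norm bounds and Luxemburg norms\<close>

text \<open>For each truncation the 2^n grids are estimated by \<open>dyadic_op_bound\<close> with a
  constant free of the shift, and Fatou's lemma lets M tend to infinity. The factorisation |f| = F *
  wv holds almost everywhere only, which is enough because the dyadic operators see f through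
  integrals.\<close>

lemma frac_comm_Lq_bound:
  fixes p q \<alpha> s \<delta> :: real and m :: nat
  assumes p: "1 < p" "p \<le> s" "s \<le> q" and \<alpha>: "0 < \<alpha>" "\<alpha> < real CARD('n::finite)" and m: "1 \<le> m" and \<delta>: "0 < \<delta>"
  shows "\<exists>C>0. \<forall>(b :: nat \<Rightarrow> real ^ 'n \<Rightarrow> real) B f F wv wu a Kc.
     (\<forall>j\<in>{1..m}. locally_integrable (b j) \<and> bmo_norm (b j) \<le> ennreal (B j) \<and> B j > 0) \<and>
     f \<in> borel_measurable lebesgue \<and> F \<in> borel_measurable lebesgue \<and>
     wv \<in> borel_measurable lebesgue \<and> wu \<in> borel_measurable lebesgue \<and>
     (\<forall>x. F x \<ge> 0) \<and> (\<forall>x. wv x \<ge> 0) \<and> (\<forall>x. wu x \<ge> 0) \<and>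
     (AE x in lebesgue. \<bar>f x\<bar> = F x * wv x) \<and>
     (\<integral>\<^sup>+x. ennreal (F x powr p) \<partial>lebesgue) = ennreal a \<and> a \<ge> 0 \<and> Kc \<ge> 0 \<and>
     (\<forall>\<tau>. bump_cond \<alpha> p q m s \<delta> \<tau> wu wv Kc)
     \<longrightarrow> (\<integral>\<^sup>+x. ennreal ((\<bar>frac_comm \<alpha> m b f x\<bar> * wu x) powr q) \<partial>lebesgue)
        \<le> ennreal ((C * Kc * (\<Prod>j\<in>{1..m}. B j) * a powr (1 / p)) powr q)"
proof -
  have q: "q > 1" using p by simp
  define c where "c = ln (3/2) / (2 ^ (CARD('n) + 1) * real m)"
  define C0 where "C0 = 8 * real m * exp c"
  define K where "K = real m * 2 ^ CARD('n)"
  have c0: "c > 0" using m by (simp add: c_def)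
  have C0: "C0 \<ge> 0" and K0: "K \<ge> 0" by (auto simp: C0_def K_def)
  obtain C1 where C1: "C1 > 0" and dy: "\<And>(\<tau> :: real ^ 'n) D F wv wu a Kc \<F>.
     osc_family \<tau> c C0 K D \<and> F \<in> borel_measurable lebesgue \<and>
     wv \<in> borel_measurable lebesgue \<and> wu \<in> borel_measurable lebesgue \<and>
     (\<forall>x. F x \<ge> 0) \<and> (\<forall>x. wv x \<ge> 0) \<and> (\<forall>x. wu x \<ge> 0) \<and>
     (\<integral>\<^sup>+x. ennreal (F x powr p) \<partial>lebesgue) = ennreal a \<and> a \<ge> 0 \<and> Kc \<ge> 0 \<and> bump_cond \<alpha> p q m s \<delta> \<tau> wu wv Kc \<and> finite \<F>
     \<Longrightarrow> (\<forall>P. osc_int \<tau> D m (\<lambda>x. F x * wv x) P \<noteq> top) \<and>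
       (\<integral>\<^sup>+x. ennreal ((dyadic_op \<alpha> \<tau> D m \<F> (\<lambda>x. F x * wv x) x * wu x) powr q) \<partial>lebesgue) \<le> ennreal ((C1 * Kc * a powr (1 / p)) powr q)"
    using dyadic_op_bound[where 'n = 'n, OF p \<alpha>(1) \<delta> c0 C0 K0, of m] by blast
  define N where "N = real (card (UNIV :: 'n set set))"
  have N: "N > 0" by (simp add: N_def card_gt_0_iff)
  define c1 where "c1 = 6 powr (real CARD('n) - \<alpha>) * 2 ^ m"
  have c1: "c1 > 0" by (simp add: c1_def)
  \<comment> \<open>N comes from the power of a sum of N terms, N powr (1 / q) from adding N equal
    bounds for q-th powers.\<close>
  define C where "C = c1 * N * N powr (1 / q) * C1"
  have C: "C > 0" using c1 N C1 by (simp add: C_def)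
  have main: "(\<integral>\<^sup>+x. ennreal ((\<bar>frac_comm \<alpha> m b f x\<bar> * wu x) powr q) \<partial>lebesgue)
        \<le> ennreal ((C * Kc * (\<Prod>j\<in>{1..m}. B j) * a powr (1 / p)) powr q)"
    if b: "\<forall>j\<in>{1..m}. locally_integrable (b j) \<and> bmo_norm (b j) \<le> ennreal (B j) \<and> B j > 0"
      and me[measurable]: "f \<in> borel_measurable lebesgue" "F \<in> borel_measurable lebesgue" "wv \<in> borel_measurable lebesgue" "wu \<in> borel_measurable lebesgue"
      and nn: "\<forall>x. F x \<ge> 0" "\<forall>x. wv x \<ge> 0" "\<forall>x. wu x \<ge> 0"
      and fF: "AE x in lebesgue. \<bar>f x\<bar> = F x * wv x"
      and a: "(\<integral>\<^sup>+x. ennreal (F x powr p) \<partial>lebesgue) = ennreal a" "a \<ge> 0" and Kc: "Kc \<ge> 0"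
      and bump: "\<forall>\<tau>. bump_cond \<alpha> p q m s \<delta> \<tau> wu wv Kc"
    for b :: "nat \<Rightarrow> real ^ 'n \<Rightarrow> real" and B f F wv wu a Kc
  proof -
    have osc: "osc_family \<tau> c C0 K (bmo_osc m b B \<tau>)" for \<tau>
      unfolding C0_def K_def by (rule osc_family_bmo[OF m]) (use b in \<open>auto simp: c_def\<close>)
    have dyF: "(\<forall>P. osc_int \<tau> (bmo_osc m b B \<tau>) m (\<lambda>x. F x * wv x) P \<noteq> top) \<and>
       (\<integral>\<^sup>+x. ennreal ((dyadic_op \<alpha> \<tau> (bmo_osc m b B \<tau>) m \<F> (\<lambda>x. F x * wv x) x * wu x) powr q) \<partial>lebesgue) \<le> ennreal ((C1 * Kc * a powr (1 / p)) powr q)"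
      if "finite \<F>" for \<tau> \<F>
      by (rule dy) (use osc me nn a Kc bump that in blast)
    define G where "G M S = dyadic_op \<alpha> (dshift M S) (bmo_osc m b B (dshift M S)) m (dtrunc M (dshift M S)) (\<lambda>x. \<bar>f x\<bar>)" for M S
    have G0: "G M S x \<ge> 0" for M S x
      unfolding G_def dyadic_op_def using osc_familyD(2)[OF osc]
      by (intro sum_nonneg mult_nonneg_nonneg zero_le_power) (auto intro: order_trans[OF zero_le_one])
    have Gm[measurable]: "G M S \<in> borel_measurable lebesgue" for M S
    proof -
      note [measurable] = osc_familyD(1)[OF osc]
      show ?thesis unfolding G_def dyadic_op_def by measurable
    qed
    have GI: "(\<integral>\<^sup>+x. ennreal ((G M S x * wu x) powr q) \<partial>lebesgue) \<le> ennreal ((C1 * Kc * a powr (1 / p)) powr q)" for M S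
      unfolding G_def dyadic_op_cong_AE[OF fF] using dyF[OF finite_dtrunc] by blast
    define \<beta> where "\<beta> = (\<Prod>j\<in>{1..m}. B j)"
    have \<beta>: "\<beta> \<ge> 0" unfolding \<beta>_def using b by (intro prod_nonneg) (auto intro: less_imp_le)
    define H where "H M x = c1 * \<beta> * (\<Sum>S\<in>UNIV. G M S x)" for M x
    have [measurable]: "H M \<in> borel_measurable lebesgue" for M unfolding H_def by measurable
    have fr: "ennreal \<bar>frac_comm \<alpha> m b f x\<bar> \<le> liminf (\<lambda>M. ennreal (H M x))" for x
    proof -
      have "ennreal \<bar>frac_comm \<alpha> m b f x\<bar> \<le> liminf (\<lambda>M. ennreal (6 powr (real CARD('n) - \<alpha>) * (\<Prod>j\<in>{1..m}. B j) * 2 ^ m *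
         (\<Sum>S\<in>UNIV. G M S x)))"
        unfolding G_def
      proof (rule frac_comm_le_dyadic[OF \<alpha>(2) me(1)])
        show "\<And>j. j \<in> {1..m} \<Longrightarrow> b j \<in> borel_measurable lebesgue" using b locally_integrable_measurable by blast
        show "\<And>j. j \<in> {1..m} \<Longrightarrow> 0 < B j" using b by blast
        show "osc_int \<tau> (bmo_osc m b B \<tau>) m (\<lambda>x. \<bar>f x\<bar>) P \<noteq> top" for \<tau> P
          unfolding osc_int_cong_AE[OF fF] using dyF[of "{}" \<tau>] by blast
      qed
      then show ?thesis by (simp add: H_def c1_def \<beta>_def mult_ac)
    qed
    show ?thesis
    proof (rule nn_integral_le_Fatou)
      show "(\<lambda>x. ennreal ((H M x * wu x) powr q)) \<in> borel_measurable lebesgue" for M by measurable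
      show "AE x in lebesgue. ennreal ((\<bar>frac_comm \<alpha> m b f x\<bar> * wu x) powr q) \<le> liminf (\<lambda>M. ennreal ((H M x * wu x) powr q))"
        using fr nn q by (intro AE_I2 ennreal_powr_le_liminf) auto
      fix M
      have pw: "(H M x * wu x) powr q \<le> (c1 * \<beta> * N) powr q * (\<Sum>S\<in>UNIV. (G M S x * wu x) powr q)" for x
      proof -
        have "H M x * wu x = c1 * \<beta> * (\<Sum>S\<in>UNIV. G M S x * wu x)" by (simp add: H_def sum_distrib_right mult.assoc)
        then have "(H M x * wu x) powr q = (c1 * \<beta>) powr q * (\<Sum>S\<in>UNIV. G M S x * wu x) powr q"
          by (simp only: powr_mult)
        also have "\<dots> \<le> (c1 * \<beta>) powr q * (N powr q * (\<Sum>S\<in>UNIV. (G M S x * wu x) powr q))"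
          unfolding N_def using G0 nn q by (intro mult_left_mono sum_powr_le) auto
        finally show ?thesis by (simp add: powr_mult mult_ac)
      qed
      have "(\<integral>\<^sup>+x. ennreal ((H M x * wu x) powr q) \<partial>lebesgue) \<le> (\<integral>\<^sup>+x. ennreal ((c1 * \<beta> * N) powr q) * (\<Sum>S\<in>UNIV. ennreal ((G M S x * wu x) powr q)) \<partial>lebesgue)"
      proof (rule nn_integral_mono)
        fix x
        have "ennreal ((H M x * wu x) powr q) \<le> ennreal ((c1 * \<beta> * N) powr q * (\<Sum>S\<in>UNIV. (G M S x * wu x) powr q))"
          by (rule ennreal_leI[OF pw])
        also have "\<dots> = ennreal ((c1 * \<beta> * N) powr q) * (\<Sum>S\<in>UNIV. ennreal ((G M S x * wu x) powr q))"
          by (simp add: ennreal_mult sum_nonneg)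
        finally show "ennreal ((H M x * wu x) powr q) \<le> ennreal ((c1 * \<beta> * N) powr q) * (\<Sum>S\<in>UNIV. ennreal ((G M S x * wu x) powr q))" .
      qed
      also have "\<dots> = ennreal ((c1 * \<beta> * N) powr q) * (\<Sum>S\<in>UNIV. \<integral>\<^sup>+x. ennreal ((G M S x * wu x) powr q) \<partial>lebesgue)"
        by (subst nn_integral_cmult, measurable, subst nn_integral_sum, measurable)
      also have "\<dots> \<le> ennreal ((c1 * \<beta> * N) powr q) * (\<Sum>S\<in>(UNIV :: 'n set set). ennreal ((C1 * Kc * a powr (1 / p)) powr q))"
        by (intro mult_left_mono sum_mono GI) auto
      also have "\<dots> = ennreal ((c1 * \<beta> * N) powr q) * (ennreal N * ennreal ((C1 * Kc * a powr (1 / p)) powr q))"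
        by (simp add: N_def ennreal_of_nat_eq_real_of_nat)
      also have "\<dots> = ennreal ((c1 * \<beta> * N) powr q * (N * (C1 * Kc * a powr (1 / p)) powr q))"
        using N by (simp add: ennreal_mult)
      also have "(c1 * \<beta> * N) powr q * (N * (C1 * Kc * a powr (1 / p)) powr q) = (C * Kc * \<beta> * a powr (1 / p)) powr q"
      proof -
        have "N = (N powr (1 / q)) powr q" using N q by (simp add: powr_powr)
        then have "(c1 * \<beta> * N) powr q * (N * (C1 * Kc * a powr (1 / p)) powr q) =
            (c1 * \<beta> * N) powr q * ((N powr (1 / q)) powr q * (C1 * Kc * a powr (1 / p)) powr q)" by simp
        also have "\<dots> = (C * Kc * \<beta> * a powr (1 / p)) powr q"
          unfolding powr_mult[symmetric] C_def by (simp add: mult_ac)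
        finally show ?thesis .
      qed
      finally show "(\<integral>\<^sup>+x. ennreal ((H M x * wu x) powr q) \<partial>lebesgue) \<le> ennreal ((C * Kc * (\<Prod>j\<in>{1..m}. B j) * a powr (1 / p)) powr q)"
        unfolding \<beta>_def .
    qed
  qed
  show ?thesis
  proof (intro exI[of _ C] conjI[OF C] allI impI, goal_cases)
    case (1 b B f F wv wu a Kc)
    then show ?case by (elim conjE) (rule main)
  qed
qed

text \<open>Heights are certain to be available only strictly above an infimum; the strict
  hypothesis provides one whether or not the infimum is attained.\<close>

lemma lux_norm_less_imp:
  fixes g :: "real ^ 'n::finite \<Rightarrow> real"
  assumes "lux_norm A g Q < ennreal r" and Q: "measure lebesgue Q > 0"
  shows "\<exists>t>0. t < r \<and> (\<integral>\<^sup>+x\<in>Q. ennreal (A (\<bar>g x\<bar> / t)) \<partial>lebesgue) \<le> ennreal (measure lebesgue Q)"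
proof -
  obtain t where t: "t > 0" "ennreal t < ennreal r"
     "ennreal (1 / measure lebesgue Q) * (\<integral>\<^sup>+x\<in>Q. ennreal (A (\<bar>g x\<bar> / t)) \<partial>lebesgue) \<le> 1"
    using assms(1) unfolding lux_norm_def Inf_less_iff by auto
  have "t < r" using t(1,2) by (simp add: ennreal_less_iff)
  moreover have "(\<integral>\<^sup>+x\<in>Q. ennreal (A (\<bar>g x\<bar> / t)) \<partial>lebesgue) \<le> ennreal (measure lebesgue Q)"
  proof -
    have "ennreal (measure lebesgue Q) * (ennreal (1 / measure lebesgue Q) * (\<integral>\<^sup>+x\<in>Q. ennreal (A (\<bar>g x\<bar> / t)) \<partial>lebesgue)) \<le> ennreal (measure lebesgue Q) * 1"
      by (rule mult_left_mono[OF t(3)]) simp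
    then show ?thesis using Q by (simp add: mult.assoc[symmetric] ennreal_mult[symmetric])
  qed
  ultimately show ?thesis using t(1) by blast
qed

lemma lux_norm_le:
  assumes "t > 0" "(\<integral>\<^sup>+x\<in>Q. ennreal (A (\<bar>g x\<bar> / t)) \<partial>lebesgue) \<le> ennreal (measure lebesgue Q)" and Q: "measure lebesgue Q > 0"
  shows "lux_norm A g Q \<le> ennreal t"
  unfolding lux_norm_def
proof (rule Inf_lower, rule imageI, rule CollectI, rule conjI)
  have "ennreal (1 / measure lebesgue Q) * (\<integral>\<^sup>+x\<in>Q. ennreal (A (\<bar>g x\<bar> / t)) \<partial>lebesgue) \<le> ennreal (1 / measure lebesgue Q) * ennreal (measure lebesgue Q)"
    by (rule mult_left_mono[OF assms(2)]) simp
  then show "ennreal (1 / measure lebesgue Q) * (\<integral>\<^sup>+x\<in>Q. ennreal (A (\<bar>g x\<bar> / t)) \<partial>lebesgue) \<le> 1"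
    using Q by (simp add: ennreal_mult[symmetric])
qed (rule assms(1))

lemma cube_facts:
  assumes "cube (Q :: (real ^ 'n::finite) set)"
  shows "Q \<in> sets lebesgue" "measure lebesgue Q > 0" "emeasure lebesgue Q = ennreal (measure lebesgue Q)"
proof -
  obtain a r where r: "r > 0" "Q = cbox a (a + (\<chi> i. r))" using assms unfolding cube_def by blast
  show "Q \<in> sets lebesgue" using r by simp
  have "a \<in> Q" using r by (auto simp: mem_box_cart)
  then have "Q \<noteq> {}" by blast
  then have "measure lebesgue Q = r ^ CARD('n)" using r by (simp add: content_cbox_cart)
  then show "measure lebesgue Q > 0" using r by simp
  have "emeasure lebesgue Q \<noteq> top" using r emeasure_lborel_cbox_finite by (simp add: less_top)
  then show "emeasure lebesgue Q = ennreal (measure lebesgue Q)" by (rule emeasure_eq_ennreal_measure)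
qed

text \<open>The logarithm is at least 1, so the modular dominates (|g| / t) powr r; arbitrarily
  small admissible heights then force the integral of |g| powr r to be 0.\<close>

lemma lux_norm_LlogL_eq_0:
  fixes g :: "real ^ 'n::finite \<Rightarrow> real"
  assumes Q: "cube Q" and g[measurable]: "g \<in> borel_measurable lebesgue" and r: "r \<ge> 1" and a: "a \<ge> 0"
    and 0: "lux_norm (LlogL r a) g Q = 0"
  shows "AE x in lebesgue. x \<in> Q \<longrightarrow> g x = 0"
proof -
  note Qf = cube_facts[OF Q]
  note [measurable] = Qf(1)
  have le: "(\<integral>\<^sup>+x\<in>Q. ennreal (\<bar>g x\<bar> powr r) \<partial>lebesgue) \<le> ennreal (e powr r * measure lebesgue Q)" if e: "e > 0" for e
  proof -
    have "lux_norm (LlogL r a) g Q < ennreal e" using 0 e by simp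
    then obtain t where t: "t > 0" "t < e" "(\<integral>\<^sup>+x\<in>Q. ennreal (LlogL r a (\<bar>g x\<bar> / t)) \<partial>lebesgue) \<le> ennreal (measure lebesgue Q)"
      using lux_norm_less_imp[OF _ Qf(2)] by blast
    have "(\<integral>\<^sup>+x\<in>Q. ennreal (\<bar>g x\<bar> powr r) \<partial>lebesgue) \<le> (\<integral>\<^sup>+x. ennreal (t powr r) * (ennreal (LlogL r a (\<bar>g x\<bar> / t)) * indicator Q x) \<partial>lebesgue)"
    proof (rule nn_integral_mono)
      fix x
      have L: "ln (exp 1 + \<bar>g x\<bar> / t) \<ge> 1" using t by (intro ln_exp1_ge_1) auto
      have "(\<bar>g x\<bar> / t) powr r * 1 \<le> LlogL r a (\<bar>g x\<bar> / t)"
        unfolding LlogL_def using L a by (intro mult_left_mono ge_one_powr_ge_zero) auto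
      then have "t powr r * (\<bar>g x\<bar> / t) powr r \<le> t powr r * LlogL r a (\<bar>g x\<bar> / t)" by (intro mult_left_mono) auto
      moreover have "t powr r * (\<bar>g x\<bar> / t) powr r = \<bar>g x\<bar> powr r" using t unfolding powr_mult[symmetric] by simp
      ultimately have "ennreal (\<bar>g x\<bar> powr r) \<le> ennreal (t powr r * LlogL r a (\<bar>g x\<bar> / t))" by (intro ennreal_leI) simp
      then show "ennreal (\<bar>g x\<bar> powr r) * indicator Q x \<le> ennreal (t powr r) * (ennreal (LlogL r a (\<bar>g x\<bar> / t)) * indicator Q x)"
        by (cases "x \<in> Q") (auto simp: ennreal_mult)
    qed
    also have "\<dots> = ennreal (t powr r) * (\<integral>\<^sup>+x\<in>Q. ennreal (LlogL r a (\<bar>g x\<bar> / t)) \<partial>lebesgue)"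
      by (rule nn_integral_cmult) measurable
    also have "\<dots> \<le> ennreal (e powr r) * ennreal (measure lebesgue Q)"
      using t r by (intro mult_mono ennreal_leI powr_mono2) auto
    finally show ?thesis using Qf(2) by (simp add: ennreal_mult)
  qed
  have "(\<integral>\<^sup>+x\<in>Q. ennreal (\<bar>g x\<bar> powr r) \<partial>lebesgue) \<le> 0"
  proof (rule ennreal_le_epsilon)
    fix e :: real assume e: "e > 0"
    define e' where "e' = (e / measure lebesgue Q) powr (1 / r)"
    have "e' > 0" "e' powr r * measure lebesgue Q = e" using e Qf(2) r by (auto simp: e'_def powr_powr)
    then show "(\<integral>\<^sup>+x\<in>Q. ennreal (\<bar>g x\<bar> powr r) \<partial>lebesgue) \<le> 0 + ennreal e" using le[of e'] by simp
  qed
  then have "(\<integral>\<^sup>+x\<in>Q. ennreal (\<bar>g x\<bar> powr r) \<partial>lebesgue) = 0" by simp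
  then have "AE x in lebesgue. ennreal (\<bar>g x\<bar> powr r) * indicator Q x = 0"
    by (subst (asm) nn_integral_0_iff_AE) auto
  then show ?thesis by eventually_elim (auto simp: indicator_def split: if_splits)
qed

text \<open>Multiplying the height by \<rho> \<ge> |Q0| / |Q| divides the modular by at least
  \<rho>, as r \<ge> 1, which makes up for the smaller normalising volume.\<close>

lemma lux_norm_LlogL_finite_mono:
  fixes g :: "real ^ 'n::finite \<Rightarrow> real"
  assumes Q: "cube Q" "cube Q0" "Q \<subseteq> Q0" and r: "r \<ge> 1" and a: "a \<ge> 0" and g[measurable]: "g \<in> borel_measurable lebesgue"
    and fin: "lux_norm (LlogL r a) g Q0 < top"
  shows "lux_norm (LlogL r a) g Q < top"
proof -
  note Qf = cube_facts[OF Q(1)] cube_facts[OF Q(2)]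
  note [measurable] = Qf(1,4)
  obtain L where "lux_norm (LlogL r a) g Q0 = ennreal L" "L \<ge> 0" using fin by (metis ennreal_cases less_irrefl)
  then have "lux_norm (LlogL r a) g Q0 < ennreal (L + 1)" by (simp add: ennreal_less_iff)
  then obtain t where t: "t > 0" "(\<integral>\<^sup>+x\<in>Q0. ennreal (LlogL r a (\<bar>g x\<bar> / t)) \<partial>lebesgue) \<le> ennreal (measure lebesgue Q0)"
    using lux_norm_less_imp[OF _ Qf(5)] by blast
  define \<rho> where "\<rho> = max 1 (measure lebesgue Q0 / measure lebesgue Q)"
  have \<rho>: "\<rho> \<ge> 1" "measure lebesgue Q0 / \<rho> \<le> measure lebesgue Q"
  proof -
    show "\<rho> \<ge> 1" by (simp add: \<rho>_def)
    have "measure lebesgue Q0 / measure lebesgue Q \<le> \<rho>" by (simp add: \<rho>_def)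
    then show "measure lebesgue Q0 / \<rho> \<le> measure lebesgue Q" using Qf(2) \<open>\<rho> \<ge> 1\<close> by (simp add: field_simps)
  qed
  have "(\<integral>\<^sup>+x\<in>Q. ennreal (LlogL r a (\<bar>g x\<bar> / (t * \<rho>))) \<partial>lebesgue) \<le> (\<integral>\<^sup>+x. ennreal (1 / \<rho>) * (ennreal (LlogL r a (\<bar>g x\<bar> / t)) * indicator Q0 x) \<partial>lebesgue)"
  proof (rule nn_integral_mono)
    fix x
    let ?y = "\<bar>g x\<bar> / t"
    have y: "?y \<ge> 0" using t by simp
    have "LlogL r a (\<bar>g x\<bar> / (t * \<rho>)) = (?y / \<rho>) powr r * ln (exp 1 + ?y / \<rho>) powr a" by (simp add: LlogL_def)
    also have "\<dots> \<le> (1 / \<rho> * ?y powr r) * ln (exp 1 + ?y) powr a"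
    proof (intro mult_mono powr_mono2)
      have "(?y / \<rho>) powr r = ?y powr r / \<rho> powr r" by (rule powr_divide)
      also have "\<dots> \<le> ?y powr r / \<rho> powr 1" using \<rho> r by (intro divide_left_mono powr_mono mult_pos_pos) auto
      finally show "(?y / \<rho>) powr r \<le> 1 / \<rho> * ?y powr r" using \<rho> by simp
      have "?y / \<rho> \<le> ?y / 1" using y \<rho> by (intro divide_left_mono) auto
      then have "?y / \<rho> \<le> ?y" by simp
      then show "ln (exp 1 + ?y / \<rho>) \<le> ln (exp 1 + ?y)" using y \<rho> t(1) by (subst ln_le_cancel_iff) (auto intro!: add_pos_nonneg)
      show "0 \<le> ln (exp 1 + ?y / \<rho>)" using ln_exp1_ge_1[of "?y / \<rho>"] t(1) \<rho> by simp
    qed (use a \<rho> in auto)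
    also have "\<dots> = 1 / \<rho> * LlogL r a ?y" by (simp add: LlogL_def)
    finally have "ennreal (LlogL r a (\<bar>g x\<bar> / (t * \<rho>))) \<le> ennreal (1 / \<rho>) * ennreal (LlogL r a ?y)"
      using \<rho> by (subst ennreal_mult[symmetric]) (auto intro: ennreal_leI)
    then show "ennreal (LlogL r a (\<bar>g x\<bar> / (t * \<rho>))) * indicator Q x \<le> ennreal (1 / \<rho>) * (ennreal (LlogL r a ?y) * indicator Q0 x)"
      using Q(3) by (auto simp: indicator_def)
  qed
  also have "\<dots> = ennreal (1 / \<rho>) * (\<integral>\<^sup>+x\<in>Q0. ennreal (LlogL r a (\<bar>g x\<bar> / t)) \<partial>lebesgue)"
    by (rule nn_integral_cmult) measurable
  also have "\<dots> \<le> ennreal (1 / \<rho>) * ennreal (measure lebesgue Q0)" by (intro mult_left_mono t) auto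
  also have "\<dots> = ennreal (measure lebesgue Q0 / \<rho>)" using \<rho> by (subst ennreal_mult[symmetric]) auto
  also have "\<dots> \<le> ennreal (measure lebesgue Q)" using \<rho> by (intro ennreal_leI) auto
  finally have "lux_norm (LlogL r a) g Q \<le> ennreal (t * \<rho>)" using t \<rho> Qf(2) by (intro lux_norm_le) auto
  then show ?thesis by (rule le_less_trans) simp
qed

section \<open>The two-weight inequality\<close>

text \<open>An exhaustion by concentric cubes; N + 1 keeps the side positive at N = 0, as
  \<open>cube\<close> demands.\<close>

definition ccube :: "nat \<Rightarrow> (real ^ 'n::finite) set" where
  "ccube N = cbox (\<chi> i. - (real N + 1)) ((\<chi> i. - (real N + 1)) + (\<chi> i. 2 * (real N + 1)))"

lemma cube_ccube: "cube (ccube N)"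
  unfolding cube_def ccube_def by (intro exI[of _ "\<chi> i. - (real N + 1)"] exI[of _ "2 * (real N + 1)"]) simp

lemma mem_ccube: "x \<in> ccube N \<longleftrightarrow> (\<forall>i. \<bar>x $ i\<bar> \<le> real N + 1)"
proof -
  have "x \<in> ccube N \<longleftrightarrow> (\<forall>i. - (real N + 1) \<le> x $ i \<and> x $ i \<le> real N + 1)"
    unfolding ccube_def mem_box_cart by simp
  moreover have "- c \<le> z \<and> z \<le> c \<longleftrightarrow> \<bar>z\<bar> \<le> c" for z c :: real by linarith
  ultimately show ?thesis by (simp only:)
qed

lemma ccube_mono: "M \<le> N \<Longrightarrow> ccube M \<subseteq> ccube N"
  by (auto simp: mem_ccube) (meson add_right_mono of_nat_le_iff order_trans)

lemma bounded_subset_ccube: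
  assumes "bounded (A :: (real ^ 'n::finite) set)"
  shows "\<exists>N. A \<subseteq> ccube N"
proof -
  obtain R where R: "\<And>x. x \<in> A \<Longrightarrow> norm x \<le> R" using assms unfolding bounded_iff by blast
  obtain N :: nat where "R \<le> real N" using real_arch_simple by blast
  have "\<bar>x $ i\<bar> \<le> real N + 1" if "x \<in> A" for x i
    using R[OF that] component_le_norm_cart[of x i] \<open>R \<le> real N\<close> by linarith
  then have "A \<subseteq> ccube N" by (auto simp: mem_ccube)
  then show ?thesis by blast
qed

lemma mem_ccube_ex: "\<exists>N. x \<in> ccube N"
  using bounded_subset_ccube[of "{x}"] by auto

text \<open>In \<open>ennreal\<close> 0 * \<infinity> = 0, so a finite K_hat bounds each norm only
  where the other is nonzero. The v norm never vanishes, as v > 0 almost everywhere, so the u norm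
  is finite on all cubes. The u norm is nonzero on large centred cubes, which makes the v norm
  finite there and hence on every subcube.\<close>

lemma K_hat_levels:
  fixes u v :: "real ^ 'n::finite \<Rightarrow> real"
  assumes p: "1 < p" "p \<le> s" "s \<le> q" and \<delta>: "\<delta> > 0"
    and u: "weight u" and v: "weight v" and upos: "emeasure lebesgue {x. u x > 0} > 0"
    and vpos: "AE x in lebesgue. v x > 0" and K: "K_hat \<alpha> p q m s \<delta> u v < \<infinity>"
  shows "enn2real (K_hat \<alpha> p q m s \<delta> u v) > 0"
    and "cube Q \<Longrightarrow> \<exists>lu>0. \<exists>lv>0.
      (\<integral>\<^sup>+x\<in>Q. ennreal (LlogL q ((real m + 1 / conj_exp s) * q + \<delta>) (u x powr (1 / q) / lu)) \<partial>lebesgue) \<le> ennreal (measure lebesgue Q) \<and>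
      (\<integral>\<^sup>+x\<in>Q. ennreal (LlogL (conj_exp p) ((real m + 1 / s) * conj_exp p + \<delta>) (v x powr (- 1 / p) / lv)) \<partial>lebesgue) \<le> ennreal (measure lebesgue Q) \<and>
      measure lebesgue Q powr (\<alpha> / real CARD('n) + 1 / q - 1 / p) * lu * lv \<le> 2 * enn2real (K_hat \<alpha> p q m s \<delta> u v)"
proof -
  have s1: "s > 1" and q1: "q > 1" using p by auto
  define au where "au = (real m + 1 / conj_exp s) * q + \<delta>"
  define av where "av = (real m + 1 / s) * conj_exp p + \<delta>"
  have au: "au \<ge> 0" unfolding au_def using conj_exp_facts(1)[OF s1] q1 \<delta> by (intro add_nonneg_nonneg mult_nonneg_nonneg) auto
  have p': "conj_exp p > 1" by (rule conj_exp_facts(1)[OF p(1)])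
  have av: "av \<ge> 0" unfolding av_def using p' s1 \<delta> by (intro add_nonneg_nonneg mult_nonneg_nonneg) auto
  define wu where "wu x = u x powr (1 / q)" for x
  define wv where "wv x = v x powr (- 1 / p)" for x
  have um[measurable]: "u \<in> borel_measurable lebesgue" and vm[measurable]: "v \<in> borel_measurable lebesgue"
    using u v locally_integrable_measurable by (auto simp: weight_def)
  have [measurable]: "wu \<in> borel_measurable lebesgue" "wv \<in> borel_measurable lebesgue"
    unfolding wu_def wv_def by measurable
  have u0: "u x \<ge> 0" and v0: "v x \<ge> 0" for x using u v by (auto simp: weight_def)
  define Lu where "Lu Q = lux_norm (LlogL q au) wu Q" for Q
  define Lv where "Lv Q = lux_norm (LlogL (conj_exp p) av) wv Q" for Q
  define e where "e = \<alpha> / real CARD('n) + 1 / q - 1 / p"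
  define Kr where "Kr = enn2real (K_hat \<alpha> p q m s \<delta> u v)"
  have KQ: "ennreal (measure lebesgue Q powr e) * Lu Q * Lv Q \<le> ennreal Kr" if "cube Q" for Q
  proof -
    have "ennreal (measure lebesgue Q powr e) * Lu Q * Lv Q \<le> K_hat \<alpha> p q m s \<delta> u v"
      unfolding K_hat_def e_def Lu_def Lv_def au_def av_def wu_def wv_def
      by (rule SUP_upper2[of Q]) (use that in auto)
    then show ?thesis using K by (simp add: Kr_def)
  qed
  have Lv0: "Lv Q \<noteq> 0" if Q: "cube Q" for Q
  proof
    assume "Lv Q = 0"
    then have "AE x in lebesgue. x \<in> Q \<longrightarrow> wv x = 0"
      unfolding Lv_def using p' av by (intro lux_norm_LlogL_eq_0[OF Q]) auto
    then have "AE x in lebesgue. x \<notin> Q" using vpos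
      by eventually_elim (auto simp: wv_def)
    then have "emeasure lebesgue Q = 0"
      using cube_facts(1)[OF Q] AE_iff_measurable[of Q lebesgue "\<lambda>x. x \<notin> Q"] by auto
    then show False using cube_facts(2,3)[OF Q] by simp
  qed
  \<comment> \<open>u is only known to be positive on some set of positive measure, so its norm may
    vanish on small cubes; if it vanished on arbitrarily large centred ones, u would be 0 almost
    everywhere.\<close>
  have Lu0: "\<exists>N0. \<forall>N\<ge>N0. Lu (ccube N) \<noteq> 0"
  proof (rule ccontr)
    assume "\<not> ?thesis"
    then have inf: "\<forall>N0. \<exists>N\<ge>N0. Lu (ccube N) = 0" by blast
    have "AE x in lebesgue. x \<in> ccube M \<longrightarrow> u x = 0" for M
    proof -
      obtain N where N: "N \<ge> M" "Lu (ccube N) = 0" using inf by blast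
      have "AE x in lebesgue. x \<in> ccube N \<longrightarrow> wu x = 0"
        using N(2) q1 au unfolding Lu_def by (intro lux_norm_LlogL_eq_0[OF cube_ccube]) auto
      then show ?thesis by eventually_elim (use ccube_mono[OF N(1)] in \<open>auto simp: wu_def\<close>)
    qed
    then have "AE x in lebesgue. \<forall>M. x \<in> ccube M \<longrightarrow> u x = 0" by (subst AE_all_countable) blast
    then have "AE x in lebesgue. \<not> u x > 0"
      by eventually_elim (use mem_ccube_ex in force)
    moreover have "{x \<in> space lebesgue. u x > 0} \<in> sets lebesgue" by measurable
    then have "{x. u x > 0} \<in> sets lebesgue" by simp
    then have "(AE x in lebesgue. \<not> u x > 0) \<longleftrightarrow> emeasure lebesgue {x. u x > 0} = 0"
      by (rule AE_iff_measurable) simp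
    ultimately show False using upos by (metis less_irrefl)
  qed
  then obtain N0 where N0: "\<And>N. N \<ge> N0 \<Longrightarrow> Lu (ccube N) \<noteq> 0" by blast
  have mpos: "ennreal (measure lebesgue Q powr e) \<noteq> 0" if "cube Q" for Q
    using cube_facts(2)[OF that] by simp
  show Kpos: "enn2real (K_hat \<alpha> p q m s \<delta> u v) > 0"
  proof -
    have "ennreal (measure lebesgue (ccube N0 :: (real ^ 'n) set) powr e) * Lu (ccube N0) * Lv (ccube N0) \<noteq> 0"
      using mpos[OF cube_ccube] Lv0[OF cube_ccube] N0[of N0] by simp
    then have "ennreal Kr \<noteq> 0" using KQ[OF cube_ccube, of N0] by (metis le_zero_eq)
    then show ?thesis unfolding Kr_def[symmetric] using enn2real_nonneg[of "K_hat \<alpha> p q m s \<delta> u v"]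
      by (simp add: Kr_def less_le)
  qed
  have Lufin: "Lu Q < top" if Q: "cube Q" for Q
  proof (rule ccontr)
    assume "\<not> ?thesis"
    then have "Lu Q = top" by (metis top.not_eq_extremum)
    then have "ennreal (measure lebesgue Q powr e) * Lu Q * Lv Q = top"
      using mpos[OF Q] Lv0[OF Q] by (simp add: ennreal_mult_top ennreal_top_mult)
    then show False using KQ[OF Q] by (simp add: top_unique)
  qed
  have Lvfin: "Lv Q < top" if Q: "cube Q" for Q
  proof -
    have "bounded Q" using Q unfolding cube_def by auto
    then obtain N1 where "Q \<subseteq> ccube N1" using bounded_subset_ccube by blast
    \<comment> \<open>Large enough both to contain Q and to have a nonzero u norm.\<close>
    define N where "N = max N0 N1"
    have QN: "Q \<subseteq> ccube N" using \<open>Q \<subseteq> ccube N1\<close> ccube_mono[of N1 N] by (auto simp: N_def)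
    have "Lv (ccube N) < top"
    proof (rule ccontr)
      assume "\<not> ?thesis"
      then have "Lv (ccube N) = top" by (metis top.not_eq_extremum)
      then have "ennreal (measure lebesgue (ccube N :: (real ^ 'n) set) powr e) * Lu (ccube N) * Lv (ccube N) = top"
        using mpos[OF cube_ccube] N0[of N] by (simp add: ennreal_mult_top N_def)
      then show False using KQ[OF cube_ccube, of N] by (simp add: top_unique)
    qed
    then show ?thesis unfolding Lv_def using p' av
      by (intro lux_norm_LlogL_finite_mono[OF Q cube_ccube QN]) auto
  qed
  show "\<exists>lu>0. \<exists>lv>0.
      (\<integral>\<^sup>+x\<in>Q. ennreal (LlogL q ((real m + 1 / conj_exp s) * q + \<delta>) (u x powr (1 / q) / lu)) \<partial>lebesgue) \<le> ennreal (measure lebesgue Q) \<and>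
      (\<integral>\<^sup>+x\<in>Q. ennreal (LlogL (conj_exp p) ((real m + 1 / s) * conj_exp p + \<delta>) (v x powr (- 1 / p) / lv)) \<partial>lebesgue) \<le> ennreal (measure lebesgue Q) \<and>
      measure lebesgue Q powr (\<alpha> / real CARD('n) + 1 / q - 1 / p) * lu * lv \<le> 2 * enn2real (K_hat \<alpha> p q m s \<delta> u v)"
    if Q: "cube Q"
  proof -
    obtain x where x: "Lu Q = ennreal x" "x \<ge> 0" using Lufin[OF Q] by (metis ennreal_cases less_irrefl)
    obtain y where y: "Lv Q = ennreal y" "y \<ge> 0" using Lvfin[OF Q] by (metis ennreal_cases less_irrefl)
    define M where "M = measure lebesgue Q powr e"
    have M: "M > 0" using cube_facts(2)[OF Q] by (simp add: M_def)
    have "ennreal (M * x * y) \<le> ennreal Kr" using KQ[OF Q] x y M by (simp add: M_def ennreal_mult)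
    then have "M * x * y \<le> Kr" using Kpos by (subst (asm) ennreal_le_iff) (auto simp: Kr_def)
    then have lt: "M * x * y < 2 * Kr" using Kpos by (simp add: Kr_def)
    \<comment> \<open>Both norms are raised by a small h: this yields admissible positive heights
      even for zero or unattained infima, and M * x * y \<le> Kr < 2 * Kr leaves room for
      it.\<close>
    have "((\<lambda>h. M * (x + h) * (y + h)) \<longlongrightarrow> M * (x + 0) * (y + 0)) (at_right 0)" by (intro tendsto_intros)
    then have "((\<lambda>h. M * (x + h) * (y + h)) \<longlongrightarrow> M * x * y) (at_right 0)" by simp
    then have "\<forall>\<^sub>F h in at_right 0. M * (x + h) * (y + h) < 2 * Kr" using lt by (rule order_tendstoD(2))
    moreover have "\<forall>\<^sub>F h :: real in at_right 0. h > 0" by (simp add: eventually_at_right_less)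
    ultimately have "\<forall>\<^sub>F h in at_right 0. M * (x + h) * (y + h) < 2 * Kr \<and> h > 0" by (rule eventually_conj)
    then obtain h where h: "M * (x + h) * (y + h) < 2 * Kr" "h > 0"
      using eventually_happens'[OF trivial_limit_at_right_real] by blast
    have "lux_norm (LlogL q au) wu Q < ennreal (x + h)" using x h unfolding Lu_def by (simp add: ennreal_less_iff)
    then obtain lu where lu: "lu > 0" "lu < x + h" "(\<integral>\<^sup>+z\<in>Q. ennreal (LlogL q au (\<bar>wu z\<bar> / lu)) \<partial>lebesgue) \<le> ennreal (measure lebesgue Q)"
      using lux_norm_less_imp[OF _ cube_facts(2)[OF Q]] by blast
    have "lux_norm (LlogL (conj_exp p) av) wv Q < ennreal (y + h)" using y h unfolding Lv_def by (simp add: ennreal_less_iff)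
    then obtain lv where lv: "lv > 0" "lv < y + h" "(\<integral>\<^sup>+z\<in>Q. ennreal (LlogL (conj_exp p) av (\<bar>wv z\<bar> / lv)) \<partial>lebesgue) \<le> ennreal (measure lebesgue Q)"
      using lux_norm_less_imp[OF _ cube_facts(2)[OF Q]] by blast
    have "M * lu * lv \<le> M * (x + h) * (y + h)"
      using M lu lv x y h by (intro mult_mono) auto
    then have "M * lu * lv \<le> 2 * Kr" using h by simp
    moreover have "\<bar>wu z\<bar> = u z powr (1 / q)" "\<bar>wv z\<bar> = v z powr (- 1 / p)" for z by (auto simp: wu_def wv_def)
    ultimately show ?thesis using lu lv unfolding M_def e_def Kr_def au_def av_def by (intro exI[of _ lu] conjI exI[of _ lv]) auto
  qed
qed

text \<open>Zero oscillation makes b constant almost everywhere on every centred cube; these cubes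
  are nested, so the constants agree.\<close>

lemma bmo_norm_eq_0:
  fixes b :: "real ^ 'n::finite \<Rightarrow> real"
  assumes b: "locally_integrable b" and 0: "bmo_norm b = 0"
  shows "\<exists>c. AE x in lebesgue. b x = c"
proof -
  note [measurable] = locally_integrable_measurable[OF b]
  define a where "a N = 1 / measure lebesgue (ccube N :: (real ^ 'n) set) * (LINT y:ccube N|lebesgue. b y)" for N
  have [measurable]: "ccube N \<in> sets lebesgue" for N by (rule cube_facts(1)[OF cube_ccube])
  have AE_N: "AE x in lebesgue. x \<in> ccube N \<longrightarrow> b x = a N" for N
  proof -
    have "ennreal (1 / measure lebesgue (ccube N :: (real ^ 'n) set)) * (\<integral>\<^sup>+x\<in>ccube N. ennreal \<bar>b x - a N\<bar> \<partial>lebesgue) \<le> bmo_norm b"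
      unfolding bmo_norm_def a_def by (rule SUP_upper) (simp add: cube_ccube)
    then have "ennreal (1 / measure lebesgue (ccube N :: (real ^ 'n) set)) * (\<integral>\<^sup>+x\<in>ccube N. ennreal \<bar>b x - a N\<bar> \<partial>lebesgue) = 0" using 0 by simp
    then have "(\<integral>\<^sup>+x\<in>ccube N. ennreal \<bar>b x - a N\<bar> \<partial>lebesgue) = 0"
      using cube_facts(2)[OF cube_ccube, where 'n = 'n, of N] by simp
    then have "AE x in lebesgue. ennreal \<bar>b x - a N\<bar> * indicator (ccube N) x = 0"
      by (subst (asm) nn_integral_0_iff_AE) auto
    then show ?thesis by eventually_elim (auto simp: indicator_def split: if_splits)
  qed
  have eq: "a N = a 0" for N
  proof (rule ccontr)
    assume ne: "a N \<noteq> a 0"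
    have "AE x in lebesgue. x \<notin> (ccube 0 :: (real ^ 'n) set)"
      using AE_N[of N] AE_N[of 0] by eventually_elim (use ne ccube_mono[of 0 N] in auto)
    then have "emeasure lebesgue (ccube 0 :: (real ^ 'n) set) = 0"
      using AE_iff_measurable[of "ccube 0 :: (real ^ 'n) set" lebesgue "\<lambda>x. x \<notin> ccube 0"] by auto
    then show False using cube_facts(2,3)[OF cube_ccube, where 'n = 'n, of 0] by simp
  qed
  have "AE x in lebesgue. x \<in> ccube N \<longrightarrow> b x = a 0" for N
    using AE_N[of N] unfolding eq[of N] .
  then have "AE x in lebesgue. \<forall>N. x \<in> ccube N \<longrightarrow> b x = a 0"
    by (subst AE_all_countable) blast
  then have "AE x in lebesgue. b x = a 0"
    by eventually_elim (use mem_ccube_ex in blast)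
  then show ?thesis by blast
qed

text \<open>Covers the symbols that cannot be normalised: a factor b j x - b j y vanishing for
  almost all x and y kills the commutator.\<close>

lemma frac_comm_eq_0:
  fixes b :: "nat \<Rightarrow> real ^ 'n::finite \<Rightarrow> real"
  assumes "j \<in> {1..m}" "locally_integrable (b j)" "bmo_norm (b j) = 0"
  shows "AE x in lebesgue. frac_comm \<alpha> m b f x = 0"
proof -
  obtain c where c: "AE x in lebesgue. b j x = c" using bmo_norm_eq_0[OF assms(2,3)] by blast
  then show ?thesis
  proof eventually_elim
    case (elim x)
    have "AE y in lebesgue. (\<Prod>j\<in>{1..m}. b j x - b j y) * f y / dist x y powr (real CARD('n) - \<alpha>) = 0"
      using c
    proof eventually_elim
      case (elim y)
      then have "(\<Prod>j\<in>{1..m}. b j x - b j y) = 0"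
        using assms(1) \<open>b j x = c\<close> by (intro prod_zero) auto
      then show ?case by simp
    qed
    then show ?case unfolding frac_comm_def by (rule integral_eq_zero_AE)
  qed
qed

theorem theorem1p4:
  fixes p q \<alpha> s \<delta> :: real and m :: nat
  assumes "1 < p" "p \<le> q" "0 < \<alpha>" "\<alpha> < real CARD('n::finite)" "1 \<le> m"
    and "p \<le> s" "s \<le> q" "0 < \<delta>"
  shows "\<exists>C::real. C > 0 \<and>
    (\<forall>(u :: real ^ 'n \<Rightarrow> real) v (b :: nat \<Rightarrow> real ^ 'n \<Rightarrow> real) f.
      weight u \<and> weight v \<and> emeasure lebesgue {x. u x > 0} > 0 \<and>
      (AE x in lebesgue. v x > 0) \<and>
      (\<forall>j\<in>{1..m}. in_BMO (b j)) \<and>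
      K_hat \<alpha> p q m s \<delta> u v < \<infinity> \<and>
      f \<in> borel_measurable lebesgue
      \<longrightarrow> Lp_w_norm q u (frac_comm \<alpha> m b f)
          \<le> ennreal C * K_hat \<alpha> p q m s \<delta> u v * (\<Prod>j\<in>{1..m}. bmo_norm (b j)) * Lp_w_norm p v f)"
proof -
  note p = assms(1,6,7)
  have q: "q > 1" using assms by simp
  obtain C where C: "C > 0" and Lq: "\<And>(b :: nat \<Rightarrow> real ^ 'n \<Rightarrow> real) B f F wv wu a Kc.
     (\<forall>j\<in>{1..m}. locally_integrable (b j) \<and> bmo_norm (b j) \<le> ennreal (B j) \<and> B j > 0) \<and>
     f \<in> borel_measurable lebesgue \<and> F \<in> borel_measurable lebesgue \<and>
     wv \<in> borel_measurable lebesgue \<and> wu \<in> borel_measurable lebesgue \<and>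
     (\<forall>x. F x \<ge> 0) \<and> (\<forall>x. wv x \<ge> 0) \<and> (\<forall>x. wu x \<ge> 0) \<and>
     (AE x in lebesgue. \<bar>f x\<bar> = F x * wv x) \<and>
     (\<integral>\<^sup>+x. ennreal (F x powr p) \<partial>lebesgue) = ennreal a \<and> a \<ge> 0 \<and> Kc \<ge> 0 \<and> (\<forall>\<tau>. bump_cond \<alpha> p q m s \<delta> \<tau> wu wv Kc)
     \<Longrightarrow> (\<integral>\<^sup>+x. ennreal ((\<bar>frac_comm \<alpha> m b f x\<bar> * wu x) powr q) \<partial>lebesgue)
        \<le> ennreal ((C * Kc * (\<Prod>j\<in>{1..m}. B j) * a powr (1 / p)) powr q)"
    using frac_comm_Lq_bound[where 'n = 'n, OF p assms(3,4,5,8)] by blast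
  \<comment> \<open>The factor 2 is the slack from \<open>K_hat_levels\<close>.\<close>
  have main: "Lp_w_norm q u (frac_comm \<alpha> m b f)
          \<le> ennreal (2 * C) * K_hat \<alpha> p q m s \<delta> u v * (\<Prod>j\<in>{1..m}. bmo_norm (b j)) * Lp_w_norm p v f"
    if u: "weight u" and v: "weight v" and upos: "emeasure lebesgue {x. u x > 0} > 0"
      and vpos: "AE x in lebesgue. v x > 0" and b: "\<forall>j\<in>{1..m}. in_BMO (b j)"
      and K: "K_hat \<alpha> p q m s \<delta> u v < \<infinity>" and f[measurable]: "f \<in> borel_measurable lebesgue"
    for u v f :: "real ^ 'n \<Rightarrow> real" and b :: "nat \<Rightarrow> real ^ 'n \<Rightarrow> real"
  proof (cases "\<exists>j\<in>{1..m}. bmo_norm (b j) = 0")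
    case True
    then obtain j where "j \<in> {1..m}" "bmo_norm (b j) = 0" by blast
    then have "AE x in lebesgue. frac_comm \<alpha> m b f x = 0"
      using b by (intro frac_comm_eq_0) (auto simp: in_BMO_def)
    then have "(\<integral>\<^sup>+x. ennreal (\<bar>frac_comm \<alpha> m b f x\<bar> powr q * u x) \<partial>lebesgue) = (\<integral>\<^sup>+x. 0 \<partial>(lebesgue :: (real ^ 'n) measure))"
      by (intro nn_integral_cong_AE) (auto elim!: eventually_mono)
    then show ?thesis by (simp add: Lp_w_norm_def Let_def)
  next
    case False
    define Kr where "Kr = enn2real (K_hat \<alpha> p q m s \<delta> u v)"
    have Kr: "Kr > 0" "K_hat \<alpha> p q m s \<delta> u v = ennreal Kr"
      unfolding Kr_def using K_hat_levels(1)[OF p assms(8) u v upos vpos K] K by auto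
    define B where "B j = enn2real (bmo_norm (b j))" for j
    have bf: "bmo_norm (b j) < top" if "j \<in> {1..m}" for j using b that by (auto simp: in_BMO_def)
    have B: "bmo_norm (b j) = ennreal (B j)" "B j > 0" if j: "j \<in> {1..m}" for j
    proof -
      show "bmo_norm (b j) = ennreal (B j)" unfolding B_def using bf[OF j] by simp
      then show "B j > 0" using False j by (metis B_def ennreal_eq_0_iff not_less)
    qed
    have prodB: "(\<Prod>j\<in>{1..m}. bmo_norm (b j)) = ennreal (\<Prod>j\<in>{1..m}. B j)"
    proof -
      have "(\<Prod>j\<in>{1..m}. bmo_norm (b j)) = (\<Prod>j\<in>{1..m}. ennreal (B j))" using B by (intro prod.cong) auto
      also have "\<dots> = ennreal (\<Prod>j\<in>{1..m}. B j)" using B by (intro prod_ennreal) (auto intro: less_imp_le)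
      finally show ?thesis .
    qed
    have prodpos: "(\<Prod>j\<in>{1..m}. B j) > 0" using B by (intro prod_pos) auto
    define I where "I = (\<integral>\<^sup>+x. ennreal (\<bar>f x\<bar> powr p * v x) \<partial>lebesgue)"
    show ?thesis
    proof (cases "I = \<infinity>")
      \<comment> \<open>The right side is infinite because its other factors are positive; this uses
        K_hat > 0 and the exclusion of zero seminorms.\<close>
      case True
      then have "Lp_w_norm p v f = top" by (simp add: Lp_w_norm_def I_def)
      then have "ennreal (2 * C) * K_hat \<alpha> p q m s \<delta> u v * (\<Prod>j\<in>{1..m}. bmo_norm (b j)) * Lp_w_norm p v f = top"
        unfolding Kr(2) prodB using C Kr(1) prodpos
        by (simp add: ennreal_mult_top ennreal_mult[symmetric] less_imp_neq[symmetric] del: prod_zero_iff)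
      then show ?thesis by simp
    next
      case False
      then obtain a where a: "I = ennreal a" "a \<ge> 0" by (metis ennreal_cases infinity_ennreal_def)
      have [measurable]: "u \<in> borel_measurable lebesgue" "v \<in> borel_measurable lebesgue"
        using u v locally_integrable_measurable by (auto simp: weight_def)
      have u0: "u x \<ge> 0" and v0: "v x \<ge> 0" for x using u v by (auto simp: weight_def)
      \<comment> \<open>The L^p norm of F is that of f in L^p(v), and |f| = F * wv where v > 0; from
        here on the weights act only through wu and wv.\<close>
      define F where "F x = \<bar>f x\<bar> * v x powr (1 / p)" for x
      define wv where "wv x = v x powr (- 1 / p)" for x
      define wu where "wu x = u x powr (1 / q)" for x
      have [measurable]: "F \<in> borel_measurable lebesgue" "wv \<in> borel_measurable lebesgue" "wu \<in> borel_measurable lebesgue"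
        unfolding F_def wv_def wu_def by measurable
      have Fp: "F x powr p = \<bar>f x\<bar> powr p * v x" for x
        using v0[of x] assms(1) by (simp add: F_def powr_mult powr_powr)
      have fF: "AE x in lebesgue. \<bar>f x\<bar> = F x * wv x"
        using vpos
      proof eventually_elim
        case (elim x)
        then have "v x powr (1 / p) * v x powr (- 1 / p) = 1" by (simp flip: powr_add)
        then show ?case by (simp add: F_def wv_def mult.assoc)
      qed
      \<comment> \<open>The heights were obtained on closed cubes; null sets carry them over to the
        grid cubes.\<close>
      have bump: "bump_cond \<alpha> p q m s \<delta> \<tau> wu wv (2 * Kr)" for \<tau>
        unfolding bump_cond_def
      proof (intro allI)
        fix P
        obtain lu lv where l: "lu > 0" "lv > 0"
          "(\<integral>\<^sup>+x\<in>dclosed \<tau> P. ennreal (LlogL q ((real m + 1 / conj_exp s) * q + \<delta>) (u x powr (1 / q) / lu)) \<partial>lebesgue) \<le> ennreal (measure lebesgue (dclosed \<tau> P))"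
          "(\<integral>\<^sup>+x\<in>dclosed \<tau> P. ennreal (LlogL (conj_exp p) ((real m + 1 / s) * conj_exp p + \<delta>) (v x powr (- 1 / p) / lv)) \<partial>lebesgue) \<le> ennreal (measure lebesgue (dclosed \<tau> P))"
          "measure lebesgue (dclosed \<tau> P) powr (\<alpha> / real CARD('n) + 1 / q - 1 / p) * lu * lv \<le> 2 * Kr"
          using K_hat_levels(2)[OF p assms(8) u v upos vpos K cube_dclosed[of \<tau> P]] unfolding Kr_def by blast
        then show "\<exists>lu>0. \<exists>lv>0.
          (dint \<tau> P (\<lambda>x. LlogL q ((real m + 1 / conj_exp s) * q + \<delta>) (wu x / lu))) \<le> ennreal (dvol P) \<and>
          (dint \<tau> P (\<lambda>x. LlogL (conj_exp p) ((real m + 1 / s) * conj_exp p + \<delta>) (wv x / lv))) \<le> ennreal (dvol P) \<and>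
          dvol P powr (\<alpha> / real CARD('n) + 1 / q - 1 / p) * lu * lv \<le> 2 * Kr"
          unfolding nn_integral_dclosed_dcube measure_dclosed wu_def wv_def by blast
      qed
      define X where "X = C * (2 * Kr) * (\<Prod>j\<in>{1..m}. B j) * a powr (1 / p)"
      have X: "X \<ge> 0" unfolding X_def using C Kr(1) prodpos by (intro mult_nonneg_nonneg) auto
      have "(\<integral>\<^sup>+x. ennreal ((\<bar>frac_comm \<alpha> m b f x\<bar> * wu x) powr q) \<partial>lebesgue) \<le> ennreal (X powr q)"
        unfolding X_def
      proof (rule Lq[where F = F and wv = wv], intro conjI ballI allI)
        show "(\<integral>\<^sup>+x. ennreal (F x powr p) \<partial>lebesgue) = ennreal a" unfolding Fp a(1)[symmetric] I_def ..
        show "locally_integrable (b j)" if "j \<in> {1..m}" for j using b that by (auto simp: in_BMO_def)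
        show "bmo_norm (b j) \<le> ennreal (B j)" "B j > 0" if "j \<in> {1..m}" for j using B[OF that] by auto
        show "bump_cond \<alpha> p q m s \<delta> \<tau> wu wv (2 * Kr)" for \<tau> by (rule bump)
      qed (use a fF Kr in \<open>auto simp: F_def wv_def wu_def\<close>)
      also have "(\<integral>\<^sup>+x. ennreal ((\<bar>frac_comm \<alpha> m b f x\<bar> * wu x) powr q) \<partial>lebesgue) = (\<integral>\<^sup>+x. ennreal (\<bar>frac_comm \<alpha> m b f x\<bar> powr q * u x) \<partial>lebesgue)"
        using u0 q by (simp add: wu_def powr_mult powr_powr)
      finally have le: "(\<integral>\<^sup>+x. ennreal (\<bar>frac_comm \<alpha> m b f x\<bar> powr q * u x) \<partial>lebesgue) \<le> ennreal (X powr q)" (is "?J \<le> _") .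
      then have "?J \<noteq> top" by (auto simp: top_unique)
      then obtain y where y: "?J = ennreal y" "y \<ge> 0"
        using ennreal_cases[of ?J] by blast
      have "y \<le> X powr q" using le y by (simp add: ennreal_le_iff)
      then have "y powr (1 / q) \<le> (X powr q) powr (1 / q)" using y q by (intro powr_mono2) auto
      also have "\<dots> = X" using X q by (simp add: powr_powr)
      finally have "Lp_w_norm q u (frac_comm \<alpha> m b f) \<le> ennreal X"
        unfolding Lp_w_norm_def Let_def y(1) using y(2) by (simp add: ennreal_leI)
      also have "ennreal X = ennreal (2 * C) * K_hat \<alpha> p q m s \<delta> u v * (\<Prod>j\<in>{1..m}. bmo_norm (b j)) * Lp_w_norm p v f"
      proof -
        have "Lp_w_norm p v f = ennreal (a powr (1 / p))"
          unfolding Lp_w_norm_def Let_def I_def[symmetric] a(1) using a(2) by simp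
        moreover have "X = 2 * C * Kr * (\<Prod>j\<in>{1..m}. B j) * a powr (1 / p)" by (simp add: X_def)
        ultimately show ?thesis unfolding Kr(2) prodB using C Kr(1) prodpos by (simp add: ennreal_mult)
      qed
      finally show ?thesis .
    qed
  qed
  show ?thesis
    using C main by (intro exI[of _ "2 * C"]) auto
qed

end
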